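(* Let $m\in(0,1)$, $\alpha\in(0,1]$, $q\geq2$, $\kappa\geq1$, $\theta>0$, $\mathbb I=(0,1)$, and $\gamma(x,t)=x-\theta t^\kappa$. (i) If \[ s>\max\left\{\frac12-\frac m4,\ \frac12-\frac{m\alpha}{q}\right\}, \] then for every $\mu\in\mathcal M^\alpha$ there is a constant $C<\infty$ such that for all $f\in H^s(\mathbb R)$ \[ \Big\|e^{it(-\Delta)^{m/2}}f(\gamma(x,t))\Big\|_{L^q_x(\mathbb I,d\mu)L^\infty_t(\mathbb I)}\leq C\|f\|_{H^s(\mathbb R)} . \] (ii) This is sharp in the following sense: if \[ s<\max\left\{\frac12-\frac m4,\ \frac12-\frac{m\alpha}{q}\right\}, \] then there exists $\mu\in\mathcal M^\alpha$ for which the inequality in (i) fails, i.e. does not hold for all $f\in H^s(\mathbb R)$ with any finite constant $C$.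
   Context: $H^s(\mathbb R)$ is the inhomogeneous $L^2$-Sobolev space with norm $\|f\|_{H^s(\mathbb R)}=\|(1-\Delta)^{s/2}f\|_{L^2(\mathbb R)}$. With $\widehat f(\xi)=\int_{\mathbb R}e^{-ix\xi}f(x)\,dx$, one (formally) sets \[ e^{it(-\Delta)^{m/2}}f(x)=(2\pi)^{-1}\int_{\mathbb R}e^{i(x\xi+t|\xi|^m)}\widehat f(\xi)\,d\xi . \] For $f\in H^s(\mathbb R)$ the value at a given point $x$ and time $t$ is understood as $\lim_{N\to\infty}(2\pi)^{-1}\int_{\mathbb R}e^{i(x\xi+t|\xi|^m)}e^{-|\xi|^2/N^2}\widehat f(\xi)\,d\xi$ whenever this limit exists; $e^{it(-\Delta)^{m/2}}f(\gamma(x,t))$ is the value at the point $\gamma(x,t)$ and time $t$. $\mathcal M^\alpha$ is the collection of (positive Borel) $\alpha$-dimensional measures $\mu$ on $\mathbb R$ supported in the unit ball, where $\mu$ is $\alpha$-dimensional if $\sup_{x\in\mathbb R,\,r>0}\mu(B(x,r))/r^\alpha<\infty$, with $B(x,r)$ the ball of radius $r$ centered at $x$. The mixed norm is \[ \|F\|_{L^q_x(\mathbb I,d\mu)L^\infty_t(\mathbb I)}=\Big(\int_{\mathbb I}\sup_{t\in\mathbb I}|F(x,t)|^q\,d\mu(x)\Big)^{1/q}. \] *)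

theory Defs
  imports "HOL-Analysis.Analysis"
begin

section \<open>Schwartz functions and tempered distributions on the real line\<close>

definition vderiv :: "(real \<Rightarrow> complex) \<Rightarrow> real \<Rightarrow> complex" where
  "vderiv \<phi> = (\<lambda>x. vector_derivative \<phi> (at x))"

definition schwartz :: "(real \<Rightarrow> complex) set" where
  "schwartz = {\<phi>. \<forall>k. (\<forall>x. (vderiv ^^ k) \<phi> differentiable (at x)) \<and>
                      (\<forall>n. bounded (range (\<lambda>x. x ^ n *\<^sub>R (vderiv ^^ k) \<phi> x)))}"

definition schwartz_seminorm :: "nat \<Rightarrow> nat \<Rightarrow> (real \<Rightarrow> complex) \<Rightarrow> real" where
  "schwartz_seminorm n k \<phi> = (SUP x. norm (x ^ n *\<^sub>R (vderiv ^^ k) \<phi> x))"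

text \<open>Distributions are total functionals in HOL; only their values on \<^const>\<open>schwartz\<close> matter.\<close>

type_synonym dist = "(real \<Rightarrow> complex) \<Rightarrow> complex"

definition tempered :: "dist \<Rightarrow> bool" where
  "tempered T \<longleftrightarrow>
     (\<forall>\<phi>\<in>schwartz. \<forall>\<psi>\<in>schwartz. T (\<lambda>x. \<phi> x + \<psi> x) = T \<phi> + T \<psi>) \<and>
     (\<forall>\<phi>\<in>schwartz. \<forall>c. T (\<lambda>x. c * \<phi> x) = c * T \<phi>) \<and>
     (\<exists>C K. \<forall>\<phi>\<in>schwartz. norm (T \<phi>) \<le> C * (\<Sum>n\<le>K. \<Sum>k\<le>K. schwartz_seminorm n k \<phi>))"

definition represents :: "(real \<Rightarrow> complex) \<Rightarrow> dist \<Rightarrow> bool" where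
  "represents g T \<longleftrightarrow> g \<in> borel_measurable borel \<and>
     (\<forall>\<phi>\<in>schwartz. integrable lborel (\<lambda>x. g x * \<phi> x) \<and> T \<phi> = (LINT x|lborel. g x * \<phi> x))"

section \<open>Fourier transform\<close>

definition fourier :: "(real \<Rightarrow> complex) \<Rightarrow> real \<Rightarrow> complex" where
  "fourier \<phi> \<xi> = (LINT x|lborel. cis (- (x * \<xi>)) * \<phi> x)"

definition inv_fourier :: "(real \<Rightarrow> complex) \<Rightarrow> real \<Rightarrow> complex" where
  "inv_fourier \<phi> x = complex_of_real (1 / (2 * pi)) * (LINT \<xi>|lborel. cis (x * \<xi>) * \<phi> \<xi>)"

definition fourier_dist :: "dist \<Rightarrow> dist" where
  "fourier_dist T = (\<lambda>\<phi>. T (fourier \<phi>))"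

definition inv_fourier_dist :: "dist \<Rightarrow> dist" where
  "inv_fourier_dist T = (\<lambda>\<phi>. T (inv_fourier \<phi>))"

definition mult_dist :: "(real \<Rightarrow> complex) \<Rightarrow> dist \<Rightarrow> dist" where
  "mult_dist w T = (\<lambda>\<phi>. T (\<lambda>x. w x * \<phi> x))"

text \<open>A function version of the distributional Fourier transform. It exists, and is unique almost
  everywhere, for every element of a Sobolev space \<open>H\<^sup>s\<close>.\<close>

definition fhat :: "dist \<Rightarrow> real \<Rightarrow> complex" where
  "fhat f = (SOME g. represents g (fourier_dist f))"

section \<open>Sobolev spaces\<close>

definition bessel :: "real \<Rightarrow> dist \<Rightarrow> dist"  \<comment> \<open>\<open>(1 - \<Delta>)\<^sup>s\<^sup>/\<^sup>2\<close>\<close> where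
  "bessel s f = inv_fourier_dist
     (mult_dist (\<lambda>\<xi>. complex_of_real ((1 + \<xi>\<^sup>2) powr (s / 2))) (fourier_dist f))"

definition L2_fun :: "(real \<Rightarrow> complex) \<Rightarrow> bool" where
  "L2_fun h \<longleftrightarrow> h \<in> borel_measurable borel \<and> integrable lborel (\<lambda>x. (cmod (h x))\<^sup>2)"

definition L2_norm :: "(real \<Rightarrow> complex) \<Rightarrow> real" where
  "L2_norm h = sqrt (LINT x|lborel. (cmod (h x))\<^sup>2)"

definition sobolev :: "real \<Rightarrow> dist set" where
  "sobolev s = {f. tempered f \<and> (\<exists>h. L2_fun h \<and> represents h (bessel s f))}"

definition sobolev_norm :: "real \<Rightarrow> dist \<Rightarrow> real" where
  "sobolev_norm s f = L2_norm (SOME h. L2_fun h \<and> represents h (bessel s f))"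

section \<open>Pointwise values of the evolution\<close>

definition evol_reg :: "real \<Rightarrow> dist \<Rightarrow> real \<Rightarrow> real \<Rightarrow> real \<Rightarrow> complex" where
  "evol_reg m f N t x = complex_of_real (1 / (2 * pi)) *
     (LINT \<xi>|lborel. cis (x * \<xi> + t * \<bar>\<xi>\<bar> powr m) *
        complex_of_real (exp (- (\<bar>\<xi>\<bar>\<^sup>2 / N\<^sup>2))) * fhat f \<xi>)"

definition evol_defined :: "real \<Rightarrow> dist \<Rightarrow> real \<Rightarrow> real \<Rightarrow> bool" where
  "evol_defined m f t x \<longleftrightarrow> (\<exists>v. ((\<lambda>N. evol_reg m f N t x) \<longlongrightarrow> v) at_top)"

text \<open>Where the limit does not exist the value is set to 0, so that such points can only make
  the left-hand side of the maximal inequality smaller.\<close>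

definition evol :: "real \<Rightarrow> dist \<Rightarrow> real \<Rightarrow> real \<Rightarrow> complex" where
  "evol m f t x = (if evol_defined m f t x then Lim at_top (\<lambda>N. evol_reg m f N t x) else 0)"

section \<open>Fractal measures and the mixed norm\<close>

definition alpha_dimensional :: "real \<Rightarrow> real measure \<Rightarrow> bool" where
  "alpha_dimensional \<alpha> \<mu> \<longleftrightarrow>
     (SUP (x, r)\<in>UNIV \<times> {0<..}. emeasure \<mu> (ball x r) / ennreal (r powr \<alpha>)) < \<infinity>"

definition fractal_measures :: "real \<Rightarrow> real measure set" where
  "fractal_measures \<alpha> =
     {\<mu>. sets \<mu> = sets borel \<and> emeasure \<mu> (- ball 0 1) = 0 \<and> alpha_dimensional \<alpha> \<mu>}"

definition ennreal_powr :: "ennreal \<Rightarrow> real \<Rightarrow> ennreal"  \<comment> \<open>for positive exponents only\<close> where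
  "ennreal_powr a p = (if a = \<infinity> then \<infinity> else ennreal (enn2real a powr p))"

definition mixed_norm :: "real \<Rightarrow> real measure \<Rightarrow> (real \<Rightarrow> real \<Rightarrow> complex) \<Rightarrow> ennreal" where
  "mixed_norm q \<mu> F = ennreal_powr
     (\<integral>\<^sup>+x\<in>{0<..<1}. (SUP t\<in>{0<..<1}. ennreal (cmod (F x t) powr q)) \<partial>\<mu>) (1 / q)"

end

theory Submission
  imports Defs "HOL-Probability.Probability"
begin

text \<open>Sufficiency is a \<open>T T*\<close> argument on each dyadic frequency range \<open>\<bar>\<xi>\<bar> \<sim> R\<close>, with the time and the
  Gaussian damping chosen as measurable functions of \<open>x\<close>. Since \<open>\<kappa> \<ge> 1\<close>, the curve is Lipschitz in
  time, so the phase \<open>u \<xi> + \<tau> \<bar>\<xi>\<bar>\<^sup>m\<close> of the kernel is either without stationary points, with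
  \<open>\<bar>u\<bar>\<close> comparable to the spatial distance \<open>d\<close>, or \<open>\<bar>\<tau>\<bar>\<close> dominates \<open>d\<close>. In both cases van der
  Corput bounds the kernel by \<open>R (1 + R\<^sup>m d)\<^bsup>-1/2\<^esup>\<close>, and Young's inequality for the fractal measure
  yields the exponents \<open>1/2 - m/4\<close> and \<open>1/2 - m \<alpha> / q\<close>. The room in \<open>s\<close> sums the dyadic pieces and
  makes them converge uniformly in the damping almost everywhere.

  Necessity of \<open>1/2 - m \<alpha> / q\<close> comes from data focusing at one point of the curve, tested on
  \<open>x\<^bsup>\<alpha> - 1\<^esup> dx\<close>; necessity of \<open>1/2 - m/4\<close> comes from a wave packet of frequency width
  \<open>R\<^bsup>1 - m/2\<^esup>\<close>, tested on Lebesgue measure.\<close>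

section \<open>Oscillatory integrals\<close>

text \<open>The exponents come from one free parameter. For each \<beta> in [0, 1/2] the kernel at
  frequency R is bounded by a constant times R (R^m d)^(-\<beta>). Its power q/2 is integrable
  against an \<alpha>-dimensional measure once \<beta> q / 2 < \<alpha>, and the T T* argument then
  gives the operator norm R^((1 - m \<beta>) / 2). Letting \<beta> approach min(1/2, 2 \<alpha> / q)
  produces both thresholds at once; the endpoint is never taken, so no critical
  Hardy-Littlewood-Sobolev inequality enters.

  Two obstacles shape the rest. A value of the evolution is a limit of Gaussian means, so every
  kernel bound has to be uniform in the damping: the Gaussian enters van der Corput's lemma as a
  monotone amplitude and the maximal function as a second parameter. Moreover the data are tempered
  distributions and \<open>fhat\<close> is picked by \<open>SOME\<close>. Inversion, an L^2 bound
  and the uniqueness of representing functions are needed to turn \<open>fhat\<close> into a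
  concrete weighted L^2 function, and to realise prescribed test data as elements of a Sobolev
  space.\<close>

text \<open>Writing cos \<phi> as (1/\<phi>') times (sin \<phi>)' leaves a monotone factor and a
  function all of whose integrals are at most 2 in size. The second mean value theorem then replaces
  integration by parts, so that monotonicity of \<phi>' is enough and \<phi>'' does not occur. The 4
  is 2 + 2, one term for each endpoint.\<close>

lemma cos_integral_first_derivative:
  fixes \<phi> \<phi>' :: "real \<Rightarrow> real"
  assumes "a \<le> b" and deriv: "\<And>x. x \<in> {a..b} \<Longrightarrow> (\<phi> has_real_derivative \<phi>' x) (at x)"
    and mono: "mono_on {a..b} \<phi>' \<or> antimono_on {a..b} \<phi>'"
    and l: "0 < l" "\<And>x. x \<in> {a..b} \<Longrightarrow> l \<le> \<phi>' x"
  shows "\<bar>integral {a..b} (\<lambda>x. cos (\<phi> x))\<bar> \<le> 4 / l"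
proof -
  define f where "f = (\<lambda>x. \<phi>' x * cos (\<phi> x))"
  have FTC: "(f has_integral (sin (\<phi> d) - sin (\<phi> c))) {c..d}" if "a \<le> c" "c \<le> d" "d \<le> b" for c d
    unfolding f_def
  proof (rule fundamental_theorem_of_calculus[OF that(2)])
    fix x assume "x \<in> {c..d}"
    hence "(\<phi> has_real_derivative \<phi>' x) (at x)" using deriv that by auto
    hence "((\<lambda>x. sin (\<phi> x)) has_real_derivative \<phi>' x * cos (\<phi> x)) (at x)"
      by (auto intro!: derivative_eq_intros)
    thus "((\<lambda>x. sin (\<phi> x)) has_vector_derivative \<phi>' x * cos (\<phi> x)) (at x within {c..d})"
      using has_real_derivative_iff_has_vector_derivative has_vector_derivative_at_within by blast
  qed
  have fb: "\<bar>integral {c..d} f\<bar> \<le> 2" if "a \<le> c" "c \<le> d" "d \<le> b" for c d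
    using integral_unique[OF FTC[OF that]] sin_le_one[of "\<phi> d"] sin_le_one[of "\<phi> c"]
      sin_ge_minus_one[of "\<phi> d"] sin_ge_minus_one[of "\<phi> c"] by linarith
  have pos: "0 < \<phi>' x" if "x \<in> {a..b}" for x using l that by force
  \<comment> \<open>The mean value theorem used below takes a nondecreasing weight; with this sign
    \<sigma> / \<phi>' is nondecreasing whether \<phi>' increases or decreases.\<close>
  define \<sigma> :: real where "\<sigma> = (if mono_on {a..b} \<phi>' then -1 else 1)"
  have \<sigma>: "\<sigma> * \<sigma> = 1" "\<bar>\<sigma>\<bar> = 1" by (auto simp: \<sigma>_def)
  have g: "\<sigma> / \<phi>' x \<le> \<sigma> / \<phi>' y" if "a \<le> x" "x \<le> y" "y \<le> b" for x y
  proof (cases "mono_on {a..b} \<phi>'")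
    case True
    have "\<phi>' x \<le> \<phi>' y" using True that by (auto simp: monotone_on_def)
    thus ?thesis using pos[of x] pos[of y] that True by (auto simp: \<sigma>_def field_simps)
  next
    case False
    hence "\<phi>' y \<le> \<phi>' x" using mono that by (auto simp: monotone_on_def)
    thus ?thesis using pos[of x] pos[of y] that False by (auto simp: \<sigma>_def field_simps)
  qed
  have fi: "f integrable_on {a..b}" using FTC[of a b] assms(1) by auto
  obtain c where c: "c \<in> {a..b}"
    "integral {a..b} (\<lambda>x. \<sigma> / \<phi>' x * f x) = \<sigma> / \<phi>' a * integral {a..c} f + \<sigma> / \<phi>' b * integral {c..b} f"
    using second_mean_value_theorem[OF fi assms(1), of "\<lambda>x. \<sigma> / \<phi>' x"] g by auto
  have "integral {a..b} (\<lambda>x. \<sigma> / \<phi>' x * f x) = integral {a..b} (\<lambda>x. \<sigma> * cos (\<phi> x))"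
    by (rule integral_cong) (use pos in \<open>force simp: f_def\<close>)
  also have "\<dots> = \<sigma> * integral {a..b} (\<lambda>x. cos (\<phi> x))" by simp
  finally have eq: "\<bar>integral {a..b} (\<lambda>x. cos (\<phi> x))\<bar> = \<bar>\<sigma> / \<phi>' a * integral {a..c} f + \<sigma> / \<phi>' b * integral {c..b} f\<bar>"
    using c(2) \<sigma>(2) abs_mult[of \<sigma> "integral {a..b} (\<lambda>x. cos (\<phi> x))"] by simp
  have q: "\<bar>\<sigma> / \<phi>' x\<bar> \<le> 1 / l" if "x \<in> {a..b}" for x
    using l that pos[OF that] \<sigma> by (auto simp: abs_divide frac_le)
  have "\<bar>\<sigma> / \<phi>' a * integral {a..c} f\<bar> \<le> 1 / l * 2" unfolding abs_mult
    by (rule mult_mono) (use q fb c assms in auto)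
  moreover have "\<bar>\<sigma> / \<phi>' b * integral {c..b} f\<bar> \<le> 1 / l * 2" unfolding abs_mult
    by (rule mult_mono) (use q fb c assms in auto)
  ultimately show ?thesis unfolding eq by linarith
qed

lemma cos_integral_first_derivative':
  fixes \<phi> \<phi>' :: "real \<Rightarrow> real"
  assumes "a \<le> b" and deriv: "\<And>x. x \<in> {a..b} \<Longrightarrow> (\<phi> has_real_derivative \<phi>' x) (at x)"
    and mono: "mono_on {a..b} \<phi>' \<or> antimono_on {a..b} \<phi>'"
    and l: "0 < l" "(\<forall>x\<in>{a..b}. l \<le> \<phi>' x) \<or> (\<forall>x\<in>{a..b}. \<phi>' x \<le> - l)"
  shows "\<bar>integral {a..b} (\<lambda>x. cos (\<phi> x))\<bar> \<le> 4 / l"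
  using l(2)
proof
  assume "\<forall>x\<in>{a..b}. l \<le> \<phi>' x"
  thus ?thesis using cos_integral_first_derivative[OF assms(1) deriv mono l(1)] by auto
next
  assume *: "\<forall>x\<in>{a..b}. \<phi>' x \<le> - l"
  have "\<bar>integral {a..b} (\<lambda>x. cos (- \<phi> x))\<bar> \<le> 4 / l"
  proof (rule cos_integral_first_derivative[where \<phi>' = "\<lambda>x. - \<phi>' x"])
    show "mono_on {a..b} (\<lambda>x. - \<phi>' x) \<or> antimono_on {a..b} (\<lambda>x. - \<phi>' x)"
      using mono by (auto simp: monotone_on_def)
    show "((\<lambda>x. - \<phi> x) has_real_derivative - \<phi>' x) (at x)" if "x \<in> {a..b}" for x
      using deriv[OF that] by (auto intro!: derivative_eq_intros)
  qed (use assms * in force)+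
  thus ?thesis by simp
qed

text \<open>Van der Corput's second-derivative test, with \<phi>'' \<ge> l expressed through
  increments of \<phi>'. Within 1 / sqrt l of the point where \<phi>' is closest to 0 the trivial
  bound is used; farther away \<phi>' has size at least sqrt l and the first-derivative test gives 4
  / sqrt l on either side. Altogether 4 + 2 + 4 = 10.\<close>

lemma cos_integral_second_derivative_mono:
  fixes \<phi> \<phi>' :: "real \<Rightarrow> real"
  assumes ab: "a \<le> b" and deriv: "\<And>x. x \<in> {a..b} \<Longrightarrow> (\<phi> has_real_derivative \<phi>' x) (at x)"
    and cont: "continuous_on {a..b} \<phi>'"
    and l: "0 < l" "\<And>x y. a \<le> x \<Longrightarrow> x \<le> y \<Longrightarrow> y \<le> b \<Longrightarrow> l * (y - x) \<le> \<phi>' y - \<phi>' x"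
  shows "\<bar>integral {a..b} (\<lambda>x. cos (\<phi> x))\<bar> \<le> 10 / sqrt l"
proof -
  have cc: "continuous_on {a..b} (\<lambda>x. cos (\<phi> x))"
    by (intro continuous_intros continuous_at_imp_continuous_on ballI)
       (use deriv DERIV_isCont in blast)
  \<comment> \<open>If \<phi>' keeps its sign, \<open>c\<close> is the endpoint where it is closest
    to 0, otherwise it is a zero. In all cases the size of \<phi>' grows at least with slope l away
    from \<open>c\<close>.\<close>
  obtain c where c: "c \<in> {a..b}" and cr: "\<And>x. c < x \<Longrightarrow> x \<le> b \<Longrightarrow> l * (x - c) \<le> \<phi>' x"
     and cl: "\<And>x. a \<le> x \<Longrightarrow> x < c \<Longrightarrow> \<phi>' x \<le> - (l * (c - x))"
  proof -
    consider "0 \<le> \<phi>' a" | "\<phi>' b \<le> 0" | "\<phi>' a < 0" "0 < \<phi>' b" by linarith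
    thus thesis
    proof cases
      case 1
      have "l * (x - a) \<le> \<phi>' x" if "a < x" "x \<le> b" for x using l(2)[of a x] 1 that by simp
      thus thesis using ab by (intro that[of a]) force+
    next
      case 2
      have "\<phi>' x \<le> - (l * (b - x))" if "a \<le> x" "x < b" for x using l(2)[of x b] 2 that by simp
      thus thesis using ab by (intro that[of b]) force+
    next
      case 3
      then obtain c where c: "a \<le> c" "c \<le> b" "\<phi>' c = 0" using IVT'[of \<phi>' a 0 b] cont ab by auto
      have "l * (x - c) \<le> \<phi>' x" if "c < x" "x \<le> b" for x using l(2)[of c x] c that by simp
      moreover have "\<phi>' x \<le> - (l * (c - x))" if "a \<le> x" "x < c" for x using l(2)[of x c] c that by simp
      ultimately show thesis using c by (intro that[of c]) auto
    qed
  qed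
  \<comment> \<open>This length balances the trivial bound 2 \<delta> near \<open>c\<close> against
    4 / (l \<delta>) on each outer piece.\<close>
  define \<delta> where "\<delta> = 1 / sqrt l"
  have \<delta>: "\<delta> > 0" "l * \<delta> = sqrt l"
    using l(1) by (auto simp: \<delta>_def real_div_sqrt)
  define p where "p = max a (c - \<delta>)"
  define r where "r = min b (c + \<delta>)"
  have pr: "a \<le> p" "p \<le> r" "r \<le> b" "r - p \<le> 2 * \<delta>" using c \<delta> by (auto simp: p_def r_def)
  have mono: "mono_on S \<phi>'" if "S \<subseteq> {a..b}" for S
    unfolding monotone_on_def
  proof (intro allI impI ballI)
    fix x y assume "x \<in> S" "y \<in> S" "x \<le> y"
    moreover have "0 \<le> l * (y - x)" using l(1) \<open>x \<le> y\<close> by simp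
    ultimately show "\<phi>' x \<le> \<phi>' y" using l(2)[of x y] that by force
  qed
  have A: "\<bar>integral {a..p} (\<lambda>x. cos (\<phi> x))\<bar> \<le> 4 / sqrt l"
  proof (cases "p = a")
    case False
    hence p: "p = c - \<delta>" "a < p" by (auto simp: p_def)
    have "\<phi>' x \<le> - sqrt l" if "x \<in> {a..p}" for x
    proof -
      have "l * \<delta> \<le> l * (c - x)" using that p l(1) by (intro mult_left_mono) auto
      thus ?thesis using cl[of x] that p \<delta> by auto
    qed
    thus ?thesis using pr l(1) deriv mono[of "{a..p}"]
      by (intro cos_integral_first_derivative'[where \<phi>'=\<phi>']) auto
  qed (use l in auto)
  have B: "\<bar>integral {r..b} (\<lambda>x. cos (\<phi> x))\<bar> \<le> 4 / sqrt l"
  proof (cases "r = b")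
    case False
    hence r: "r = c + \<delta>" "r < b" by (auto simp: r_def)
    have "\<phi>' x \<ge> sqrt l" if "x \<in> {r..b}" for x
    proof -
      have "l * \<delta> \<le> l * (x - c)" using that r l(1) by (intro mult_left_mono) auto
      thus ?thesis using cr[of x] that r \<delta> by auto
    qed
    thus ?thesis using pr l(1) deriv mono[of "{r..b}"]
      by (intro cos_integral_first_derivative'[where \<phi>'=\<phi>']) auto
  qed (use l in auto)
  have "norm (integral {p..r} (\<lambda>x. cos (\<phi> x))) \<le> integral {p..r} (\<lambda>_. 1 :: real)"
    by (rule Henstock_Kurzweil_Integration.integral_norm_bound_integral)
       (use pr cc in \<open>auto intro!: integrable_continuous_real intro: continuous_on_subset\<close>)
  hence M: "\<bar>integral {p..r} (\<lambda>x. cos (\<phi> x))\<bar> \<le> 2 / sqrt l"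
    using pr by (auto simp: \<delta>_def)
  have int: "(\<lambda>x. cos (\<phi> x)) integrable_on {a..b}" by (rule integrable_continuous_real[OF cc])
  have "integral {a..b} (\<lambda>x. cos (\<phi> x)) = integral {a..p} (\<lambda>x. cos (\<phi> x)) + integral {p..b} (\<lambda>x. cos (\<phi> x))"
    using Henstock_Kurzweil_Integration.integral_combine[OF _ _ int, of p] pr by simp
  moreover have "integral {p..b} (\<lambda>x. cos (\<phi> x)) = integral {p..r} (\<lambda>x. cos (\<phi> x)) + integral {r..b} (\<lambda>x. cos (\<phi> x))"
    using Henstock_Kurzweil_Integration.integral_combine[of p r b "\<lambda>x. cos (\<phi> x)"] pr
      integrable_subinterval_real[OF int, of p b] by simp
  ultimately have "\<bar>integral {a..b} (\<lambda>x. cos (\<phi> x))\<bar> \<le> 4 / sqrt l + (2 / sqrt l + 4 / sqrt l)"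
    using A B M by linarith
  thus ?thesis by simp
qed

lemma cos_integral_second_derivative:
  fixes \<phi> \<phi>' :: "real \<Rightarrow> real"
  assumes ab: "a \<le> b" and deriv: "\<And>x. x \<in> {a..b} \<Longrightarrow> (\<phi> has_real_derivative \<phi>' x) (at x)"
    and cont: "continuous_on {a..b} \<phi>'"
    and l: "0 < l" "(\<forall>x y. a \<le> x \<longrightarrow> x \<le> y \<longrightarrow> y \<le> b \<longrightarrow> l * (y - x) \<le> \<phi>' y - \<phi>' x) \<or>
                     (\<forall>x y. a \<le> x \<longrightarrow> x \<le> y \<longrightarrow> y \<le> b \<longrightarrow> l * (y - x) \<le> \<phi>' x - \<phi>' y)"
  shows "\<bar>integral {a..b} (\<lambda>x. cos (\<phi> x))\<bar> \<le> 10 / sqrt l"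
  using l(2)
proof
  assume "\<forall>x y. a \<le> x \<longrightarrow> x \<le> y \<longrightarrow> y \<le> b \<longrightarrow> l * (y - x) \<le> \<phi>' y - \<phi>' x"
  thus ?thesis using cos_integral_second_derivative_mono[OF ab deriv cont l(1)] by auto
next
  assume *: "\<forall>x y. a \<le> x \<longrightarrow> x \<le> y \<longrightarrow> y \<le> b \<longrightarrow> l * (y - x) \<le> \<phi>' x - \<phi>' y"
  have "\<bar>integral {a..b} (\<lambda>x. cos (- \<phi> x))\<bar> \<le> 10 / sqrt l"
  proof (rule cos_integral_second_derivative_mono[where \<phi>' = "\<lambda>x. - \<phi>' x"])
    show "continuous_on {a..b} (\<lambda>x. - \<phi>' x)" using cont by (intro continuous_intros)
    show "((\<lambda>x. - \<phi> x) has_real_derivative - \<phi>' x) (at x)" if "x \<in> {a..b}" for x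
      using deriv[OF that] by (auto intro!: derivative_eq_intros)
  qed (use assms * in auto)
  thus ?thesis by simp
qed

text \<open>The second mean value theorem reduces a decreasing amplitude with values in [0, 1] to
  integrals of \<open>f\<close> alone, at the cost of a factor 2. In this way a Gaussian factor
  exp(-b x^2) enters with a bound that does not depend on b.\<close>

lemma integral_decreasing_amplitude:
  fixes f \<psi> :: "real \<Rightarrow> real"
  assumes "a \<le> b" "continuous_on {a..b} f"
    and \<psi>: "\<And>x y. a \<le> x \<Longrightarrow> x \<le> y \<Longrightarrow> y \<le> b \<Longrightarrow> \<psi> y \<le> \<psi> x" "0 \<le> \<psi> b" "\<psi> a \<le> 1"
    and M: "\<And>c d. a \<le> c \<Longrightarrow> c \<le> d \<Longrightarrow> d \<le> b \<Longrightarrow> \<bar>integral {c..d} f\<bar> \<le> M"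
  shows "\<bar>integral {a..b} (\<lambda>x. \<psi> x * f x)\<bar> \<le> 2 * M"
proof -
  \<comment> \<open>The weight is \<open>- \<psi>\<close> because the mean value theorem asks for a
    nondecreasing one.\<close>
  obtain c where c: "c \<in> {a..b}"
    "integral {a..b} (\<lambda>x. - \<psi> x * f x) = - \<psi> a * integral {a..c} f + - \<psi> b * integral {c..b} f"
    using second_mean_value_theorem[OF integrable_continuous_real[OF assms(2)] assms(1), of "\<lambda>x. - \<psi> x"] \<psi>
    by auto
  have "\<psi> b \<le> \<psi> a" using \<psi>(1)[of a b] assms(1) by simp
  hence r: "0 \<le> \<psi> a" "\<psi> b \<le> 1" using \<psi> by linarith+
  have "\<bar>\<psi> a * integral {a..c} f\<bar> \<le> 1 * M" unfolding abs_mult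
    by (rule mult_mono) (use r \<psi> M c in auto)
  moreover have "\<bar>\<psi> b * integral {c..b} f\<bar> \<le> 1 * M" unfolding abs_mult
    by (rule mult_mono) (use r \<psi> M c in auto)
  moreover have "integral {a..b} (\<lambda>x. - \<psi> x * f x) = - integral {a..b} (\<lambda>x. \<psi> x * f x)"
    by (simp add: integral_neg)
  ultimately show ?thesis using c(2) by auto
qed

section \<open>The phase u x + \<tau> x^m on a dyadic interval\<close>

text \<open>The second derivative of \<tau> x^m has size |\<tau>| m (1 - m) x^(m - 2), which is
  smallest at the right end 2 R; this gives the first bound. For the second, m x^(m - 1) \<le> 1 on
  x \<ge> 1, so the phase derivative differs from u by at most |\<tau>| and keeps both its sign and
  a size of at least l. The shift \<open>p\<close> makes the sine integral a special case of the
  cosine integral.\<close>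

lemma powr_phase_integral_bounds:
  fixes m R u \<tau> b p :: real
  assumes m: "0 < m" "m < 1" and R: "1 \<le> R" and b: "0 \<le> b"
  defines "I \<equiv> integral {R..2*R} (\<lambda>x. exp (- b * x\<^sup>2) * cos (u * x + \<tau> * x powr m + p))"
  shows "\<tau> \<noteq> 0 \<Longrightarrow> \<bar>I\<bar> \<le> 20 / sqrt (\<bar>\<tau>\<bar> * m * (1 - m) * (2 * R) powr (m - 2))"
    and "0 < l \<Longrightarrow> l + \<bar>\<tau>\<bar> \<le> \<bar>u\<bar> \<Longrightarrow> \<bar>I\<bar> \<le> 8 / l"
proof -
  define \<phi> where "\<phi> = (\<lambda>x. u * x + \<tau> * x powr m + p)"
  define \<phi>' where "\<phi>' = (\<lambda>x. u + \<tau> * (m * x powr (m - 1)))"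
  have d: "(\<phi> has_real_derivative \<phi>' x) (at x)" if "R \<le> x" for x
    unfolding \<phi>_def \<phi>'_def using that R by (auto intro!: derivative_eq_intros)
  have c: "continuous_on {R..} \<phi>'" unfolding \<phi>'_def
    using R by (intro continuous_intros) auto
  have cc: "continuous_on {R..2*R} (\<lambda>x. cos (\<phi> x))"
    by (intro continuous_intros continuous_at_imp_continuous_on ballI) (use d DERIV_isCont in force)
  have I_eq: "I = integral {R..2*R} (\<lambda>x. exp (- b * x\<^sup>2) * cos (\<phi> x))" by (simp add: I_def \<phi>_def)
  have amp: "\<bar>I\<bar> \<le> 2 * M"
    if M: "\<And>c d. R \<le> c \<Longrightarrow> c \<le> d \<Longrightarrow> d \<le> 2*R \<Longrightarrow> \<bar>integral {c..d} (\<lambda>x. cos (\<phi> x))\<bar> \<le> M" for M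
    unfolding I_eq
  proof (rule integral_decreasing_amplitude[where \<psi> = "\<lambda>x. exp (- b * x\<^sup>2)" and f = "\<lambda>x. cos (\<phi> x)"])
    show "continuous_on {R..2*R} (\<lambda>x. cos (\<phi> x))" by (rule cc)
    show "exp (- b * y\<^sup>2) \<le> exp (- b * x\<^sup>2)" if "R \<le> x" "x \<le> y" for x y
      using that R b by (auto intro!: mult_left_mono power_mono)
  qed (use R b M in auto)
  have dd: "m * (1 - m) * (2 * R) powr (m - 2) * (y - x) \<le> m * x powr (m - 1) - m * y powr (m - 1)"
    if "R \<le> x" "x \<le> y" "y \<le> 2 * R" for x y
  proof (cases "x = y")
    case False
    hence xy: "x < y" using that by simp
    have "\<exists>z. x < z \<and> z < y \<and> y powr (m-1) - x powr (m-1) = (y - x) * ((m-1) * z powr (m - 1 - 1))"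
      by (rule MVT2[OF xy]) (use that R in \<open>auto intro!: derivative_eq_intros\<close>)
    then obtain z where z: "x < z" "z < y" "y powr (m-1) - x powr (m-1) = (y - x) * ((m-1) * z powr (m - 2))"
      by auto
    have "(2 * R) powr (m - 2) \<le> z powr (m - 2)"
      using z that R m by (intro powr_mono2') auto
    hence "m * (1 - m) * (y - x) * (2 * R) powr (m - 2) \<le> m * (1 - m) * (y - x) * z powr (m - 2)"
      using m xy by (intro mult_left_mono) auto
    also have "\<dots> = m * - (y powr (m-1) - x powr (m-1))" unfolding z by (simp add: algebra_simps)
    finally show ?thesis by (simp add: algebra_simps)
  qed auto
  have am: "mono_on {c..e} \<phi>' \<or> antimono_on {c..e} \<phi>'" if "R \<le> c" "e \<le> 2 * R" for c e
  proof -
    have *: "m * y powr (m-1) \<le> m * x powr (m-1)" if "x \<in> {c..e}" "x \<le> y" for x y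
      using that \<open>R \<le> c\<close> R m by (intro mult_left_mono powr_mono2') auto
    show ?thesis
    proof (cases "\<tau> \<ge> 0")
      case True
      hence "antimono_on {c..e} \<phi>'" unfolding monotone_on_def \<phi>'_def
        by (intro ballI impI add_left_mono mult_left_mono *) auto
      thus ?thesis ..
    next
      case False
      hence "mono_on {c..e} \<phi>'" unfolding monotone_on_def \<phi>'_def
        by (intro ballI impI add_left_mono mult_left_mono_neg *) auto
      thus ?thesis ..
    qed
  qed
  show "\<bar>I\<bar> \<le> 20 / sqrt (\<bar>\<tau>\<bar> * m * (1 - m) * (2 * R) powr (m - 2))" if \<tau>: "\<tau> \<noteq> 0"
  proof -
    define l where "l = \<bar>\<tau>\<bar> * m * (1 - m) * (2 * R) powr (m - 2)"
    have l: "l > 0" using \<tau> m R by (simp add: l_def)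
    have "\<bar>integral {c..e} (\<lambda>x. cos (\<phi> x))\<bar> \<le> 10 / sqrt l" if ce: "R \<le> c" "c \<le> e" "e \<le> 2*R" for c e
    proof (rule cos_integral_second_derivative[where \<phi>' = \<phi>'])
      show "continuous_on {c..e} \<phi>'" using ce by (auto intro: continuous_on_subset[OF c])
      have "l * (y - x) \<le> \<bar>\<tau>\<bar> * (m * x powr (m - 1) - m * y powr (m - 1))" if "c \<le> x" "x \<le> y" "y \<le> e" for x y
      proof -
        have "\<bar>\<tau>\<bar> * (m * (1 - m) * (2 * R) powr (m - 2) * (y - x)) \<le> \<bar>\<tau>\<bar> * (m * x powr (m - 1) - m * y powr (m - 1))"
          by (intro mult_left_mono dd) (use that ce in auto)
        thus ?thesis by (simp add: l_def algebra_simps)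
      qed
      thus "(\<forall>x y. c \<le> x \<longrightarrow> x \<le> y \<longrightarrow> y \<le> e \<longrightarrow> l * (y - x) \<le> \<phi>' y - \<phi>' x) \<or>
        (\<forall>x y. c \<le> x \<longrightarrow> x \<le> y \<longrightarrow> y \<le> e \<longrightarrow> l * (y - x) \<le> \<phi>' x - \<phi>' y)"
        by (cases "\<tau> \<ge> 0") (auto simp: \<phi>'_def algebra_simps)
    qed (use l ce d in auto)
    from amp[OF this] show ?thesis by (simp add: l_def)
  qed
  show "\<bar>I\<bar> \<le> 8 / l" if l: "0 < l" "l + \<bar>\<tau>\<bar> \<le> \<bar>u\<bar>"
  proof -
    have "\<bar>integral {c..e} (\<lambda>x. cos (\<phi> x))\<bar> \<le> 4 / l" if ce: "R \<le> c" "c \<le> e" "e \<le> 2*R" for c e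
    proof (rule cos_integral_first_derivative'[where \<phi>' = \<phi>'])
      have "\<bar>\<tau> * (m * x powr (m - 1))\<bar> \<le> \<bar>\<tau>\<bar>" if "c \<le> x" for x
      proof -
        have "x powr (m - 1) \<le> x powr 0" using that ce R m by (intro powr_mono) auto
        hence "x powr (m - 1) \<le> 1" using that ce R by simp
        hence "m * x powr (m - 1) \<le> 1 * 1" using m by (intro mult_mono) auto
        thus ?thesis using m by (simp add: abs_mult mult_left_le)
      qed
      hence "\<bar>\<phi>' x - u\<bar> \<le> \<bar>\<tau>\<bar>" if "c \<le> x" for x using that by (simp add: \<phi>'_def)
      hence *: "\<bar>\<phi>' x - u\<bar> \<le> \<bar>u\<bar> - l" if "c \<le> x" for x using that l(2) by fastforce
      show "(\<forall>x\<in>{c..e}. l \<le> \<phi>' x) \<or> (\<forall>x\<in>{c..e}. \<phi>' x \<le> - l)"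
      proof (cases "u \<ge> 0")
        case True
        have "l \<le> \<phi>' x" if "x \<in> {c..e}" for x using *[of x] that True by auto
        thus ?thesis by blast
      next
        case False
        have "\<phi>' x \<le> - l" if "x \<in> {c..e}" for x using *[of x] that False by auto
        thus ?thesis by blast
      qed
    qed (use l ce d am in auto)
    from amp[OF this] show ?thesis by simp
  qed
qed

lemma norm_le_of_Re_Im_le:
  fixes z :: complex
  assumes "\<bar>Re z\<bar> \<le> M" "\<bar>Im z\<bar> \<le> M"
  shows "norm z \<le> 2 * M"
  using cmod_le[of z] assms by linarith

lemma powr_phase_complex_integral_bounds:
  fixes m R u \<tau> b :: real
  assumes m: "0 < m" "m < 1" and R: "1 \<le> R" and b: "0 \<le> b"
  defines "J \<equiv> (LINT x|lborel. indicator {R..<2*R} x *\<^sub>R (complex_of_real (exp (- b * x\<^sup>2)) * cis (u * x + \<tau> * x powr m)))"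
  shows "\<tau> \<noteq> 0 \<Longrightarrow> norm J \<le> 40 / sqrt (\<bar>\<tau>\<bar> * m * (1 - m) * (2 * R) powr (m - 2))"
    and "0 < l \<Longrightarrow> l + \<bar>\<tau>\<bar> \<le> \<bar>u\<bar> \<Longrightarrow> norm J \<le> 16 / l"
proof -
  let ?f = "\<lambda>x. complex_of_real (exp (- b * x\<^sup>2)) * cis (u * x + \<tau> * x powr m)"
  have c: "continuous_on {R..2*R} ?f"
    using R by (intro continuous_intros) auto
  have si: "set_integrable lborel {R..2*R} ?f"
    by (rule borel_integrable_atLeastAtMost'[OF c])
  have "J = (LINT x|lborel. indicator {R..2*R} x *\<^sub>R ?f x)"
    unfolding J_def
  proof (rule integral_cong_AE)
    show "AE x in lborel. indicat_real {R..<2 * R} x *\<^sub>R ?f x = indicat_real {R..2 * R} x *\<^sub>R ?f x"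
      using AE_lborel_singleton[of "2*R"] by eventually_elim (auto simp: indicator_def)
  qed (auto simp: cis_conv_exp)
  also have "\<dots> = integral {R..2*R} ?f"
    using set_borel_integral_eq_integral(2)[OF si] by (simp add: set_lebesgue_integral_def)
  finally have J: "J = integral {R..2*R} ?f" .
  have i: "?f integrable_on {R..2*R}" by (rule integrable_continuous_real[OF c])
  have re: "Re J = integral {R..2*R} (\<lambda>x. exp (- b * x\<^sup>2) * cos (u * x + \<tau> * x powr m + 0))"
    unfolding J using integral_component_eq[OF i, of 1] by (simp add: inner_complex_def)
  have "Im J = integral {R..2*R} (\<lambda>x. exp (- b * x\<^sup>2) * sin (u * x + \<tau> * x powr m))"
    unfolding J using integral_component_eq[OF i, of \<i>] by (simp add: inner_complex_def)
  \<comment> \<open>The imaginary part is the same cosine integral with the phase moved by a quarter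
    period.\<close>
  also have "(\<lambda>x. exp (- b * x\<^sup>2) * sin (u * x + \<tau> * x powr m)) = (\<lambda>x. exp (- b * x\<^sup>2) * cos (u * x + \<tau> * x powr m + - (pi/2)))"
    by (simp add: sin_cos_eq cos_minus[symmetric, of "pi/2 - _"])
  finally have im: "Im J = integral {R..2*R} (\<lambda>x. exp (- b * x\<^sup>2) * cos (u * x + \<tau> * x powr m + - (pi/2)))" .
  show "norm J \<le> 40 / sqrt (\<bar>\<tau>\<bar> * m * (1 - m) * (2 * R) powr (m - 2))" if "\<tau> \<noteq> 0"
    using norm_le_of_Re_Im_le[of J "20 / sqrt (\<bar>\<tau>\<bar> * m * (1 - m) * (2 * R) powr (m - 2))"]
      powr_phase_integral_bounds(1)[OF m R b that, of u 0, folded re]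
      powr_phase_integral_bounds(1)[OF m R b that, of u "- (pi/2)", folded im] by simp
  show "norm J \<le> 16 / l" if "0 < l" "l + \<bar>\<tau>\<bar> \<le> \<bar>u\<bar>"
    using norm_le_of_Re_Im_le[of J "8 / l"]
      powr_phase_integral_bounds(2)[OF m R b that, of 0, folded re]
      powr_phase_integral_bounds(2)[OF m R b that, of "- (pi/2)", folded im] by simp
qed

text \<open>Half open, so that the annuli with R = 2^k, k \<ge> 1, tile the frequencies of size at
  least 2 without overlap.\<close>

definition annulus :: "real \<Rightarrow> real set" where
  "annulus R = {\<xi>. R \<le> \<bar>\<xi>\<bar> \<and> \<bar>\<xi>\<bar> < 2 * R}"

lemma annulus_sets [measurable]: "annulus R \<in> sets borel"
  unfolding annulus_def by measurable

lemma indicator_annulus_split: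
  assumes "R > 0"
  shows "indicator (annulus R) x = (indicator {R..<2*R} x + indicator {R..<2*R} (-x) :: real)"
  using assms by (auto simp: annulus_def indicator_def)

text \<open>Reflection fixes |x|^m and the Gaussian and changes the sign of u, so the two halves of
  the annulus are one-sided integrals with u and -u, and the constants double. The third bound is
  the length of the annulus.\<close>

lemma annulus_kernel_bounds:
  fixes m R u \<tau> b :: real
  assumes m: "0 < m" "m < 1" and R: "1 \<le> R" and b: "0 \<le> b"
  defines "K \<equiv> (LINT x|lborel. indicator (annulus R) x *\<^sub>R (complex_of_real (exp (- b * x\<^sup>2)) * cis (u * x + \<tau> * \<bar>x\<bar> powr m)))"
  shows "\<tau> \<noteq> 0 \<Longrightarrow> norm K \<le> 80 / sqrt (\<bar>\<tau>\<bar> * m * (1 - m) * (2 * R) powr (m - 2))"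
    and "0 < l \<Longrightarrow> l + \<bar>\<tau>\<bar> \<le> \<bar>u\<bar> \<Longrightarrow> norm K \<le> 32 / l"
    and "norm K \<le> 2 * R"
proof -
  define f where "f = (\<lambda>u x. complex_of_real (exp (- b * x\<^sup>2)) * cis (u * x + \<tau> * \<bar>x\<bar> powr m))"
  have [measurable]: "f u \<in> borel_measurable borel" for u unfolding f_def cis_conv_exp by measurable
  have nf: "norm (f u x) \<le> 1" for u x using b by (simp add: f_def norm_mult)
  define J where "J = (\<lambda>u. LINT x|lborel. indicator {R..<2*R} x *\<^sub>R f u x)"
  have ind: "integrable lborel (indicat_real {R..<2*R})"
    using R by (intro integrable_real_indicator) auto
  have int: "integrable lborel (\<lambda>x. indicator {R..<2*R} x *\<^sub>R f u x)" for u
  proof (rule Bochner_Integration.integrable_bound[OF ind])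
    show "AE x in lborel. norm (indicat_real {R..<2 * R} x *\<^sub>R f u x) \<le> norm (indicat_real {R..<2 * R} x)"
      using nf by (auto simp: indicator_def)
  qed auto
  have int': "integrable lborel (\<lambda>x. indicator {R..<2*R} (-x) *\<^sub>R f u x)" for u
    using lborel_integrable_real_affine[OF int[of "-u"], of "-1" 0] by (simp add: f_def add.commute)
  have "K = (LINT x|lborel. indicator {R..<2*R} x *\<^sub>R f u x + indicator {R..<2*R} (-x) *\<^sub>R f u x)"
    unfolding K_def using R by (simp add: indicator_annulus_split f_def scaleR_add_left)
  also have "\<dots> = J u + (LINT x|lborel. indicator {R..<2*R} (-x) *\<^sub>R f u x)"
    unfolding J_def by (rule Bochner_Integration.integral_add[OF int int'])
  also have "(LINT x|lborel. indicator {R..<2*R} (-x) *\<^sub>R f u x) = J (-u)"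
    unfolding J_def by (subst lborel_integral_real_affine[where c = "-1" and t = 0]) (auto simp: f_def)
  finally have K: "K = J u + J (-u)" .
  have J: "J u = (LINT x|lborel. indicator {R..<2*R} x *\<^sub>R (complex_of_real (exp (- b * x\<^sup>2)) * cis (u * x + \<tau> * x powr m)))" for u
    unfolding J_def f_def using R by (intro Bochner_Integration.integral_cong) (auto simp: indicator_def)
  show "norm K \<le> 80 / sqrt (\<bar>\<tau>\<bar> * m * (1 - m) * (2 * R) powr (m - 2))" if "\<tau> \<noteq> 0"
    using norm_triangle_ineq[of "J u" "J (-u)"] powr_phase_complex_integral_bounds(1)[OF m R b that, of u, folded J]
      powr_phase_complex_integral_bounds(1)[OF m R b that, of "- u", folded J]
    unfolding K by simp
  show "norm K \<le> 32 / l" if "0 < l" "l + \<bar>\<tau>\<bar> \<le> \<bar>u\<bar>"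
  proof -
    have "norm (J u) \<le> 16/l" "norm (J (-u)) \<le> 16/l"
      using powr_phase_complex_integral_bounds(2)[OF m R b, of l \<tau>, folded J] that by auto
    thus ?thesis using norm_triangle_ineq[of "J u" "J (-u)"] unfolding K by (simp add: field_simps)
  qed
  have "norm (J u) \<le> R" for u
  proof -
    have "norm (J u) \<le> (LINT x|lborel. indicat_real {R..<2*R} x)" unfolding J_def
      by (rule Bochner_Integration.integral_norm_bound_integral[OF int ind]) (use nf in \<open>auto simp: indicator_def\<close>)
    thus ?thesis using R by simp
  qed
  from this[of u] this[of "-u"] show "norm K \<le> 2 * R"
    using norm_triangle_ineq[of "J u" "J (-u)"] unfolding K by simp
qed

text \<open>Either the curve moves much less in time than in space, and then the phase has no stationary
  point, or \<open>\<bar>\<tau>\<bar>\<close> is comparable with the spatial distance and the curvature of \<open>\<bar>\<xi>\<bar>\<^sup>m\<close> is used.\<close>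

lemma annulus_kernel_decay:
  fixes m L :: real
  assumes m: "0 < m" "m < 1" and L: "0 \<le> L"
  obtains C where "C \<ge> 2" and "\<And>R u \<tau> b d \<beta>. 1 \<le> R \<Longrightarrow> 0 \<le> b \<Longrightarrow> d \<noteq> 0 \<Longrightarrow> \<bar>u - d\<bar> \<le> L * \<bar>\<tau>\<bar> \<Longrightarrow> 0 \<le> \<beta> \<Longrightarrow> \<beta> \<le> 1/2 \<Longrightarrow>
    norm (LINT x|lborel. indicator (annulus R) x *\<^sub>R (complex_of_real (exp (- b * x\<^sup>2)) * cis (u * x + \<tau> * \<bar>x\<bar> powr m)))
      \<le> C * R * (R powr m * \<bar>d\<bar>) powr (- \<beta>)"
proof -
  \<comment> \<open>Chosen so that D |\<tau>| \<le> |d| implies |u| \<ge> |d| - L |\<tau>| \<ge> |d|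
    / 2 + |\<tau>|, which is the non-stationary case with l = |d| / 2.\<close>
  define D where "D = 2 * L + 2"
  \<comment> \<open>The constant of the second-derivative bound once |\<tau>| is replaced by |d| / D
    and the powers of R and |d| are split off.\<close>
  define C0 where "C0 = 80 / sqrt (m * (1 - m) * 2 powr (m - 2) / D)"
  define C where "C = max 16 C0"
  have D: "D \<ge> 2" using L by (simp add: D_def)
  have C: "C \<ge> 16" "C \<ge> C0" by (auto simp: C_def)
  have half: "norm (LINT x|lborel. indicator (annulus R) x *\<^sub>R (complex_of_real (exp (- b * x\<^sup>2)) * cis (u * x + \<tau> * \<bar>x\<bar> powr m)))
      \<le> C * R * (R powr m * \<bar>d\<bar>) powr (- 1/2)" (is "norm ?K \<le> _")
    if R: "1 \<le> R" and b: "0 \<le> b" and d: "d \<noteq> 0" and u: "\<bar>u - d\<bar> \<le> L * \<bar>\<tau>\<bar>" for R u \<tau> b d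
  proof (cases "D * \<bar>\<tau>\<bar> \<le> \<bar>d\<bar>")
    case True
    have tw: "2 * (L * \<bar>\<tau>\<bar>) + 2 * \<bar>\<tau>\<bar> \<le> \<bar>d\<bar>" using True by (simp add: D_def algebra_simps)
    have "norm ?K \<le> 32 / (\<bar>d\<bar> / 2)"
      by (rule annulus_kernel_bounds(2)[OF m R b]) (use d u tw in linarith)+
    moreover have "norm ?K \<le> 2 * R" by (rule annulus_kernel_bounds(3)[OF m R b])
    \<comment> \<open>The bound 64 / |d| is better than required for large |d| and useless for small
      |d|; its geometric mean with the trivial bound 2 R has the desired shape, since R \<le> R^(2 -
      m).\<close>
    ultimately have "norm ?K * norm ?K \<le> (64 / \<bar>d\<bar>) * (2 * R)"
      using R d by (intro mult_mono) auto
    also have "\<dots> \<le> (16\<^sup>2 / \<bar>d\<bar>) * R powr (2 - m)"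
    proof -
      have "R powr 1 \<le> R powr (2 - m)" using R m by (intro powr_mono) auto
      thus ?thesis using d R by (simp add: field_simps)
    qed
    also have "\<dots> = (16 * R * (R powr m * \<bar>d\<bar>) powr (- 1/2))\<^sup>2"
    proof -
      have "((R powr m * \<bar>d\<bar>) powr (- 1/2))\<^sup>2 = (R powr m * \<bar>d\<bar>) powr (-1)"
        using R d by (simp add: power2_eq_square powr_add[symmetric])
      also have "\<dots> = 1 / (R powr m * \<bar>d\<bar>)" using R d by (simp add: powr_minus_divide)
      finally show ?thesis using R d by (simp add: power_mult_distrib powr_diff)
    qed
    finally have "(norm ?K)\<^sup>2 \<le> (16 * R * (R powr m * \<bar>d\<bar>) powr (- 1/2))\<^sup>2"
      by (simp only: power2_eq_square)
    hence "norm ?K \<le> 16 * R * (R powr m * \<bar>d\<bar>) powr (- 1/2)"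
      by (rule power2_le_imp_le) (use R in \<open>intro mult_nonneg_nonneg; simp\<close>)
    also have "\<dots> \<le> C * R * (R powr m * \<bar>d\<bar>) powr (- 1/2)"
      using R C by (intro mult_right_mono) auto
    finally show ?thesis .
  next
    case False
    hence \<tau>: "\<bar>d\<bar> / D < \<bar>\<tau>\<bar>" "\<tau> \<noteq> 0" using D d by (auto simp: field_simps)
    have "norm ?K \<le> 80 / sqrt (\<bar>\<tau>\<bar> * m * (1 - m) * (2 * R) powr (m - 2))"
      by (rule annulus_kernel_bounds(1)[OF m R b \<tau>(2)])
    also have "\<dots> \<le> 80 / sqrt ((\<bar>d\<bar> / D) * m * (1 - m) * (2 * R) powr (m - 2))"
      using \<tau> m R D d by (intro divide_left_mono real_sqrt_le_mono mult_right_mono mult_pos_pos) auto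
    also have "(\<bar>d\<bar> / D) * m * (1 - m) * (2 * R) powr (m - 2) = (m * (1 - m) * 2 powr (m - 2) / D) * (R powr (m - 2) * \<bar>d\<bar>)"
      using R by (simp add: powr_mult)
    also have "80 / sqrt \<dots> = C0 / sqrt (R powr (m - 2) * \<bar>d\<bar>)"
      by (simp add: C0_def real_sqrt_mult real_sqrt_divide)
    also have "1 / sqrt (R powr (m - 2) * \<bar>d\<bar>) = R * (R powr m * \<bar>d\<bar>) powr (- 1/2)"
    proof -
      have "sqrt (R powr (m - 2) * \<bar>d\<bar>) = sqrt (R powr m * \<bar>d\<bar>) / R"
        using R by (simp add: powr_diff real_sqrt_divide real_sqrt_mult)
      moreover have "(R powr m * \<bar>d\<bar>) powr (- 1/2) = 1 / sqrt (R powr m * \<bar>d\<bar>)"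
        using R d powr_minus_divide[of "R powr m * \<bar>d\<bar>" "1/2"] by (simp add: powr_half_sqrt)
      ultimately show ?thesis by simp
    qed
    hence "C0 / sqrt (R powr (m - 2) * \<bar>d\<bar>) = C0 * (R * (R powr m * \<bar>d\<bar>) powr (- 1/2))"
      by (metis mult.right_neutral times_divide_eq_right)
    also have "\<dots> \<le> C * (R * (R powr m * \<bar>d\<bar>) powr (- 1/2))"
      using R C by (intro mult_right_mono) auto
    finally show ?thesis by (simp add: mult.assoc)
  qed
  show thesis
  proof (rule that[of C])
    fix R u \<tau> b d \<beta> :: real
    assume *: "1 \<le> R" "0 \<le> b" "d \<noteq> 0" "\<bar>u - d\<bar> \<le> L * \<bar>\<tau>\<bar>" "0 \<le> \<beta>" "\<beta> \<le> 1/2"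
    let ?K = "LINT x|lborel. indicator (annulus R) x *\<^sub>R (complex_of_real (exp (- b * x\<^sup>2)) * cis (u * x + \<tau> * \<bar>x\<bar> powr m))"
    define z where "z = R powr m * \<bar>d\<bar>"
    have z: "z > 0" using * by (simp add: z_def)
    show "norm ?K \<le> C * R * (R powr m * \<bar>d\<bar>) powr (- \<beta>)"
    \<comment> \<open>All exponents \<beta> \<le> 1/2 follow from the two extreme ones: the trivial
      bound for z \<le> 1, and the decay z^(-1/2) for z > 1.\<close>
    proof (cases "z \<le> 1")
      case True
      have "norm ?K \<le> 2 * R * 1" using annulus_kernel_bounds(3)[OF m *(1,2)] by simp
      also have "\<dots> \<le> C * R * z powr (- \<beta>)"
      proof (intro mult_mono)
        have "z powr \<beta> \<le> 1" using z True * by (intro powr_le1) auto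
        thus "1 \<le> z powr - \<beta>" using z by (simp add: powr_minus field_simps)
      qed (use * C in auto)
      finally show ?thesis by (simp add: z_def)
    next
      case False
      have "norm ?K \<le> C * R * z powr (- 1/2)" using half[OF *(1-4)] by (simp add: z_def)
      also have "\<dots> \<le> C * R * z powr (- \<beta>)"
        using False * C by (intro mult_left_mono powr_mono) auto
      finally show ?thesis by (simp add: z_def)
    qed
  qed (use C in auto)
qed

section \<open>The kernel of \<open>T T*\<close>\<close>

lemma measurable_cnj [measurable]: "cnj \<in> borel_measurable borel"
  by (intro borel_measurable_continuous_onI continuous_intros)

lemma norm_integral_le_integral:
  fixes f :: "'a \<Rightarrow> 'b :: {banach, second_countable_topology}"
  assumes "integrable M f" "integrable M g" "\<And>x. x \<in> space M \<Longrightarrow> norm (f x) \<le> g x"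
  shows "norm (integral\<^sup>L M f) \<le> integral\<^sup>L M g"
proof -
  have "norm (integral\<^sup>L M f) \<le> (LINT x|M. norm (f x))" by (rule integral_norm_bound)
  also have "\<dots> \<le> integral\<^sup>L M g" using assms by (intro integral_mono) auto
  finally show ?thesis .
qed

lemma (in pair_sigma_finite) integrable_product_real:
  fixes f :: "'a \<Rightarrow> real" and g :: "'b \<Rightarrow> real"
  assumes f: "integrable M1 f" and g: "integrable M2 g"
  shows "integrable (M1 \<Otimes>\<^sub>M M2) (\<lambda>z. f (fst z) * g (snd z))"
proof -
  have [measurable]: "f \<in> borel_measurable M1" "g \<in> borel_measurable M2" using f g by auto
  have "integrable (M1 \<Otimes>\<^sub>M M2) (\<lambda>(x, y). f x * g y)"
    by (rule Fubini_integrable) (use f g in \<open>auto simp: abs_mult\<close>)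
  thus ?thesis by (simp add: case_prod_beta')
qed

text \<open>The square of the dual operator, written through the kernel of \<open>T T*\<close>.\<close>

lemma nn_integral_norm2_dual_le:
  fixes W :: "'a \<Rightarrow> complex" and U :: "'a \<Rightarrow> 'b \<Rightarrow> complex"
  assumes "sigma_finite_measure M" "finite_measure N" and W: "integrable M W"
    and U[measurable]: "(\<lambda>(x, \<xi>). U x \<xi>) \<in> borel_measurable (M \<Otimes>\<^sub>M N)"
    and U1: "\<And>x \<xi>. norm (U x \<xi>) \<le> 1"
  shows "(\<integral>\<^sup>+\<xi>. ennreal ((cmod (LINT x|M. W x * U x \<xi>))\<^sup>2) \<partial>N) \<le>
    (\<integral>\<^sup>+x. \<integral>\<^sup>+y. ennreal (cmod (W x) * cmod (W y) * cmod (LINT \<xi>|N. U x \<xi> * cnj (U y \<xi>))) \<partial>M \<partial>M)"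
proof -
  interpret M: sigma_finite_measure M by fact
  interpret N: finite_measure N by fact
  interpret MM: pair_sigma_finite M M ..
  interpret NM: pair_sigma_finite N M ..
  interpret MN: pair_sigma_finite M N ..
  interpret NMM: pair_sigma_finite N "M \<Otimes>\<^sub>M M" ..
  have [measurable]: "W \<in> borel_measurable M" using W by auto
  have [measurable]: "U x \<in> borel_measurable N" if "x \<in> space M" for x
    using measurable_compose[OF measurable_Pair1'[OF that] U] by simp
  have [measurable]: "(\<lambda>x. U x \<xi>) \<in> borel_measurable M" if "\<xi> \<in> space N" for \<xi>
    using measurable_compose[OF measurable_Pair2'[OF that] U] by simp
  define G where "G = (\<lambda>\<xi>. LINT x|M. W x * U x \<xi>)"
  define K where "K = (\<lambda>x y. LINT \<xi>|N. U x \<xi> * cnj (U y \<xi>))"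
  define h where "h = (\<lambda>\<xi> (x, y). W x * U x \<xi> * cnj (W y * U y \<xi>))"
  have nW: "integrable M (\<lambda>x. norm (W x))" using W by simp
  have [measurable]: "(\<lambda>(\<xi>, x). U x \<xi>) \<in> borel_measurable (N \<Otimes>\<^sub>M M)"
    using measurable_compose[OF measurable_pair_swap' U] by (simp add: split_beta')
  have [measurable]: "G \<in> borel_measurable N"
    unfolding G_def by measurable
  have Kmeas[measurable]: "(\<lambda>(x, y). K x y) \<in> borel_measurable (M \<Otimes>\<^sub>M M)"
    unfolding K_def by measurable
  have hm[measurable]: "(\<lambda>(\<xi>, p). h \<xi> p) \<in> borel_measurable (N \<Otimes>\<^sub>M (M \<Otimes>\<^sub>M M))"
    unfolding h_def by measurable
  have i1: "integrable M (\<lambda>x. W x * U x \<xi>)" if "\<xi> \<in> space N" for \<xi>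
    by (rule Bochner_Integration.integrable_bound[OF nW]) (use U1 that in \<open>auto simp: norm_mult mult_left_le\<close>)
  have "integrable (M \<Otimes>\<^sub>M M) (\<lambda>z. norm (W (fst z)) * norm (W (snd z)))"
    by (rule MM.integrable_product_real[OF nW nW])
  hence i2: "integrable (M \<Otimes>\<^sub>M M) (\<lambda>(x, y). norm (W x) * norm (W y))" by (simp add: split_beta')
  have hb: "norm (h \<xi> p) \<le> norm (W (fst p)) * norm (W (snd p))" for \<xi> p
  proof -
    have "norm (h \<xi> p) = norm (W (fst p)) * norm (W (snd p)) * (norm (U (fst p) \<xi>) * norm (U (snd p) \<xi>))"
      by (simp add: h_def split_beta' norm_mult)
    also have "\<dots> \<le> norm (W (fst p)) * norm (W (snd p)) * 1"
      by (intro mult_left_mono mult_le_one) (use U1 in auto)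
    finally show ?thesis by simp
  qed
  have i3: "integrable (N \<Otimes>\<^sub>M (M \<Otimes>\<^sub>M M)) (\<lambda>(\<xi>, p). h \<xi> p)"
  proof (rule Bochner_Integration.integrable_bound)
    have "integrable (N \<Otimes>\<^sub>M (M \<Otimes>\<^sub>M M)) (\<lambda>z. 1 * (\<lambda>(x, y). norm (W x) * norm (W y)) (snd z))"
      by (rule NMM.integrable_product_real[OF _ i2]) simp
    thus "integrable (N \<Otimes>\<^sub>M (M \<Otimes>\<^sub>M M)) (\<lambda>z. norm (W (fst (snd z))) * norm (W (snd (snd z))))"
      by (simp add: split_beta')
  qed (use hb in \<open>auto simp: split_beta'\<close>)
  have GG: "G \<xi> * cnj (G \<xi>) = (LINT p|(M \<Otimes>\<^sub>M M). h \<xi> p)" if \<xi>: "\<xi> \<in> space N" for \<xi>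
  proof -
    have i4: "integrable (M \<Otimes>\<^sub>M M) (\<lambda>(x,y). W x * U x \<xi> * cnj (W y * U y \<xi>))"
    proof (rule Bochner_Integration.integrable_bound[OF i2])
      show "(\<lambda>(x, y). W x * U x \<xi> * cnj (W y * U y \<xi>)) \<in> borel_measurable (M \<Otimes>\<^sub>M M)"
        using \<xi> by measurable
      show "AE x in (M \<Otimes>\<^sub>M M). norm (case x of (x, y) \<Rightarrow> W x * U x \<xi> * cnj (W y * U y \<xi>)) \<le> norm (case x of (x, y) \<Rightarrow> norm (W x) * norm (W y))"
        using hb[of \<xi>] by (auto simp: h_def split_beta')
    qed
    have "(LINT p|(M \<Otimes>\<^sub>M M). h \<xi> p) = (LINT x|M. LINT y|M. W x * U x \<xi> * cnj (W y * U y \<xi>))"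
      unfolding h_def using MM.integral_fst'[OF i4] by simp
    also have "\<dots> = (LINT x|M. W x * U x \<xi> * cnj (G \<xi>))"
      unfolding G_def by (simp del: complex_cnj_mult)
    also have "\<dots> = G \<xi> * cnj (G \<xi>)" unfolding G_def using i1[OF \<xi>] by simp
    finally show ?thesis ..
  qed
  have sq: "complex_of_real ((cmod (G \<xi>))\<^sup>2) = (LINT p|(M \<Otimes>\<^sub>M M). h \<xi> p)" if "\<xi> \<in> space N" for \<xi>
    using GG[OF that] complex_norm_square[of "G \<xi>"] by simp
  have Gb: "cmod (G \<xi>) \<le> (LINT x|M. norm (W x))" if \<xi>: "\<xi> \<in> space N" for \<xi>
    unfolding G_def by (rule norm_integral_le_integral[OF i1[OF \<xi>] nW]) (use U1 in \<open>auto simp: norm_mult mult_left_le\<close>)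
  have iG: "integrable N (\<lambda>\<xi>. (cmod (G \<xi>))\<^sup>2)"
    by (rule N.integrable_const_bound[where B = "(LINT x|M. norm (W x))\<^sup>2"]) (use Gb in \<open>auto intro!: power_mono AE_I2\<close>)
  have "complex_of_real (LINT \<xi>|N. (cmod (G \<xi>))\<^sup>2) = (LINT \<xi>|N. LINT p|(M \<Otimes>\<^sub>M M). h \<xi> p)"
    unfolding integral_complex_of_real[symmetric]
    by (rule Bochner_Integration.integral_cong[OF refl sq])
  also have "\<dots> = (LINT p|(M \<Otimes>\<^sub>M M). LINT \<xi>|N. h \<xi> p)"
    by (rule NMM.Fubini_integral[OF i3, symmetric])
  also have "\<dots> = (LINT p|(M \<Otimes>\<^sub>M M). (\<lambda>(x, y). W x * cnj (W y) * K x y) p)"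
  proof (rule Bochner_Integration.integral_cong[OF refl])
    fix p assume "p \<in> space (M \<Otimes>\<^sub>M M)"
    obtain x y where p: "p = (x, y)" by (cases p)
    have "(LINT \<xi>|N. h \<xi> p) = (LINT \<xi>|N. (W x * cnj (W y)) * (U x \<xi> * cnj (U y \<xi>)))"
      unfolding h_def p by (simp add: mult_ac)
    also have "\<dots> = (W x * cnj (W y)) * K x y" unfolding K_def
      by (rule integral_mult_right_zero)
    finally show "(LINT \<xi>|N. h \<xi> p) = (\<lambda>(x, y). W x * cnj (W y) * K x y) p" by (simp add: p)
  qed
  finally have eq: "complex_of_real (LINT \<xi>|N. (cmod (G \<xi>))\<^sup>2) = (LINT p|(M \<Otimes>\<^sub>M M). (\<lambda>(x, y). W x * cnj (W y) * K x y) p)" .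
  have "ennreal (LINT \<xi>|N. (cmod (G \<xi>))\<^sup>2) = ennreal (norm (complex_of_real (LINT \<xi>|N. (cmod (G \<xi>))\<^sup>2)))"
    by simp
  also have "\<dots> = ennreal (norm (LINT p|(M \<Otimes>\<^sub>M M). (\<lambda>(x, y). W x * cnj (W y) * K x y) p))"
    unfolding eq ..
  also have "\<dots> \<le> (\<integral>\<^sup>+p. ennreal (norm ((\<lambda>(x, y). W x * cnj (W y) * K x y) p)) \<partial>(M \<Otimes>\<^sub>M M))"
  \<comment> \<open>An undefined Bochner integral is 0, so the inequality holds in the other case
    too.\<close>
  proof (cases "integrable (M \<Otimes>\<^sub>M M) (\<lambda>(x, y). W x * cnj (W y) * K x y)")
    case True
    thus ?thesis using integral_norm_bound_ennreal by blast
  qed (simp add: not_integrable_integral_eq)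
  also have "\<dots> = (\<integral>\<^sup>+p. (\<lambda>(x, y). ennreal (cmod (W x) * cmod (W y) * cmod (K x y))) p \<partial>(M \<Otimes>\<^sub>M M))"
    by (intro nn_integral_cong) (auto simp: norm_mult)
  also have "\<dots> = (\<integral>\<^sup>+x. \<integral>\<^sup>+y. ennreal (cmod (W x) * cmod (W y) * cmod (K x y)) \<partial>M \<partial>M)"
    by (subst M.nn_integral_fst[symmetric]) auto
  also have "ennreal (LINT \<xi>|N. (cmod (G \<xi>))\<^sup>2) = (\<integral>\<^sup>+\<xi>. ennreal ((cmod (G \<xi>))\<^sup>2) \<partial>N)"
    using nn_integral_eq_integral[OF iG] by simp
  finally show ?thesis unfolding G_def K_def .
qed

section \<open>A Young inequality for kernels and the T T* bound\<close>

text \<open>Here \<kappa> stands for the kernel at (x, y), v and w for |T|^q at x and at y, and P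
  for the integral of |T|^q. The three terms on the right are normalised so that their double
  integrals are at most 1/q, 1/q and 1 - 2/q, which add up to 1; integration thus bounds the
  bilinear form of the kernel by A P^(2 - 2/q). The left side is A P^(2 - 2/q) times a weighted
  geometric mean of these terms, and the inequality is the one between geometric and arithmetic
  means.\<close>

lemma schur_young_pointwise:
  fixes q A P v w \<kappa> :: real
  assumes q: "2 \<le> q" and "0 < A" "0 < P" "0 \<le> v" "0 \<le> w" "0 \<le> \<kappa>"
  shows "v powr (1 - 1/q) * w powr (1 - 1/q) * \<kappa> \<le> A * P powr (2 - 2/q) *
     (1/q * (\<kappa> powr (q/2) * v / (A powr (q/2) * P)) + 1/q * (\<kappa> powr (q/2) * w / (A powr (q/2) * P))
       + (1 - 2/q) * (v * w / P\<^sup>2))" (is "?L \<le> A * P powr (2 - 2/q) * ?S")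
proof (cases "v = 0 \<or> w = 0 \<or> \<kappa> = 0")
  case True
  have "?S \<ge> 0" using assms by (intro add_nonneg_nonneg mult_nonneg_nonneg divide_nonneg_nonneg) auto
  hence "0 \<le> A * P powr (2 - 2/q) * ?S" using assms by (intro mult_nonneg_nonneg) auto
  moreover have "?L = 0" using True by auto
  ultimately show ?thesis by (simp only:)
next
  case False
  hence pos: "0 < v" "0 < w" "0 < \<kappa>" using assms by auto
  define X where "X = \<kappa> powr (q/2) * v / (A powr (q/2) * P)"
  define Y where "Y = \<kappa> powr (q/2) * w / (A powr (q/2) * P)"
  define Z where "Z = v * w / P\<^sup>2"
  have XYZ: "X > 0" "Y > 0" "Z > 0" using pos assms by (auto simp: X_def Y_def Z_def)
  \<comment> \<open>In logarithmic coordinates the identity with the geometric mean becomes a linear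
    identity between exponents.\<close>
  obtain k a b c p where e: "\<kappa> = exp k" "v = exp a" "w = exp b" "A = exp c" "P = exp p"
    using pos assms by (metis exp_ln)
  have "?L = A * P powr (2 - 2/q) * (((X * Y) powr (1/2)) powr (2/q) * Z powr (1 - 2/q))"
    unfolding X_def Y_def Z_def e power2_eq_square powr_def
    using q by (simp flip: exp_add exp_diff) (simp add: field_simps)
  also have "\<dots> \<le> A * P powr (2 - 2/q) * (2/q * ((X + Y)/2) + (1 - 2/q) * Z)"
  proof (rule mult_left_mono)
    have "((X * Y) powr (1/2)) powr (2/q) * Z powr (1 - 2/q) \<le> 2/q * (X * Y) powr (1/2) + (1 - 2/q) * Z"
      by (rule Youngs_inequality_0) (use q XYZ in auto)
    also have "2/q * (X * Y) powr (1/2) \<le> 2/q * ((X + Y) / 2)"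
      using arith_geo_mean_sqrt[of X Y] XYZ q by (intro mult_left_mono) (auto simp: powr_half_sqrt)
    finally show "((X * Y) powr (1/2)) powr (2/q) * Z powr (1 - 2/q) \<le> 2/q * ((X + Y)/2) + (1 - 2/q) * Z"
      by simp
  qed (use assms in auto)
  finally have "?L \<le> A * P powr (2 - 2/q) * (2/q * ((X + Y)/2) + (1 - 2/q) * Z)" .
  also have "2/q * ((X + Y)/2) + (1 - 2/q) * Z = ?S"
    unfolding X_def Y_def Z_def using q by (simp add: algebra_simps add_divide_distrib)
  finally show ?thesis .
qed

text \<open>Duality. Pairing T with W = cnj T |T|^(q - 2) gives P, the integral of |T|^q, and Fubini
  rewrites it as the pairing of g with the dual operator G applied to W. Cauchy-Schwarz, the kernel
  form of the L^2 norm of G and the Young inequality above yield P^2 \<le> A P^(2 - 2/q) B^2;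
  dividing leaves P^(2/q) \<le> A B^2.\<close>

lemma TTstar_estimate:
  fixes \<mu> :: "'a measure" and N :: "'b measure" and U :: "'a \<Rightarrow> 'b \<Rightarrow> complex" and g :: "'b \<Rightarrow> complex"
  assumes "finite_measure \<mu>" "finite_measure N" and q: "2 \<le> q"
    and U[measurable]: "(\<lambda>(x, \<xi>). U x \<xi>) \<in> borel_measurable (\<mu> \<Otimes>\<^sub>M N)"
    and U1: "\<And>x \<xi>. norm (U x \<xi>) \<le> 1"
    and g[measurable]: "g \<in> borel_measurable N" and gB: "(\<integral>\<^sup>+\<xi>. ennreal ((cmod (g \<xi>))\<^sup>2) \<partial>N) \<le> ennreal (B\<^sup>2)"
    and B: "0 \<le> B" and A: "0 < A"
    and K: "\<And>x. x \<in> space \<mu> \<Longrightarrow>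
        (\<integral>\<^sup>+y. ennreal (cmod (LINT \<xi>|N. U x \<xi> * cnj (U y \<xi>)) powr (q/2)) \<partial>\<mu>) \<le> ennreal (A powr (q/2))"
  shows "(\<integral>\<^sup>+x. ennreal (cmod (LINT \<xi>|N. U x \<xi> * g \<xi>) powr q) \<partial>\<mu>) \<le> ennreal ((sqrt A * B) powr q)"
proof -
  interpret M: finite_measure \<mu> by fact
  interpret N: finite_measure N by fact
  interpret MM: pair_sigma_finite \<mu> \<mu> ..
  interpret MN: pair_sigma_finite \<mu> N ..
  have [measurable]: "U x \<in> borel_measurable N" if "x \<in> space \<mu>" for x
    using measurable_compose[OF measurable_Pair1'[OF that] U] by simp
  have [measurable]: "(\<lambda>(\<xi>, x). U x \<xi>) \<in> borel_measurable (N \<Otimes>\<^sub>M \<mu>)"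
    using measurable_compose[OF measurable_pair_swap' U] by (simp add: split_beta')
  define k where "k = (\<lambda>x y. cmod (LINT \<xi>|N. U x \<xi> * cnj (U y \<xi>)))"
  have [measurable]: "(\<lambda>(x, y). k x y) \<in> borel_measurable (\<mu> \<Otimes>\<^sub>M \<mu>)"
    unfolding k_def by measurable
  have [measurable]: "k x \<in> borel_measurable \<mu>" if "x \<in> space \<mu>" for x
    unfolding k_def using that by measurable
  have ksym: "k x y = k y x" for x y
  proof -
    have "(LINT \<xi>|N. U x \<xi> * cnj (U y \<xi>)) = (LINT \<xi>|N. cnj (U y \<xi> * cnj (U x \<xi>)))" by (simp add: mult.commute)
    also have "\<dots> = cnj (LINT \<xi>|N. U y \<xi> * cnj (U x \<xi>))" by (rule Bochner_Integration.integral_cnj)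
    finally show ?thesis by (simp add: k_def)
  qed
  define T where "T = (\<lambda>x. LINT \<xi>|N. U x \<xi> * g \<xi>)"
  have [measurable]: "T \<in> borel_measurable \<mu>" unfolding T_def by measurable
  have "integrable N (\<lambda>\<xi>. (cmod (g \<xi>))\<^sup>2)"
    by (rule integrableI_bounded) (use gB in \<open>auto simp: less_top[symmetric] top_unique\<close>)
  hence gi: "integrable N g"
    using N.square_integrable_imp_integrable[of "\<lambda>x. cmod (g x)"] integrable_norm_cancel[of N g] by simp
  define B1 where "B1 = (LINT \<xi>|N. cmod (g \<xi>))"
  have i1: "integrable N (\<lambda>\<xi>. U x \<xi> * g \<xi>)" if "x \<in> space \<mu>" for x
    by (rule Bochner_Integration.integrable_bound[OF gi]) (use U1 that in \<open>auto simp: norm_mult mult_left_le_one_le\<close>)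
  have Tb: "cmod (T x) \<le> B1" if "x \<in> space \<mu>" for x
    unfolding T_def B1_def by (rule norm_integral_le_integral[OF i1[OF that] integrable_norm[OF gi]])
      (use U1 in \<open>auto simp: norm_mult mult_left_le_one_le\<close>)
  define V where "V = (\<lambda>x. cmod (T x) powr q)"
  have [measurable]: "V \<in> borel_measurable \<mu>" unfolding V_def by measurable
  have V0: "V x \<ge> 0" for x by (simp add: V_def)
  have Vi: "integrable \<mu> V"
    by (rule M.integrable_const_bound[where B = "B1 powr q"]) (use Tb q in \<open>auto simp: V_def intro!: powr_mono2\<close>)
  \<comment> \<open>T is bounded and \<mu> is finite, so P is a real number; this is what permits
    the division by a power of P at the end.\<close>
  define P where "P = (LINT x|\<mu>. V x)"
  have P0: "P \<ge> 0" unfolding P_def using V0 by (intro integral_nonneg_AE) auto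
  have VP: "(\<integral>\<^sup>+x. ennreal (V x) \<partial>\<mu>) = ennreal P"
    unfolding P_def by (rule nn_integral_eq_integral[OF Vi]) (use V0 in auto)
  show ?thesis
  proof (cases "P = 0")
    case True
    thus ?thesis using VP by (simp add: V_def T_def)
  next
    case False
    hence P: "P > 0" using P0 by simp
    \<comment> \<open>The extremal function for duality in L^q: W T = |T|^q, and |W| is the power 1
      - 1/q of |T|^q that the pointwise inequality expects.\<close>
    define W where "W = (\<lambda>x. cnj (T x) * complex_of_real (cmod (T x) powr (q - 2)))"
    have [measurable]: "W \<in> borel_measurable \<mu>" unfolding W_def by measurable
    have nW: "cmod (W x) = V x powr (1 - 1/q)" for x
    proof (cases "T x = 0")
      case False
      have "cmod (W x) = cmod (T x) powr 1 * cmod (T x) powr (q - 2)" by (simp add: W_def norm_mult)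
      also have "\<dots> = cmod (T x) powr (q - 1)"
        by (simp add: powr_mult_base add.commute)
      also have "\<dots> = V x powr (1 - 1/q)" unfolding V_def powr_powr using q by (simp add: right_diff_distrib)
      finally show ?thesis .
    qed (auto simp: W_def V_def)
    have WT: "W x * T x = complex_of_real (V x)" for x
    proof (cases "T x = 0")
      case False
      have "W x * T x = complex_of_real ((cmod (T x))\<^sup>2 * cmod (T x) powr (q - 2))"
        using complex_norm_square[of "T x"] by (simp add: W_def mult_ac)
      also have "(cmod (T x))\<^sup>2 = cmod (T x) powr 2" using False by (simp add: powr_numeral)
      also have "cmod (T x) powr 2 * cmod (T x) powr (q - 2) = V x" unfolding V_def powr_add[symmetric] by simp
      finally show ?thesis .
    qed (auto simp: W_def V_def)
    have Wb: "cmod (W x) \<le> (B1 powr q) powr (1 - 1/q)" if "x \<in> space \<mu>" for x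
      unfolding nW V_def using Tb[OF that] q by (intro powr_mono2) (auto simp: field_simps)
    have Wi: "integrable \<mu> W"
      by (rule M.integrable_const_bound[OF AE_I2[OF Wb]]) auto
    define G where "G = (\<lambda>\<xi>. LINT x|\<mu>. W x * U x \<xi>)"
    have [measurable]: "G \<in> borel_measurable N" unfolding G_def by measurable
    have i2: "integrable (\<mu> \<Otimes>\<^sub>M N) (\<lambda>(x, \<xi>). W x * (U x \<xi> * g \<xi>))"
    proof (rule Bochner_Integration.integrable_bound)
      show "integrable (\<mu> \<Otimes>\<^sub>M N) (\<lambda>z. cmod (W (fst z)) * cmod (g (snd z)))"
        by (rule MN.integrable_product_real) (use Wi gi in auto)
      show "AE x in (\<mu> \<Otimes>\<^sub>M N). norm (case x of (x, \<xi>) \<Rightarrow> W x * (U x \<xi> * g \<xi>)) \<le> norm (cmod (W (fst x)) * cmod (g (snd x)))"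
        using U1 by (auto simp: norm_mult split_beta' intro!: mult_left_mono mult_left_le_one_le)
    qed auto
    have "complex_of_real P = (LINT x|\<mu>. W x * T x)" unfolding P_def WT by simp
    also have "\<dots> = (LINT x|\<mu>. LINT \<xi>|N. W x * (U x \<xi> * g \<xi>))" unfolding T_def by simp
    also have "\<dots> = (LINT \<xi>|N. LINT x|\<mu>. W x * (U x \<xi> * g \<xi>))"
      using MN.Fubini_integral[OF i2] by simp
    also have "\<dots> = (LINT \<xi>|N. LINT x|\<mu>. (W x * U x \<xi>) * g \<xi>)" by (simp only: mult.assoc)
    also have "\<dots> = (LINT \<xi>|N. G \<xi> * g \<xi>)" unfolding G_def by simp
    finally have PG: "complex_of_real P = (LINT \<xi>|N. G \<xi> * g \<xi>)" .
    have "ennreal P = ennreal (norm (LINT \<xi>|N. G \<xi> * g \<xi>))" using PG[symmetric] P by simp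
    also have "\<dots> \<le> (\<integral>\<^sup>+\<xi>. ennreal (norm (G \<xi> * g \<xi>)) \<partial>N)"
    proof (cases "integrable N (\<lambda>\<xi>. G \<xi> * g \<xi>)")
      case True thus ?thesis by (rule integral_norm_bound_ennreal)
    qed (simp add: not_integrable_integral_eq)
    also have "\<dots> = (\<integral>\<^sup>+\<xi>. ennreal (cmod (G \<xi>)) * ennreal (cmod (g \<xi>)) \<partial>N)"
      by (simp add: norm_mult ennreal_mult)
    finally have "(ennreal P)\<^sup>2 \<le> (\<integral>\<^sup>+\<xi>. ennreal (cmod (G \<xi>)) * ennreal (cmod (g \<xi>)) \<partial>N)\<^sup>2"
      by (intro power_mono) auto
    also have "\<dots> \<le> (\<integral>\<^sup>+\<xi>. (ennreal (cmod (G \<xi>)))\<^sup>2 \<partial>N) * (\<integral>\<^sup>+\<xi>. (ennreal (cmod (g \<xi>)))\<^sup>2 \<partial>N)"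
      by (rule Cauchy_Schwarz_nn_integral) auto
    also have "\<dots> \<le> (\<integral>\<^sup>+\<xi>. ennreal ((cmod (G \<xi>))\<^sup>2) \<partial>N) * ennreal (B\<^sup>2)"
      using gB by (intro mult_mono) (auto simp: ennreal_power)
    also have "(\<integral>\<^sup>+\<xi>. ennreal ((cmod (G \<xi>))\<^sup>2) \<partial>N) \<le>
        (\<integral>\<^sup>+x. \<integral>\<^sup>+y. ennreal (cmod (W x) * cmod (W y) * k x y) \<partial>\<mu> \<partial>\<mu>)"
      unfolding G_def k_def by (rule nn_integral_norm2_dual_le[OF _ _ Wi U U1]) unfold_locales
    also have "\<dots> \<le> ennreal (A * P powr (2 - 2/q))"
    proof -
      \<comment> \<open>Coefficients of the pointwise inequality. After integration the bracket
        collapses to 1/q + 1/q + (1 - 2/q) = 1, which leaves \<open>c0\<close>.\<close>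
      define c1 where "c1 = 1/q / (A powr (q/2) * P)"
      define c2 where "c2 = (1 - 2/q) / P\<^sup>2"
      define c0 where "c0 = A * P powr (2 - 2/q)"
      have c: "c0 \<ge> 0" "c1 \<ge> 0" "c2 \<ge> 0" using q A P by (auto simp: c0_def c1_def c2_def)
      have "(\<integral>\<^sup>+x. \<integral>\<^sup>+y. ennreal (cmod (W x) * cmod (W y) * k x y) \<partial>\<mu> \<partial>\<mu>)
        \<le> (\<integral>\<^sup>+x. \<integral>\<^sup>+y. ennreal c0 * (ennreal (c1 * V x) * ennreal (k x y powr (q/2)) + ennreal c1 * ennreal (V y * k x y powr (q/2))
             + ennreal (c2 * V x) * ennreal (V y)) \<partial>\<mu> \<partial>\<mu>)"
      proof (intro nn_integral_mono)
        fix x y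
        have "cmod (W x) * cmod (W y) * k x y \<le> c0 * (1/q * (k x y powr (q/2) * V x / (A powr (q/2) * P)) + 1/q * (k x y powr (q/2) * V y / (A powr (q/2) * P))
       + (1 - 2/q) * (V x * V y / P\<^sup>2))"
          unfolding nW c0_def by (rule schur_young_pointwise[OF q A P V0 V0]) (simp add: k_def)
        also have "\<dots> = c0 * (c1 * V x * k x y powr (q/2) + c1 * (V y * k x y powr (q/2)) + c2 * V x * V y)"
          unfolding c1_def c2_def by (simp add: field_simps)
        finally have "ennreal (cmod (W x) * cmod (W y) * k x y) \<le> ennreal \<dots>" by (rule ennreal_leI)
        also have "\<dots> = ennreal c0 * (ennreal (c1 * V x) * ennreal (k x y powr (q/2)) + ennreal c1 * ennreal (V y * k x y powr (q/2))
             + ennreal (c2 * V x) * ennreal (V y))"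
          using c V0 by (simp add: ennreal_mult ennreal_plus)
        finally show "ennreal (cmod (W x) * cmod (W y) * k x y) \<le> \<dots>" .
      qed
      also have "\<dots> = (\<integral>\<^sup>+x. ennreal c0 * (ennreal (c1 * V x) * (\<integral>\<^sup>+y. ennreal (k x y powr (q/2)) \<partial>\<mu>)
            + ennreal c1 * (\<integral>\<^sup>+y. ennreal (V y * k x y powr (q/2)) \<partial>\<mu>)
             + ennreal (c2 * V x) * ennreal P) \<partial>\<mu>)"
        by (intro nn_integral_cong) (simp add: nn_integral_cmult nn_integral_add VP)
      also have "\<dots> = ennreal c0 * ((\<integral>\<^sup>+x. ennreal (c1 * V x) * (\<integral>\<^sup>+y. ennreal (k x y powr (q/2)) \<partial>\<mu>) \<partial>\<mu>)
            + ennreal c1 * (\<integral>\<^sup>+x. \<integral>\<^sup>+y. ennreal (V y * k x y powr (q/2)) \<partial>\<mu> \<partial>\<mu>)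
             + ennreal c2 * ennreal P * ennreal P)"
        using c V0 by (simp add: nn_integral_cmult nn_integral_add nn_integral_multc ennreal_mult VP)
      also have "(\<integral>\<^sup>+x. \<integral>\<^sup>+y. ennreal (V y * k x y powr (q/2)) \<partial>\<mu> \<partial>\<mu>) = (\<integral>\<^sup>+y. \<integral>\<^sup>+x. ennreal (V y * k x y powr (q/2)) \<partial>\<mu> \<partial>\<mu>)"
        by (rule MM.Fubini') measurable
      also have "\<dots> = (\<integral>\<^sup>+y. ennreal (V y) * (\<integral>\<^sup>+x. ennreal (k y x powr (q/2)) \<partial>\<mu>) \<partial>\<mu>)"
        using V0 by (intro nn_integral_cong) (simp add: ksym[of _ y for y] ennreal_mult nn_integral_cmult)
      also have "\<dots> \<le> (\<integral>\<^sup>+y. ennreal (V y) * ennreal (A powr (q/2)) \<partial>\<mu>)"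
        using K unfolding k_def by (intro nn_integral_mono mult_left_mono) auto
      also have "\<dots> = ennreal (P * A powr (q/2))" using P by (simp add: nn_integral_multc VP ennreal_mult)
      also have "(\<integral>\<^sup>+x. ennreal (c1 * V x) * (\<integral>\<^sup>+y. ennreal (k x y powr (q/2)) \<partial>\<mu>) \<partial>\<mu>)
          \<le> (\<integral>\<^sup>+x. ennreal (c1 * V x) * ennreal (A powr (q/2)) \<partial>\<mu>)"
        using K unfolding k_def by (intro nn_integral_mono mult_left_mono) auto
      also have "\<dots> = ennreal (c1 * P * A powr (q/2))"
        using P c V0 by (simp add: nn_integral_multc nn_integral_cmult VP ennreal_mult)
      also have "ennreal c0 * (ennreal (c1 * P * A powr (q/2)) + ennreal c1 * ennreal (P * A powr (q/2)) + ennreal c2 * ennreal P * ennreal P)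
         = ennreal (c0 * (c1 * P * A powr (q/2) + c1 * (P * A powr (q/2)) + c2 * P * P))"
        using c P by (simp add: mult_ac flip: ennreal_mult ennreal_plus)
      also have "c1 * P * A powr (q/2) + c1 * (P * A powr (q/2)) + c2 * P * P = 1"
        unfolding c1_def c2_def using q P A by (simp add: field_simps power2_eq_square)
      finally show ?thesis by (simp add: c0_def add_mono mult_left_mono)
    qed
    finally have "(ennreal P)\<^sup>2 \<le> ennreal (A * P powr (2 - 2/q)) * ennreal (B\<^sup>2)"
      by (simp add: mult_right_mono)
    also have "\<dots> = ennreal (A * P powr (2 - 2/q) * B\<^sup>2)" using A by (simp add: ennreal_mult)
    finally have "P\<^sup>2 \<le> A * P powr (2 - 2/q) * B\<^sup>2" using P A by (simp add: ennreal_power ennreal_le_iff)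
    moreover have "P\<^sup>2 = P powr (2/q) * P powr (2 - 2/q)" using P by (simp flip: powr_add)
    ultimately have "P powr (2/q) \<le> A * B\<^sup>2" using P by (simp add: mult_ac)
    hence "(P powr (2/q)) powr (q/2) \<le> (A * B\<^sup>2) powr (q/2)" using q by (intro powr_mono2) auto
    also have "(P powr (2/q)) powr (q/2) = P" using q P by (simp add: powr_powr)
    also have "A * B\<^sup>2 = (sqrt A * B)\<^sup>2" using A by (simp add: power_mult_distrib)
    also have "((sqrt A * B)\<^sup>2) powr (q/2) = (sqrt A * B) powr q"
      using A B by (simp add: powr_power[symmetric] powr_powr flip: powr_numeral)
    finally show ?thesis using VP by (simp add: V_def T_def ennreal_leI)
  qed
qed

section \<open>Schwartz functions\<close>

text \<open>Spares any formula for iterated derivatives: a class that is stable under one derivative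
  and consists of rapidly decreasing differentiable functions lies inside
  \<open>schwartz\<close>.\<close>

lemma schwartz_coinduct:
  assumes "f \<in> X"
    and "\<And>f. f \<in> X \<Longrightarrow> (\<forall>x. f differentiable (at x)) \<and> vderiv f \<in> X \<and> (\<forall>n. bounded (range (\<lambda>x. x ^ n *\<^sub>R f x)))"
  shows "f \<in> schwartz"
proof -
  have "(vderiv ^^ k) f \<in> X" for k by (induction k) (use assms in auto)
  thus ?thesis using assms(2) unfolding schwartz_def by blast
qed

lemma schwartz_vderiv: "f \<in> schwartz \<Longrightarrow> vderiv f \<in> schwartz"
proof -
  assume f: "f \<in> schwartz"
  have "(vderiv ^^ k) (vderiv f) = (vderiv ^^ Suc k) f" for k by (simp only: funpow_Suc_right comp_def)
  thus ?thesis using f unfolding schwartz_def by (simp only: mem_Collect_eq) blast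
qed

lemma schwartz_differentiable:
  assumes "f \<in> schwartz" shows "f differentiable (at x)"
proof -
  have "(vderiv ^^ 0) f differentiable (at x)" using assms unfolding schwartz_def by blast
  thus ?thesis by simp
qed

lemma schwartz_has_vector_derivative:
  "f \<in> schwartz \<Longrightarrow> (f has_vector_derivative vderiv f x) (at x)"
  using schwartz_differentiable vector_derivative_works by (auto simp: vderiv_def)

lemma schwartz_bounded:
  assumes "f \<in> schwartz" shows "bounded (range (\<lambda>x. x ^ n *\<^sub>R f x))"
proof -
  have "bounded (range (\<lambda>x. x ^ n *\<^sub>R (vderiv ^^ 0) f x))" using assms unfolding schwartz_def by blast
  thus ?thesis by simp
qed

lemma vderivI: "(\<And>x. (f has_vector_derivative f' x) (at x)) \<Longrightarrow> vderiv f = f'"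
  unfolding vderiv_def by (auto intro!: vector_derivative_at)

section \<open>Closure properties of the Schwartz class\<close>

text \<open>The Japanese bracket of x raised to the power 2 a, so that the multiplier in
  \<open>bessel s\<close> is \<open>japanese (s / 2)\<close>.\<close>

definition japanese :: "real \<Rightarrow> real \<Rightarrow> complex" where
  "japanese a x = complex_of_real ((1 + x\<^sup>2) powr a)"

lemma norm_japanese [simp]: "norm (japanese a x) = (1 + x\<^sup>2) powr a"
  unfolding japanese_def norm_of_real by simp

lemma one_plus_square_pos [simp]: "0 < 1 + (x::real)\<^sup>2" "1 + x\<^sup>2 \<noteq> 0"
  by (smt (verit) zero_le_power2)+

lemma japanese_has_vector_derivative:
  "(japanese a has_vector_derivative (complex_of_real (2 * a) * (complex_of_real x * japanese (a - 1) x))) (at x)"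
proof -
  have "((\<lambda>x. (1 + x\<^sup>2) powr a) has_real_derivative a * (1 + x\<^sup>2) powr (a - 1) * (2 * x)) (at x)"
    by (rule DERIV_fun_powr[where r = a, THEN DERIV_cong]) (auto intro!: derivative_eq_intros)
  hence "((\<lambda>x. complex_of_real ((1 + x\<^sup>2) powr a)) has_vector_derivative complex_of_real (a * (1 + x\<^sup>2) powr (a - 1) * (2 * x))) (at x)"
    by (intro has_vector_derivative_of_real) (simp add: has_real_derivative_iff_has_vector_derivative)
  thus ?thesis by (simp add: japanese_def[abs_def] mult_ac)
qed

lemma cis_has_vector_derivative:
  "((\<lambda>x. cis (t * x)) has_vector_derivative (\<i> * complex_of_real t * cis (t * x))) (at x)"
proof -
  have "((\<lambda>x. exp (\<i> * complex_of_real t * x)) has_field_derivative (\<i> * complex_of_real t * exp (\<i> * complex_of_real t * x))) (at (complex_of_real x))"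
    by (auto intro!: derivative_eq_intros)
  from has_vector_derivative_real_field[OF this] show ?thesis
    by (simp add: cis_conv_exp mult_ac)
qed

lemma gaussian_has_vector_derivative:
  "((\<lambda>x. complex_of_real (exp (- x\<^sup>2))) has_vector_derivative (complex_of_real (-2) * (complex_of_real x * complex_of_real (exp (- x\<^sup>2))))) (at x)"
proof -
  have "((\<lambda>x::real. exp (- x\<^sup>2)) has_real_derivative (exp (- x\<^sup>2) * (- 2 * x))) (at x)"
    by (auto intro!: derivative_eq_intros)
  hence "((\<lambda>x. complex_of_real (exp (- x\<^sup>2))) has_vector_derivative complex_of_real (exp (- x\<^sup>2) * (- 2 * x))) (at x)"
    by (intro has_vector_derivative_of_real) (simp add: has_real_derivative_iff_has_vector_derivative)
  thus ?thesis by (simp add: mult_ac)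
qed

text \<open>All multipliers needed later are put into one class, since differentiating one of them
  produces others: the derivative of \<open>japanese a\<close> is a multiple of x times
  \<open>japanese (a - 1)\<close>. The class is stable under derivatives as a whole, so it coincides
  with \<open>schwartz\<close>, and its introduction rules become closure rules for Schwartz
  functions.\<close>

inductive_set schwartz_closure :: "(real \<Rightarrow> complex) set" where
  base: "f \<in> schwartz \<Longrightarrow> f \<in> schwartz_closure"
| gaussian: "(\<lambda>x. complex_of_real (exp (- x\<^sup>2))) \<in> schwartz_closure"
| add: "f \<in> schwartz_closure \<Longrightarrow> g \<in> schwartz_closure \<Longrightarrow> (\<lambda>x. f x + g x) \<in> schwartz_closure"
| scale: "f \<in> schwartz_closure \<Longrightarrow> (\<lambda>x. c * f x) \<in> schwartz_closure"
| times_x: "f \<in> schwartz_closure \<Longrightarrow> (\<lambda>x. complex_of_real x * f x) \<in> schwartz_closure"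
| times_japanese: "f \<in> schwartz_closure \<Longrightarrow> (\<lambda>x. japanese a x * f x) \<in> schwartz_closure"
| times_cis: "f \<in> schwartz_closure \<Longrightarrow> (\<lambda>x. cis (t * x) * f x) \<in> schwartz_closure"

lemma power_div_fact_le_exp:
  fixes y :: real
  assumes "0 \<le> y" shows "y ^ n / fact n \<le> exp y"
proof -
  have "(\<Sum>k\<in>{n}. y ^ k /\<^sub>R fact k) \<le> (\<Sum>k. y ^ k /\<^sub>R fact k)"
    by (rule sum_le_suminf[OF summable_exp_generic]) (use assms in auto)
  thus ?thesis by (simp add: exp_def divide_inverse mult.commute)
qed

lemma exp_minus_square_times_power_bounded:
  "bounded (range (\<lambda>x::real. x ^ n *\<^sub>R complex_of_real (exp (- x\<^sup>2))))"
proof -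
  have "\<bar>x ^ n\<bar> * exp (- x\<^sup>2) \<le> fact n" for x :: real
  proof -
    have "\<bar>x ^ n\<bar> \<le> fact n * exp (x\<^sup>2)"
    proof (cases "\<bar>x\<bar> \<le> 1")
      case True
      hence "\<bar>x ^ n\<bar> \<le> 1" by (simp add: power_abs power_le_one)
      also have "1 \<le> fact n * exp (x\<^sup>2)" using mult_mono[of 1 "fact n" 1 "exp (x\<^sup>2)"] by simp
      finally show ?thesis .
    next
      case False
      have "\<bar>x\<bar> ^ n * 1 \<le> \<bar>x\<bar> ^ n * \<bar>x\<bar> ^ n" using False by (intro mult_left_mono) auto
      hence "\<bar>x ^ n\<bar> \<le> \<bar>x\<bar> ^ n * \<bar>x\<bar> ^ n" by (simp add: power_abs)
      also have "\<dots> = (x\<^sup>2) ^ n" by (simp add: power2_eq_square power_mult_distrib[symmetric])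
      also have "(x\<^sup>2) ^ n / fact n \<le> exp (x\<^sup>2)"
        by (rule power_div_fact_le_exp) simp
      finally show ?thesis by (simp add: field_simps)
    qed
    hence "\<bar>x ^ n\<bar> * exp (- x\<^sup>2) \<le> fact n * exp (x\<^sup>2) * exp (- x\<^sup>2)" by (intro mult_right_mono) auto
    thus ?thesis by (simp add: exp_minus field_simps)
  qed
  thus ?thesis by (intro boundedI[where B = "fact n"]) (auto simp: abs_mult)
qed

lemma schwartz_closure_step:
  "f \<in> schwartz_closure \<Longrightarrow> (\<forall>x. (f has_vector_derivative vderiv f x) (at x)) \<and> vderiv f \<in> schwartz_closure \<and> (\<forall>n. bounded (range (\<lambda>x. x ^ n *\<^sub>R f x)))"
proof (induction rule: schwartz_closure.induct)
  case (base f)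
  thus ?case using schwartz_vderiv schwartz_has_vector_derivative schwartz_bounded schwartz_closure.base by blast
next
  case gaussian
  have v: "vderiv (\<lambda>x. complex_of_real (exp (- x\<^sup>2))) = (\<lambda>x. complex_of_real (-2) * (complex_of_real x * complex_of_real (exp (- x\<^sup>2))))"
    by (intro vderivI gaussian_has_vector_derivative)
  have "(\<lambda>x. complex_of_real (-2) * (complex_of_real x * complex_of_real (exp (- x\<^sup>2)))) \<in> schwartz_closure"
    by (intro schwartz_closure.intros)
  thus ?case unfolding v using gaussian_has_vector_derivative exp_minus_square_times_power_bounded by blast
next
  case (add f g)
  have d: "((\<lambda>x. f x + g x) has_vector_derivative (vderiv f x + vderiv g x)) (at x)" for x
    using add by (intro has_vector_derivative_add) auto
  have v: "vderiv (\<lambda>x. f x + g x) = (\<lambda>x. vderiv f x + vderiv g x)" by (intro vderivI d)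
  have "bounded (range (\<lambda>x. x ^ n *\<^sub>R f x + x ^ n *\<^sub>R g x))" for n
    using add by (intro bounded_plus_comp) auto
  hence "\<forall>n. bounded (range (\<lambda>x. x ^ n *\<^sub>R (f x + g x)))" by (simp add: scaleR_add_right)
  thus ?case unfolding v using d add by (auto intro: schwartz_closure.intros)
next
  case (scale f c)
  have d: "((\<lambda>x. c * f x) has_vector_derivative (c * vderiv f x)) (at x)" for x
    using scale by (auto intro!: derivative_eq_intros)
  have v: "vderiv (\<lambda>x. c * f x) = (\<lambda>x. c * vderiv f x)" by (intro vderivI d)
  have "bounded (range (\<lambda>x. x ^ n *\<^sub>R (c * f x)))" for n
  proof -
    have "bounded ((\<lambda>z. c * z) ` range (\<lambda>x. x ^ n *\<^sub>R f x))"
      by (rule bounded_linear_image[OF _ bounded_linear_mult_right]) (use scale in blast)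
    thus ?thesis by (simp add: image_image mult_scaleR_right)
  qed
  thus ?case unfolding v using d scale by (auto intro: schwartz_closure.intros)
next
  case (times_x f)
  have d: "((\<lambda>x. complex_of_real x * f x) has_vector_derivative (complex_of_real x * vderiv f x + f x)) (at x)" for x
  proof -
    have "((\<lambda>x. complex_of_real x * f x) has_vector_derivative (complex_of_real x * vderiv f x + complex_of_real 1 * f x)) (at x)"
      using times_x by (intro has_vector_derivative_mult has_vector_derivative_of_real) auto
    thus ?thesis by simp
  qed
  have v: "vderiv (\<lambda>x. complex_of_real x * f x) = (\<lambda>x. complex_of_real x * vderiv f x + f x)" by (intro vderivI d)
  have "bounded (range (\<lambda>x. x ^ Suc n *\<^sub>R f x))" for n using times_x by blast
  hence "\<forall>n. bounded (range (\<lambda>x. x ^ n *\<^sub>R (complex_of_real x * f x)))"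
    by (simp add: scaleR_conv_of_real mult_ac)
  thus ?case unfolding v using d times_x by (auto intro: schwartz_closure.intros)
next
  case (times_japanese f a)
  have d: "((\<lambda>x. japanese a x * f x) has_vector_derivative (japanese a x * vderiv f x + (complex_of_real (2 * a) * (complex_of_real x * (japanese (a - 1) x * f x))))) (at x)" for x
  proof -
    have "((\<lambda>x. japanese a x * f x) has_vector_derivative (japanese a x * vderiv f x + complex_of_real (2 * a) * (complex_of_real x * japanese (a - 1) x) * f x)) (at x)"
      using times_japanese by (intro has_vector_derivative_mult japanese_has_vector_derivative) auto
    thus ?thesis by (simp add: mult.assoc)
  qed
  have v: "vderiv (\<lambda>x. japanese a x * f x) = (\<lambda>x. japanese a x * vderiv f x + (complex_of_real (2 * a) * (complex_of_real x * (japanese (a - 1) x * f x))))"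
    by (intro vderivI d)
  \<comment> \<open>Multiplication by a natural power of 1 + x^2 keeps the decay by induction; a
    real power a is then dominated by a natural power N \<ge> a.\<close>
  have b: "bounded (range (\<lambda>x. (1 + x\<^sup>2) ^ N *\<^sub>R (x ^ n *\<^sub>R f x)))" for n N
  proof (induction N arbitrary: n)
    case 0 thus ?case using times_japanese by simp
  next
    case (Suc N)
    have "bounded (range (\<lambda>x. (1 + x\<^sup>2) ^ N *\<^sub>R (x ^ n *\<^sub>R f x) + (1 + x\<^sup>2) ^ N *\<^sub>R (x ^ (n + 2) *\<^sub>R f x)))"
      by (intro bounded_plus_comp Suc)
    also have "(\<lambda>x. (1 + x\<^sup>2) ^ N *\<^sub>R (x ^ n *\<^sub>R f x) + (1 + x\<^sup>2) ^ N *\<^sub>R (x ^ (n + 2) *\<^sub>R f x)) = (\<lambda>x. (1 + x\<^sup>2) ^ Suc N *\<^sub>R (x ^ n *\<^sub>R f x))"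
      by (simp add: fun_eq_iff algebra_simps power_add power2_eq_square flip: scaleR_add_left)
    finally show ?case .
  qed
  obtain N :: nat where N: "a \<le> real N" using real_arch_simple by blast
  have "bounded (range (\<lambda>x. x ^ n *\<^sub>R (japanese a x * f x)))" for n
  proof -
    obtain B where B: "\<And>x. norm ((1 + x\<^sup>2) ^ N *\<^sub>R (x ^ n *\<^sub>R f x)) \<le> B" using b[of N n] by (auto simp: bounded_iff)
    have "norm (x ^ n *\<^sub>R (japanese a x * f x)) \<le> B" for x
    proof -
      have "norm (japanese a x) \<le> (1 + x\<^sup>2) ^ N"
        using powr_mono[OF N, of "1 + x\<^sup>2"] by (simp add: powr_realpow)
      hence "norm (japanese a x) * norm (x ^ n *\<^sub>R f x) \<le> (1 + x\<^sup>2) ^ N * norm (x ^ n *\<^sub>R f x)"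
        by (intro mult_right_mono) auto
      also have "\<dots> = norm ((1 + x\<^sup>2) ^ N *\<^sub>R (x ^ n *\<^sub>R f x))" by (simp add: abs_mult)
      also have "\<dots> \<le> B" by (rule B)
      finally show ?thesis by (simp add: norm_mult mult_ac)
    qed
    thus ?thesis by (intro boundedI[where B = B]) auto
  qed
  moreover have "(\<lambda>x. japanese a x * vderiv f x + (complex_of_real (2 * a) * (complex_of_real x * (japanese (a - 1) x * f x)))) \<in> schwartz_closure"
    by (intro schwartz_closure.add schwartz_closure.scale schwartz_closure.times_x schwartz_closure.times_japanese) (use times_japanese in auto)
  ultimately show ?case unfolding v using d by blast
next
  case (times_cis f t)
  have d: "((\<lambda>x. cis (t * x) * f x) has_vector_derivative (cis (t * x) * vderiv f x + (\<i> * complex_of_real t) * (cis (t * x) * f x))) (at x)" for x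
  proof -
    have "((\<lambda>x. cis (t * x) * f x) has_vector_derivative (cis (t * x) * vderiv f x + \<i> * complex_of_real t * cis (t * x) * f x)) (at x)"
      using times_cis by (intro has_vector_derivative_mult cis_has_vector_derivative) auto
    thus ?thesis by (simp add: mult.assoc)
  qed
  have v: "vderiv (\<lambda>x. cis (t * x) * f x) = (\<lambda>x. cis (t * x) * vderiv f x + (\<i> * complex_of_real t) * (cis (t * x) * f x))"
    by (intro vderivI d)
  have "\<forall>n. bounded (range (\<lambda>x. x ^ n *\<^sub>R (cis (t * x) * f x)))"
    using times_cis by (simp add: bounded_iff norm_mult)
  moreover have "(\<lambda>x. cis (t * x) * vderiv f x + (\<i> * complex_of_real t) * (cis (t * x) * f x)) \<in> schwartz_closure"
    by (intro schwartz_closure.add schwartz_closure.scale schwartz_closure.times_cis) (use times_cis in auto)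
  ultimately show ?case unfolding v using d by blast
qed

lemma schwartz_closure_eq: "schwartz_closure = schwartz"
proof (intro equalityI subsetI)
  fix f assume "f \<in> schwartz_closure"
  thus "f \<in> schwartz"
  proof (rule schwartz_coinduct)
    fix f assume "f \<in> schwartz_closure"
    from schwartz_closure_step[OF this]
    show "(\<forall>x. f differentiable at x) \<and> vderiv f \<in> schwartz_closure \<and> (\<forall>n. bounded (range (\<lambda>x. x ^ n *\<^sub>R f x)))"
      by (auto intro: differentiableI_vector)
  qed
qed (rule schwartz_closure.base)

lemmas schwartz_intros = schwartz_closure.intros(2-)[unfolded schwartz_closure_eq]

lemma integrable_1_div_1_plus_square: "integrable lborel (\<lambda>x::real. 1 / (1 + x\<^sup>2))"
  using integrable_inverse_1_plus_square
  by (simp add: set_integrable_def inverse_eq_divide)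

lemma schwartz_isCont: "f \<in> schwartz \<Longrightarrow> isCont f x"
  using schwartz_has_vector_derivative has_vector_derivative_continuous by blast

lemma schwartz_measurable [measurable_dest]: "f \<in> schwartz \<Longrightarrow> f \<in> borel_measurable borel"
  by (intro borel_measurable_continuous_onI continuous_at_imp_continuous_on) (auto intro: schwartz_isCont)

lemma schwartz_bound:
  assumes "f \<in> schwartz"
  obtains B where "B \<ge> 0" "\<And>x. norm (f x) \<le> B / (1 + x\<^sup>2)"
proof -
  obtain B where B: "\<And>x. norm (x ^ 0 *\<^sub>R (japanese 1 x * f x)) \<le> B"
    using schwartz_bounded[OF schwartz_intros(5)[OF assms, of 1], of 0] by (auto simp: bounded_iff)
  have "norm (f x) * (1 + x\<^sup>2) \<le> B" for x
    using B[of x] by (simp add: norm_mult mult.commute)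
  hence *: "norm (f x) \<le> B / (1 + x\<^sup>2)" for x by (simp add: field_simps)
  moreover have "B \<ge> 0" using B[of 0] norm_ge_zero order_trans by blast
  ultimately show thesis using that by blast
qed

lemma schwartz_integrable:
  assumes "f \<in> schwartz" shows "integrable lborel f"
proof -
  from assms have [measurable]: "f \<in> borel_measurable borel" by (rule schwartz_measurable)
  obtain B where B: "B \<ge> 0" "\<And>x. norm (f x) \<le> B / (1 + x\<^sup>2)" using schwartz_bound[OF assms] by blast
  show ?thesis
  proof (rule Bochner_Integration.integrable_bound)
    show "integrable lborel (\<lambda>x. B * (1 / (1 + x\<^sup>2)))" using integrable_1_div_1_plus_square by (rule integrable_mult_right)
  qed (use B in auto)
qed

lemma schwartz_tendsto_zero:
  assumes "f \<in> schwartz"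
  shows "(f \<longlongrightarrow> 0) at_top" "(f \<longlongrightarrow> 0) at_bot"
proof -
  obtain B where B: "B \<ge> 0" "\<And>x. norm (f x) \<le> B / (1 + x\<^sup>2)" using schwartz_bound[OF assms] by blast
  have "((\<lambda>x::real. 1 / (1 + x\<^sup>2)) \<longlongrightarrow> 0) at_top" "((\<lambda>x::real. 1 / (1 + x\<^sup>2)) \<longlongrightarrow> 0) at_bot"
    by real_asymp+
  from this[THEN tendsto_mult_right_zero[where c = B]]
  have t: "((\<lambda>x. B / (1 + x\<^sup>2)) \<longlongrightarrow> 0) at_top" "((\<lambda>x. B / (1 + x\<^sup>2)) \<longlongrightarrow> 0) at_bot" by auto
  show "(f \<longlongrightarrow> 0) at_top" by (rule Lim_null_comparison[OF always_eventually t(1)]) (use B in blast)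
  show "(f \<longlongrightarrow> 0) at_bot" by (rule Lim_null_comparison[OF always_eventually t(2)]) (use B in blast)
qed

lemma schwartz_integral_vderiv:
  assumes f: "f \<in> schwartz" shows "(LINT x|lborel. vderiv f x) = 0"
proof -
  have "(LBINT x=-\<infinity>..\<infinity>. vderiv f x) = 0 - 0"
  proof (rule interval_integral_FTC_integrable)
    show "(f has_vector_derivative vderiv f x) (at x)" for x by (rule schwartz_has_vector_derivative[OF f])
    show "isCont (vderiv f) x" for x by (intro schwartz_isCont schwartz_vderiv f)
    show "set_integrable lborel (einterval (-\<infinity>) \<infinity>) (vderiv f)"
      using schwartz_integrable[OF schwartz_vderiv[OF f]] by (simp add: set_integrable_def)
    show "((f \<circ> real_of_ereal) \<longlongrightarrow> 0) (at_right (- \<infinity>))" "((f \<circ> real_of_ereal) \<longlongrightarrow> 0) (at_left \<infinity>)"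
      using schwartz_tendsto_zero[OF f] by (simp_all add: ereal_tendsto_simps)
  qed auto
  thus ?thesis by (simp add: interval_integral_to_infinity_eq interval_lebesgue_integral_def set_lebesgue_integral_def)
qed

section \<open>The Fourier transform\<close>

text \<open>The sign c = -1 gives \<open>fourier\<close>, and c = 1 gives \<open>inv_fourier\<close>
  up to the factor 1 / (2 pi); each fact is thus proved once for both transforms.\<close>

definition FT :: "real \<Rightarrow> (real \<Rightarrow> complex) \<Rightarrow> real \<Rightarrow> complex" where
  "FT c \<phi> \<xi> = (LINT x|lborel. cis (c * x * \<xi>) * \<phi> x)"

lemma fourier_eq_FT: "fourier \<phi> = FT (-1) \<phi>"
  by (simp add: fun_eq_iff fourier_def FT_def)

lemma inv_fourier_eq_FT: "inv_fourier \<phi> x = complex_of_real (1 / (2 * pi)) * FT 1 \<phi> x"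
  by (simp add: inv_fourier_def FT_def mult.commute[of x])

lemma measurable_cis [measurable]: "cis \<in> borel_measurable borel"
  unfolding cis_conv_exp by measurable

lemma norm_cis_diff_le: "norm (cis a - cis b) \<le> \<bar>a - b\<bar>"
proof -
  have "iexp (a - b) = cis (a - b)" by (simp add: cis_conv_exp)
  hence "cis a - cis b = cis b * (iexp (a - b) - 1)" by (simp add: right_diff_distrib cis_mult)
  hence "norm (cis a - cis b) = norm (iexp (a - b) - 1)" by (simp add: norm_mult)
  also have "\<dots> \<le> \<bar>a - b\<bar>" using iexp_approx1[of "a - b" 0] by simp
  finally show ?thesis .
qed

lemma integrable_cis_mult:
  fixes f :: "real \<Rightarrow> complex"
  assumes f: "integrable lborel f" and h[measurable]: "h \<in> borel_measurable borel"
  shows "integrable lborel (\<lambda>x. cis (h x) * f x)"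
proof -
  have [measurable]: "f \<in> borel_measurable borel" using f by auto
  show ?thesis by (rule Bochner_Integration.integrable_bound[OF f]) (auto simp: norm_mult)
qed

lemma FT_measurable [measurable]:
  assumes [measurable]: "f \<in> borel_measurable borel"
  shows "FT c f \<in> borel_measurable borel"
  unfolding FT_def[abs_def] by measurable

lemma norm_FT_le:
  assumes f: "integrable lborel f"
  shows "norm (FT c f \<xi>) \<le> (LINT x|lborel. norm (f x))"
  unfolding FT_def by (rule norm_integral_le_integral) (use f integrable_cis_mult[OF f, of "\<lambda>x. c * x * \<xi>"] in \<open>simp_all add: norm_mult\<close>)

text \<open>Difference quotients can be tested along sequences, so that differentiation under the
  integral becomes an application of dominated convergence.\<close>

lemma has_vector_derivative_at_iff_quotient:
  fixes f :: "real \<Rightarrow> 'a :: real_normed_vector"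
  shows "(f has_vector_derivative D) (at x) \<longleftrightarrow> ((\<lambda>h. (f (x + h) - f x) /\<^sub>R h) \<longlongrightarrow> D) (at 0)"
proof -
  have eq: "norm (f (x + h) - f x - h *\<^sub>R D) / norm h = norm ((f (x + h) - f x) /\<^sub>R h - D)" if "h \<noteq> 0" for h
  proof -
    have "f (x + h) - f x - h *\<^sub>R D = h *\<^sub>R ((f (x + h) - f x) /\<^sub>R h - D)"
      using that by (simp add: scaleR_diff_right)
    thus ?thesis using that by simp
  qed
  have "(f has_vector_derivative D) (at x) \<longleftrightarrow> ((\<lambda>h. norm (f (x + h) - f x - h *\<^sub>R D) / norm h) \<longlongrightarrow> 0) (at 0)"
    unfolding has_vector_derivative_def has_derivative_at by (simp add: bounded_linear_scaleR_left)
  also have "\<dots> \<longleftrightarrow> ((\<lambda>h. norm ((f (x + h) - f x) /\<^sub>R h - D)) \<longlongrightarrow> 0) (at 0)"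
    by (rule tendsto_cong) (use eq in \<open>auto simp: eventually_at_filter\<close>)
  also have "\<dots> \<longleftrightarrow> ((\<lambda>h. (f (x + h) - f x) /\<^sub>R h) \<longlongrightarrow> D) (at 0)"
    by (simp add: tendsto_norm_zero_iff LIM_zero_iff)
  finally show ?thesis .
qed

text \<open>The difference quotients of \<open>cis\<close> in the frequency variable are at most |c
  x|, so |c| |x f(x)| dominates; it is integrable because x f is again a Schwartz function.\<close>

lemma FT_has_vector_derivative:
  assumes f: "f \<in> schwartz"
  shows "(FT c f has_vector_derivative FT c (\<lambda>x. \<i> * complex_of_real c * (complex_of_real x * f x)) \<xi>) (at \<xi>)"
proof -
  let ?g = "\<lambda>x. \<i> * complex_of_real c * (complex_of_real x * f x)"
  have fi: "integrable lborel f" by (rule schwartz_integrable[OF f])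
  have xf: "(\<lambda>x. complex_of_real x * f x) \<in> schwartz" by (intro schwartz_intros f)
  have [measurable]: "f \<in> borel_measurable borel" using f by (rule schwartz_measurable)
  have lim: "((\<lambda>h. (FT c f (\<xi> + h) - FT c f \<xi>) /\<^sub>R h) \<longlongrightarrow> FT c ?g \<xi>) (at 0)"
    unfolding tendsto_at_iff_sequentially comp_def
  proof (intro allI impI)
    fix h :: "nat \<Rightarrow> real" assume h: "\<forall>i. h i \<in> UNIV - {0}" "h \<longlonglongrightarrow> 0"
    have h0: "h i \<noteq> 0" for i using h by auto
    define s where "s = (\<lambda>i x. ((cis (c * x * (\<xi> + h i)) - cis (c * x * \<xi>)) /\<^sub>R h i) * f x)"
    have "(\<lambda>i. LINT x|lborel. s i x) \<longlonglongrightarrow> (LINT x|lborel. cis (c * x * \<xi>) * ?g x)"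
    proof (rule integral_dominated_convergence[where w = "\<lambda>x. \<bar>c\<bar> * norm (complex_of_real x * f x)"])
      show "integrable lborel (\<lambda>x. \<bar>c\<bar> * norm (complex_of_real x * f x))"
        using schwartz_integrable[OF xf] by (intro integrable_mult_right integrable_norm)
      show "AE x in lborel. (\<lambda>i. s i x) \<longlonglongrightarrow> cis (c * x * \<xi>) * ?g x"
      proof (intro AE_I2)
        fix x
        have "((\<lambda>y. cis (c * x * y)) has_vector_derivative (\<i> * complex_of_real (c * x) * cis (c * x * \<xi>))) (at \<xi>)"
          by (rule cis_has_vector_derivative)
        hence "((\<lambda>h. (cis (c * x * (\<xi> + h)) - cis (c * x * \<xi>)) /\<^sub>R h) \<longlongrightarrow> \<i> * complex_of_real (c * x) * cis (c * x * \<xi>)) (at 0)"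
          unfolding has_vector_derivative_at_iff_quotient .
        hence "(\<lambda>i. (cis (c * x * (\<xi> + h i)) - cis (c * x * \<xi>)) /\<^sub>R h i) \<longlonglongrightarrow> \<i> * complex_of_real (c * x) * cis (c * x * \<xi>)"
          using h unfolding tendsto_at_iff_sequentially comp_def by blast
        hence "(\<lambda>i. s i x) \<longlonglongrightarrow> \<i> * complex_of_real (c * x) * cis (c * x * \<xi>) * f x"
          unfolding s_def by (intro tendsto_mult tendsto_const)
        thus "(\<lambda>i. s i x) \<longlonglongrightarrow> cis (c * x * \<xi>) * ?g x" by (simp add: mult_ac)
      qed
      show "AE x in lborel. norm (s i x) \<le> \<bar>c\<bar> * norm (complex_of_real x * f x)" for i
      proof (intro AE_I2)
        fix x
        have "norm ((cis (c * x * (\<xi> + h i)) - cis (c * x * \<xi>)) /\<^sub>R h i) \<le> \<bar>c * x * (\<xi> + h i) - c * x * \<xi>\<bar> / \<bar>h i\<bar>"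
          using norm_cis_diff_le h0[of i] by (simp add: divide_inverse mult.commute mult_left_mono)
        also have "c * x * (\<xi> + h i) - c * x * \<xi> = c * x * h i" by (simp add: algebra_simps)
        finally have "norm ((cis (c * x * (\<xi> + h i)) - cis (c * x * \<xi>)) /\<^sub>R h i) \<le> \<bar>c\<bar> * \<bar>x\<bar>"
          using h0[of i] by (simp add: abs_mult)
        hence "norm ((cis (c * x * (\<xi> + h i)) - cis (c * x * \<xi>)) /\<^sub>R h i) * norm (f x) \<le> \<bar>c\<bar> * \<bar>x\<bar> * norm (f x)"
          by (intro mult_right_mono) auto
        thus "norm (s i x) \<le> \<bar>c\<bar> * norm (complex_of_real x * f x)" by (simp add: s_def norm_mult mult_ac)
      qed
    qed (auto simp: s_def)
    moreover have "(LINT x|lborel. s i x) = (FT c f (\<xi> + h i) - FT c f \<xi>) /\<^sub>R h i" for i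
    proof -
      have "(LINT x|lborel. s i x) = (LINT x|lborel. (cis (c * x * (\<xi> + h i)) * f x - cis (c * x * \<xi>) * f x) /\<^sub>R h i)"
        unfolding s_def by (simp add: algebra_simps)
      also have "\<dots> = ((LINT x|lborel. cis (c * x * (\<xi> + h i)) * f x) - (LINT x|lborel. cis (c * x * \<xi>) * f x)) /\<^sub>R h i"
        by (simp only: integral_scaleR_right Bochner_Integration.integral_diff integrable_cis_mult[OF fi])
           (simp add: Bochner_Integration.integral_diff integrable_cis_mult[OF fi])
      finally show ?thesis by (simp add: FT_def)
    qed
    ultimately show "(\<lambda>i. (FT c f (\<xi> + h i) - FT c f \<xi>) /\<^sub>R h i) \<longlonglongrightarrow> FT c ?g \<xi>"
      by (simp add: FT_def)
  qed
  thus ?thesis unfolding has_vector_derivative_at_iff_quotient .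
qed

text \<open>Integration by parts in the form that the derivative of the Schwartz function cis(c
  \<xi> x) f(x) has integral 0.\<close>

lemma FT_vderiv:
  assumes f: "f \<in> schwartz"
  shows "FT c (vderiv f) \<xi> = - (\<i> * complex_of_real (c * \<xi>)) * FT c f \<xi>"
proof -
  define g where "g = (\<lambda>x. cis ((c * \<xi>) * x) * f x)"
  have g: "g \<in> schwartz" unfolding g_def by (intro schwartz_intros f)
  have d: "(g has_vector_derivative (cis (c * \<xi> * x) * vderiv f x + \<i> * complex_of_real (c * \<xi>) * cis (c * \<xi> * x) * f x)) (at x)" for x
    unfolding g_def by (intro has_vector_derivative_mult cis_has_vector_derivative schwartz_has_vector_derivative f)
  have i1: "integrable lborel (\<lambda>x. cis (c * \<xi> * x) * vderiv f x)"
    by (intro integrable_cis_mult schwartz_integrable schwartz_vderiv f) auto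
  have i2: "integrable lborel (\<lambda>x. \<i> * complex_of_real (c * \<xi>) * (cis (c * \<xi> * x) * f x))"
    by (intro integrable_mult_right integrable_cis_mult schwartz_integrable f) auto
  have "0 = (LINT x|lborel. vderiv g x)" using schwartz_integral_vderiv[OF g] by simp
  also have "vderiv g = (\<lambda>x. cis (c * \<xi> * x) * vderiv f x + \<i> * complex_of_real (c * \<xi>) * (cis (c * \<xi> * x) * f x))"
    using vderivI[OF d] by (simp add: mult.assoc)
  also have "(LINT x|lborel. cis (c * \<xi> * x) * vderiv f x + \<i> * complex_of_real (c * \<xi>) * (cis (c * \<xi> * x) * f x))
     = (LINT x|lborel. cis (c * \<xi> * x) * vderiv f x) + (LINT x|lborel. \<i> * complex_of_real (c * \<xi>) * (cis (c * \<xi> * x) * f x))"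
    by (rule Bochner_Integration.integral_add[OF i1 i2])
  also have "\<dots> = FT c (vderiv f) \<xi> + \<i> * complex_of_real (c * \<xi>) * FT c f \<xi>"
    unfolding FT_def integral_mult_right_zero by (simp add: mult_ac)
  finally have "\<i> * complex_of_real (c * \<xi>) * FT c f \<xi> + FT c (vderiv f) \<xi> = 0" by (simp only: add.commute)
  from minus_unique[OF this, symmetric] show ?thesis by (simp only: minus_mult_left)
qed

text \<open>The set of all transforms of Schwartz functions is stable under derivatives, because a
  derivative falls on f as a factor x. Decay is traded for smoothness: each factor \<xi> costs one
  derivative of f, whence the induction over all Schwartz functions simultaneously.\<close>

lemma schwartz_FT:
  assumes f: "f \<in> schwartz" and c: "c \<noteq> 0"
  shows "FT c f \<in> schwartz"
proof (rule schwartz_coinduct[where X = "FT c ` schwartz"])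
  fix F assume "F \<in> FT c ` schwartz"
  then obtain f where f: "f \<in> schwartz" "F = FT c f" by auto
  have d: "vderiv F = FT c (\<lambda>x. \<i> * complex_of_real c * (complex_of_real x * f x))"
    unfolding f(2) by (intro vderivI FT_has_vector_derivative f)
  have "\<exists>B. \<forall>\<xi>. norm (\<xi> ^ n *\<^sub>R FT c f \<xi>) \<le> B" if "f \<in> schwartz" for n f
    using that
  proof (induction n arbitrary: f)
    case 0
    thus ?case using norm_FT_le[OF schwartz_integrable] by auto
  next
    case (Suc n)
    then obtain B where B: "\<And>\<xi>. norm (\<xi> ^ n *\<^sub>R FT c (vderiv f) \<xi>) \<le> B" using schwartz_vderiv by blast
    have "norm (\<xi> ^ Suc n *\<^sub>R FT c f \<xi>) \<le> B / \<bar>c\<bar>" for \<xi>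
      using B[of \<xi>] c by (simp add: FT_vderiv[OF Suc.prems] norm_mult abs_mult field_simps)
    thus ?case by blast
  qed
  from this[OF f(1)] have "\<forall>n. bounded (range (\<lambda>x. x ^ n *\<^sub>R F x))" unfolding f(2) bounded_iff by blast
  moreover have "\<forall>x. F differentiable at x"
    unfolding f(2) using FT_has_vector_derivative[OF f(1)] differentiableI_vector by blast
  moreover have "vderiv F \<in> FT c ` schwartz"
    unfolding d by (intro imageI schwartz_intros f)
  ultimately show "(\<forall>x. F differentiable at x) \<and> vderiv F \<in> FT c ` schwartz \<and> (\<forall>n. bounded (range (\<lambda>x. x ^ n *\<^sub>R F x)))"
    by blast
qed (use f in auto)

lemma schwartz_fourier: "f \<in> schwartz \<Longrightarrow> fourier f \<in> schwartz"
  unfolding fourier_eq_FT by (rule schwartz_FT) auto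

lemma schwartz_inv_fourier: "f \<in> schwartz \<Longrightarrow> inv_fourier f \<in> schwartz"
  unfolding inv_fourier_eq_FT[abs_def] by (intro schwartz_intros schwartz_FT) auto

section \<open>Gaussian regularisation, inversion and the Plancherel bound\<close>

lemma integrable_gaussian:
  assumes "\<epsilon> > 0" shows "integrable lborel (\<lambda>x::real. exp (- (\<epsilon> * x)\<^sup>2 / 2))"
proof -
  have "integrable lborel (\<lambda>x::real. exp (- x\<^sup>2))"
    using integrable_norm[OF schwartz_integrable[OF schwartz_intros(1)]] by simp
  from lborel_integrable_real_affine[OF this, of "\<epsilon> / sqrt 2" 0] show ?thesis
    using assms by (simp add: power_divide power_mult_distrib)
qed

text \<open>The characteristic function of the standard normal distribution, rescaled by \<epsilon>.
  Both the inversion formula and the Plancherel bound rest on it.\<close>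

lemma gaussian_fourier_integral:
  assumes "\<epsilon> > 0"
  shows "(LINT \<xi>|lborel. complex_of_real (exp (- (\<epsilon> * \<xi>)\<^sup>2 / 2)) * cis (u * \<xi>)) =
    complex_of_real (sqrt (2 * pi) / \<epsilon> * exp (- (u / \<epsilon>)\<^sup>2 / 2))"
proof -
  have "complex_of_real (exp (- (u / \<epsilon>)\<^sup>2 / 2)) = (LINT x|std_normal_distribution. iexp ((u / \<epsilon>) * x))"
    using fun_cong[OF char_std_normal_distribution, of "u / \<epsilon>", symmetric] by (simp only: char_def)
  also have "\<dots> = (LINT x|lborel. std_normal_density x *\<^sub>R iexp ((u / \<epsilon>) * x))"
    by (rule integral_density) auto
  also have "\<dots> = (LINT x|lborel. complex_of_real (1 / sqrt (2 * pi)) * (complex_of_real (exp (- x\<^sup>2 / 2)) * cis ((u / \<epsilon>) * x)))"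
    by (intro Bochner_Integration.integral_cong) (auto simp: std_normal_density_def cis_conv_exp scaleR_conv_of_real mult.assoc)
  also have "\<dots> = complex_of_real (1 / sqrt (2 * pi)) * (LINT x|lborel. complex_of_real (exp (- x\<^sup>2 / 2)) * cis ((u / \<epsilon>) * x))"
    by (rule integral_mult_right_zero)
  finally have *: "(LINT x|lborel. complex_of_real (exp (- x\<^sup>2 / 2)) * cis ((u / \<epsilon>) * x)) = complex_of_real (sqrt (2 * pi) * exp (- (u / \<epsilon>)\<^sup>2 / 2))"
    by (simp add: field_simps)
  have "(LINT \<xi>|lborel. complex_of_real (exp (- (\<epsilon> * \<xi>)\<^sup>2 / 2)) * cis (u * \<xi>)) =
     \<bar>1 / \<epsilon>\<bar> *\<^sub>R (LINT x|lborel. complex_of_real (exp (- (\<epsilon> * (0 + 1 / \<epsilon> * x))\<^sup>2 / 2)) * cis (u * (0 + 1 / \<epsilon> * x)))"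
    by (rule lborel_integral_real_affine) (use assms in auto)
  also have "\<dots> = \<bar>1 / \<epsilon>\<bar> *\<^sub>R (LINT x|lborel. complex_of_real (exp (- x\<^sup>2 / 2)) * cis ((u / \<epsilon>) * x))"
    using assms by simp
  finally show ?thesis unfolding * using assms by (simp add: scaleR_conv_of_real)
qed

lemma integral_gaussian:
  assumes "\<epsilon> > 0"
  shows "(LINT x|lborel. exp (- (\<epsilon> * x)\<^sup>2 / 2)) = sqrt (2 * pi) / \<epsilon>"
proof -
  have "complex_of_real (LINT x|lborel. exp (- (\<epsilon> * x)\<^sup>2 / 2)) = complex_of_real (sqrt (2 * pi) / \<epsilon>)"
    using gaussian_fourier_integral[OF assms, of 0] by (simp flip: integral_complex_of_real)
  thus ?thesis by (simp only: of_real_eq_iff)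
qed

lemma gaussian_tendsto_1: "(\<lambda>n. exp (- (inverse (real (Suc n)) * x)\<^sup>2 / 2)) \<longlonglongrightarrow> 1"
proof -
  have "(\<lambda>n. exp (- (inverse (real (Suc n)) * x)\<^sup>2 / 2)) \<longlonglongrightarrow> exp (- (0 * x)\<^sup>2 / 2)"
    by (intro tendsto_intros LIMSEQ_inverse_real_of_nat) auto
  thus ?thesis by simp
qed

text \<open>The regularised integrals \<open>a n\<close> are evaluated twice. Dominated convergence
  in frequency gives the left-hand side in the limit. Fubini turns them into averages of f around x
  against a Gaussian of width \<epsilon>, which tend to 2 pi f(x); one factor sqrt(2 pi) comes from
  the Gaussian transform, the other from the Gaussian integral. The hypothesis on c makes c a
  sign.\<close>

lemma FT_inversion:
  assumes f: "f \<in> schwartz" and c: "c * c = 1"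
  shows "FT (- c) (FT c f) x = complex_of_real (2 * pi) * f x"
proof -
  have c0: "c \<noteq> 0" using c by auto
  have fi: "integrable lborel f" by (rule schwartz_integrable[OF f])
  have [measurable]: "f \<in> borel_measurable borel" using f by (rule schwartz_measurable)
  have Fi: "integrable lborel (FT c f)" by (intro schwartz_integrable schwartz_FT f c0)
  define \<epsilon> where "\<epsilon> = (\<lambda>n. inverse (real (Suc n)))"
  have \<epsilon>: "\<epsilon> n > 0" for n by (simp add: \<epsilon>_def)
  define e where "e = (\<lambda>n \<xi>. exp (- (\<epsilon> n * \<xi>)\<^sup>2 / 2))"
  have e1: "0 \<le> e n \<xi>" "e n \<xi> \<le> 1" for n \<xi> by (auto simp: e_def)
  have [measurable]: "e n \<in> borel_measurable borel" for n unfolding e_def by measurable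
  have e_lim: "(\<lambda>n. e n \<xi>) \<longlonglongrightarrow> 1" for \<xi> unfolding e_def \<epsilon>_def by (rule gaussian_tendsto_1)
  define a where "a = (\<lambda>n. LINT \<xi>|lborel. complex_of_real (e n \<xi>) * (cis (- c * \<xi> * x) * FT c f \<xi>))"
  have A: "a \<longlonglongrightarrow> FT (- c) (FT c f) x"
    unfolding a_def FT_def[of "- c"]
  proof (rule integral_dominated_convergence[where w = "\<lambda>\<xi>. norm (FT c f \<xi>)"])
    show "AE \<xi> in lborel. (\<lambda>n. complex_of_real (e n \<xi>) * (cis (- c * \<xi> * x) * FT c f \<xi>)) \<longlonglongrightarrow> cis (- c * \<xi> * x) * FT c f \<xi>"
    proof (rule AE_I2)
      fix \<xi>
      have "(\<lambda>n. complex_of_real (e n \<xi>) * (cis (- c * \<xi> * x) * FT c f \<xi>)) \<longlonglongrightarrow> complex_of_real 1 * (cis (- c * \<xi> * x) * FT c f \<xi>)"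
        by (intro tendsto_intros e_lim)
      thus "(\<lambda>n. complex_of_real (e n \<xi>) * (cis (- c * \<xi> * x) * FT c f \<xi>)) \<longlonglongrightarrow> cis (- c * \<xi> * x) * FT c f \<xi>" by simp
    qed
    show "AE \<xi> in lborel. norm (complex_of_real (e n \<xi>) * (cis (- c * \<xi> * x) * FT c f \<xi>)) \<le> norm (FT c f \<xi>)" for n
      using e1 by (auto simp: norm_mult mult_left_le_one_le)
  qed (use Fi in auto)
  \<comment> \<open>Fubini followed by the substitution y = x + \<epsilon> z, after which \<epsilon>
    remains only in the argument of f and dominated convergence applies.\<close>
  have a_eq: "a n = (LINT z|lborel. complex_of_real (sqrt (2 * pi) * exp (- z\<^sup>2 / 2)) * f (x + \<epsilon> n * z))" for n
  proof -
    let ?h = "\<lambda>y \<xi>. complex_of_real (e n \<xi>) * (cis (- c * \<xi> * x) * (cis (c * y * \<xi>) * f y))"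
    have i: "integrable (lborel \<Otimes>\<^sub>M lborel) (\<lambda>(y, \<xi>). ?h y \<xi>)"
    proof (rule Bochner_Integration.integrable_bound)
      show "integrable (lborel \<Otimes>\<^sub>M lborel) (\<lambda>z. norm (f (fst z)) * e n (snd z))"
        by (rule lborel_pair.integrable_product_real) (use fi integrable_gaussian[OF \<epsilon>] in \<open>auto simp: e_def\<close>)
    qed (use e1 in \<open>auto simp: norm_mult split_beta'\<close>)
    have "a n = (LINT \<xi>|lborel. LINT y|lborel. ?h y \<xi>)"
      unfolding a_def FT_def by simp
    also have "\<dots> = (LINT y|lborel. LINT \<xi>|lborel. ?h y \<xi>)"
      by (rule lborel_pair.Fubini_integral[OF i])
    also have "\<dots> = (LINT y|lborel. f y * (LINT \<xi>|lborel. complex_of_real (e n \<xi>) * cis ((c * (y - x)) * \<xi>)))"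
    proof (intro Bochner_Integration.integral_cong refl)
      fix y
      have "?h y \<xi> = f y * (complex_of_real (e n \<xi>) * cis ((c * (y - x)) * \<xi>))" for \<xi>
      proof -
        have "cis (- c * \<xi> * x) * cis (c * y * \<xi>) = cis ((c * (y - x)) * \<xi>)"
          unfolding cis_mult by (simp add: algebra_simps)
        thus ?thesis by (simp add: mult_ac)
      qed
      thus "(LINT \<xi>|lborel. ?h y \<xi>) = f y * (LINT \<xi>|lborel. complex_of_real (e n \<xi>) * cis ((c * (y - x)) * \<xi>))"
        by (simp only: integral_mult_right_zero)
    qed
    also have "\<dots> = (LINT y|lborel. f y * complex_of_real (sqrt (2 * pi) / \<epsilon> n * exp (- ((y - x) / \<epsilon> n)\<^sup>2 / 2)))"
    proof -
      have "(c * (y - x) / \<epsilon> n)\<^sup>2 = ((y - x) / \<epsilon> n)\<^sup>2" for y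
        using c by (simp add: power_divide power_mult_distrib power2_eq_square[of c])
      thus ?thesis unfolding e_def gaussian_fourier_integral[OF \<epsilon>] by simp
    qed
    also have "\<dots> = \<bar>\<epsilon> n\<bar> *\<^sub>R (LINT z|lborel. f (x + \<epsilon> n * z) * complex_of_real (sqrt (2 * pi) / \<epsilon> n * exp (- ((x + \<epsilon> n * z - x) / \<epsilon> n)\<^sup>2 / 2)))"
      by (rule lborel_integral_real_affine) (use \<epsilon>[of n] in auto)
    also have "\<dots> = (LINT z|lborel. \<bar>\<epsilon> n\<bar> *\<^sub>R (f (x + \<epsilon> n * z) * complex_of_real (sqrt (2 * pi) / \<epsilon> n * exp (- ((x + \<epsilon> n * z - x) / \<epsilon> n)\<^sup>2 / 2))))"
      by simp
    also have "\<dots> = (LINT z|lborel. complex_of_real (sqrt (2 * pi) * exp (- z\<^sup>2 / 2)) * f (x + \<epsilon> n * z))"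
      using \<epsilon>[of n] by (intro Bochner_Integration.integral_cong) (auto simp: scaleR_conv_of_real)
    finally show ?thesis .
  qed
  have g1: "integrable lborel (\<lambda>z::real. exp (- z\<^sup>2 / 2))" using integrable_gaussian[of 1] by simp
  obtain B where B: "\<And>x. norm (f x) \<le> B"
    using schwartz_bounded[OF f, of 0] by (auto simp: bounded_iff)
  have "a \<longlonglongrightarrow> (LINT z|lborel. complex_of_real (sqrt (2 * pi) * exp (- z\<^sup>2 / 2)) * f x)"
    unfolding a_eq[abs_def]
  proof (rule integral_dominated_convergence[where w = "\<lambda>z. sqrt (2 * pi) * B * exp (- z\<^sup>2 / 2)"])
    show "integrable lborel (\<lambda>z. sqrt (2 * pi) * B * exp (- z\<^sup>2 / 2))" by (intro integrable_mult_right g1)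
    show "AE z in lborel. (\<lambda>n. complex_of_real (sqrt (2 * pi) * exp (- z\<^sup>2 / 2)) * f (x + \<epsilon> n * z)) \<longlonglongrightarrow> complex_of_real (sqrt (2 * pi) * exp (- z\<^sup>2 / 2)) * f x"
    proof (rule AE_I2)
      fix z
      have "(\<lambda>n. x + \<epsilon> n * z) \<longlonglongrightarrow> x + 0 * z"
        unfolding \<epsilon>_def by (intro tendsto_intros LIMSEQ_inverse_real_of_nat)
      hence "(\<lambda>n. f (x + \<epsilon> n * z)) \<longlonglongrightarrow> f x"
        using isCont_tendsto_compose[OF schwartz_isCont[OF f, of x]] by simp
      thus "(\<lambda>n. complex_of_real (sqrt (2 * pi) * exp (- z\<^sup>2 / 2)) * f (x + \<epsilon> n * z)) \<longlonglongrightarrow> complex_of_real (sqrt (2 * pi) * exp (- z\<^sup>2 / 2)) * f x"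
        by (intro tendsto_intros)
    qed
    show "AE z in lborel. norm (complex_of_real (sqrt (2 * pi) * exp (- z\<^sup>2 / 2)) * f (x + \<epsilon> n * z)) \<le> sqrt (2 * pi) * B * exp (- z\<^sup>2 / 2)" for n
    proof (rule AE_I2)
      fix z :: real
      have "norm (complex_of_real (sqrt (2 * pi) * exp (- z\<^sup>2 / 2)) * f (x + \<epsilon> n * z)) = sqrt (2 * pi) * exp (- z\<^sup>2 / 2) * norm (f (x + \<epsilon> n * z))"
        unfolding norm_mult norm_of_real by simp
      also have "\<dots> \<le> sqrt (2 * pi) * exp (- z\<^sup>2 / 2) * B" by (intro mult_left_mono B) auto
      finally show "norm (complex_of_real (sqrt (2 * pi) * exp (- z\<^sup>2 / 2)) * f (x + \<epsilon> n * z)) \<le> sqrt (2 * pi) * B * exp (- z\<^sup>2 / 2)"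
        by (simp only: mult_ac)
    qed
  qed auto
  also have "(LINT z|lborel. complex_of_real (sqrt (2 * pi) * exp (- z\<^sup>2 / 2)) * f x) = complex_of_real (2 * pi) * f x"
  proof -
    have "(LINT z|lborel. complex_of_real (sqrt (2 * pi) * exp (- z\<^sup>2 / 2)) * f x) = complex_of_real (LINT z|lborel. sqrt (2 * pi) * exp (- z\<^sup>2 / 2)) * f x"
      unfolding integral_mult_left_zero integral_complex_of_real ..
    also have "(LINT z|lborel. sqrt (2 * pi) * exp (- z\<^sup>2 / 2)) = 2 * pi"
      using integral_gaussian[of 1] by simp
    finally show ?thesis .
  qed
  finally show ?thesis using A LIMSEQ_unique by blast
qed

lemma inv_fourier_fourier: "f \<in> schwartz \<Longrightarrow> inv_fourier (fourier f) = f"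
  using FT_inversion[of f "-1"] by (simp add: fun_eq_iff inv_fourier_eq_FT fourier_eq_FT)

lemma FT_multiplication_formula:
  assumes f: "integrable lborel f" and g: "integrable lborel g"
  shows "(LINT x|lborel. f x * FT c g x) = (LINT x|lborel. FT c f x * g x)"
proof -
  have [measurable]: "f \<in> borel_measurable borel" "g \<in> borel_measurable borel" using f g by auto
  have i: "integrable (lborel \<Otimes>\<^sub>M lborel) (\<lambda>(x, y). f x * (cis (c * y * x) * g y))"
  proof (rule Bochner_Integration.integrable_bound)
    show "integrable (lborel \<Otimes>\<^sub>M lborel) (\<lambda>z. norm (f (fst z)) * norm (g (snd z)))"
      by (rule lborel_pair.integrable_product_real) (use f g in auto)
  qed (auto simp: norm_mult split_beta')
  have "(LINT x|lborel. f x * FT c g x) = (LINT x|lborel. LINT y|lborel. f x * (cis (c * y * x) * g y))"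
    unfolding FT_def by simp
  also have "\<dots> = (LINT y|lborel. LINT x|lborel. f x * (cis (c * y * x) * g y))"
    by (rule lborel_pair.Fubini_integral[OF i, symmetric])
  also have "\<dots> = (LINT y|lborel. LINT x|lborel. (cis (c * x * y) * f x) * g y)"
    by (simp only: mult_ac)
  also have "\<dots> = (LINT y|lborel. FT c f y * g y)" unfolding FT_def by simp
  finally show ?thesis .
qed

text \<open>The T T* identity again, now with a Gaussian weight in frequency and \<open>g\<close> as
  the function on the physical side. The kernel is a Gaussian in x - y of mass 2 pi for every width,
  so the arithmetic-geometric inequality for |g(x)| |g(y)| bounds the form by 2 pi times the square
  integral of g. An inequality suffices throughout, and the right-hand side may be infinite.\<close>

lemma FT_plancherel_le:
  assumes g: "integrable lborel g" and c: "c * c = 1"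
  shows "(\<integral>\<^sup>+\<xi>. ennreal ((cmod (FT c g \<xi>))\<^sup>2) \<partial>lborel) \<le> ennreal (2 * pi) * (\<integral>\<^sup>+x. ennreal ((cmod (g x))\<^sup>2) \<partial>lborel)"
proof -
  have [measurable]: "g \<in> borel_measurable borel" using g by auto
  define \<epsilon> where "\<epsilon> = (\<lambda>n. inverse (real (Suc n)))"
  have \<epsilon>: "\<epsilon> n > 0" for n by (simp add: \<epsilon>_def)
  define e where "e = (\<lambda>n \<xi>. exp (- (\<epsilon> n * \<xi>)\<^sup>2 / 2))"
  have [measurable]: "e n \<in> borel_measurable borel" for n unfolding e_def by measurable
  have e_lim: "(\<lambda>n. e n \<xi>) \<longlonglongrightarrow> 1" for \<xi> unfolding e_def \<epsilon>_def by (rule gaussian_tendsto_1)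
  define G where "G = (\<integral>\<^sup>+x. ennreal ((cmod (g x))\<^sup>2) \<partial>lborel)"
  define h :: real where "h = 1 / 2"
  have h: "0 \<le> h" "h + h = 1" by (auto simp: h_def)
  have step: "(\<integral>\<^sup>+\<xi>. ennreal (e n \<xi>) * ennreal ((cmod (FT c g \<xi>))\<^sup>2) \<partial>lborel) \<le> ennreal (2 * pi) * G" for n
  proof -
    define N where "N = density lborel (\<lambda>\<xi>. ennreal (e n \<xi>))"
    have [measurable_cong]: "sets N = sets borel" by (simp add: N_def)
    have eN: "(\<integral>\<^sup>+\<xi>. ennreal (e n \<xi>) \<partial>lborel) = ennreal (sqrt (2 * pi) / \<epsilon> n)"
      using nn_integral_eq_integral[OF integrable_gaussian[OF \<epsilon>[of n]]] integral_gaussian[OF \<epsilon>[of n]] by (simp add: e_def)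
    have fin: "finite_measure N"
      by (rule finite_measureI) (simp add: N_def emeasure_density eN)
    \<comment> \<open>The transform of the weight \<open>e n\<close>. Its height grows like 1 /
      \<epsilon> and its width shrinks like \<epsilon>, which keeps the mass at 2 pi.\<close>
    define k where "k = (\<lambda>u. sqrt (2 * pi) / \<epsilon> n * exp (- (u / \<epsilon> n)\<^sup>2 / 2))"
    have k0: "k u \<ge> 0" for u using \<epsilon>[of n] by (simp add: k_def)
    have [measurable]: "k \<in> borel_measurable borel" unfolding k_def by measurable
    have K: "cmod (LINT \<xi>|N. cis (c * x * \<xi>) * cnj (cis (c * y * \<xi>))) = k (x - y)" for x y
    proof -
      have "(LINT \<xi>|N. cis (c * x * \<xi>) * cnj (cis (c * y * \<xi>))) = (LINT \<xi>|N. cis ((c * (x - y)) * \<xi>))"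
        by (simp add: cis_cnj cis_mult algebra_simps)
      also have "\<dots> = (LINT \<xi>|lborel. e n \<xi> *\<^sub>R cis ((c * (x - y)) * \<xi>))"
        unfolding N_def by (rule integral_density) (auto simp: e_def)
      also have "\<dots> = complex_of_real (sqrt (2 * pi) / \<epsilon> n * exp (- (c * (x - y) / \<epsilon> n)\<^sup>2 / 2))"
        using gaussian_fourier_integral[OF \<epsilon>[of n], of "c * (x - y)"] by (simp add: e_def scaleR_conv_of_real)
      also have "\<dots> = complex_of_real (k (x - y))"
        using c by (simp add: k_def power_divide power_mult_distrib power2_eq_square[of c])
      finally show ?thesis using k0 by simp
    qed
    have ki: "(\<integral>\<^sup>+y. ennreal (k (x - y)) \<partial>lborel) = ennreal (2 * pi)" for x
    proof -
      have "(\<integral>\<^sup>+y. ennreal (k (x - y)) \<partial>lborel) = ennreal \<bar>\<epsilon> n\<bar> * (\<integral>\<^sup>+y. ennreal (k (x - (x + \<epsilon> n * y))) \<partial>lborel)"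
        by (rule nn_integral_real_affine) (use \<epsilon>[of n] in auto)
      also have "(\<integral>\<^sup>+y. ennreal (k (x - (x + \<epsilon> n * y))) \<partial>lborel) = (\<integral>\<^sup>+y. ennreal (sqrt (2 * pi) / \<epsilon> n) * ennreal (exp (- (1 * y)\<^sup>2 / 2)) \<partial>lborel)"
        unfolding k_def using \<epsilon>[of n] by (intro nn_integral_cong) (simp flip: ennreal_mult)
      also have "\<dots> = ennreal (sqrt (2 * pi) / \<epsilon> n) * ennreal (sqrt (2 * pi))"
        using nn_integral_eq_integral[OF integrable_gaussian[of 1]] integral_gaussian[of 1] by (simp add: nn_integral_cmult)
      finally show ?thesis using \<epsilon>[of n] by (simp flip: ennreal_mult)
    qed
    have ksym: "k (x - y) = k (y - x)" for x y by (simp add: k_def power_divide power2_commute)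
    have "(\<integral>\<^sup>+\<xi>. ennreal (e n \<xi>) * ennreal ((cmod (FT c g \<xi>))\<^sup>2) \<partial>lborel) = (\<integral>\<^sup>+\<xi>. ennreal ((cmod (LINT x|lborel. g x * cis (c * x * \<xi>)))\<^sup>2) \<partial>N)"
      unfolding N_def FT_def by (subst nn_integral_density) (auto simp: mult.commute)
    also have "\<dots> \<le> (\<integral>\<^sup>+x. \<integral>\<^sup>+y. ennreal (cmod (g x) * cmod (g y) * cmod (LINT \<xi>|N. cis (c * x * \<xi>) * cnj (cis (c * y * \<xi>)))) \<partial>lborel \<partial>lborel)"
      by (rule nn_integral_norm2_dual_le[OF lborel.sigma_finite_measure_axioms fin g]) auto
    also have "\<dots> \<le> (\<integral>\<^sup>+x. \<integral>\<^sup>+y. (ennreal h * ennreal ((cmod (g x))\<^sup>2)) * ennreal (k (x - y)) + (ennreal h * ennreal ((cmod (g y))\<^sup>2)) * ennreal (k (x - y)) \<partial>lborel \<partial>lborel)"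
    proof (intro nn_integral_mono)
      fix x y
      have "2 * (cmod (g x) * cmod (g y)) \<le> (cmod (g x))\<^sup>2 + (cmod (g y))\<^sup>2"
        using sum_squares_bound[of "cmod (g x)" "cmod (g y)"] by simp
      hence "cmod (g x) * cmod (g y) * k (x - y) \<le> (h * (cmod (g x))\<^sup>2 + h * (cmod (g y))\<^sup>2) * k (x - y)"
        by (intro mult_right_mono k0) (simp add: h_def)
      thus "ennreal (cmod (g x) * cmod (g y) * cmod (LINT \<xi>|N. cis (c * x * \<xi>) * cnj (cis (c * y * \<xi>)))) \<le>
         (ennreal h * ennreal ((cmod (g x))\<^sup>2)) * ennreal (k (x - y)) + (ennreal h * ennreal ((cmod (g y))\<^sup>2)) * ennreal (k (x - y))"
        unfolding K using k0 h(1) by (simp add: distrib_right flip: ennreal_mult ennreal_plus)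
    qed
    also have "\<dots> = (\<integral>\<^sup>+x. (ennreal h * ennreal ((cmod (g x))\<^sup>2)) * ennreal (2 * pi) \<partial>lborel)
        + (\<integral>\<^sup>+x. \<integral>\<^sup>+y. (ennreal h * ennreal ((cmod (g y))\<^sup>2)) * ennreal (k (x - y)) \<partial>lborel \<partial>lborel)"
      by (simp add: nn_integral_add nn_integral_cmult ki)
    also have "(\<integral>\<^sup>+x. \<integral>\<^sup>+y. (ennreal h * ennreal ((cmod (g y))\<^sup>2)) * ennreal (k (x - y)) \<partial>lborel \<partial>lborel)
       = (\<integral>\<^sup>+y. \<integral>\<^sup>+x. (ennreal h * ennreal ((cmod (g y))\<^sup>2)) * ennreal (k (x - y)) \<partial>lborel \<partial>lborel)"
      by (rule lborel_pair.Fubini') measurable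
    also have "\<dots> = (\<integral>\<^sup>+y. (ennreal h * ennreal ((cmod (g y))\<^sup>2)) * ennreal (2 * pi) \<partial>lborel)"
      by (simp add: nn_integral_cmult ksym[of _ y for y] ki)
    also have "(\<integral>\<^sup>+x. (ennreal h * ennreal ((cmod (g x))\<^sup>2)) * ennreal (2 * pi) \<partial>lborel) = ennreal h * G * ennreal (2 * pi)"
      by (simp add: nn_integral_multc nn_integral_cmult G_def)
    also have "ennreal h * G * ennreal (2 * pi) + ennreal h * G * ennreal (2 * pi) = (ennreal h + ennreal h) * (ennreal (2 * pi) * G)"
      by (simp only: distrib_right) (simp only: mult_ac)
    also have "ennreal h + ennreal h = 1" using h by (simp flip: ennreal_plus)
    finally show ?thesis by simp
  qed
  \<comment> \<open>The bound for the weighted integrals is the same for all \<open>n\<close>, so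
    Fatou's lemma removes the Gaussian weight.\<close>
  have "(\<integral>\<^sup>+\<xi>. ennreal ((cmod (FT c g \<xi>))\<^sup>2) \<partial>lborel) = (\<integral>\<^sup>+\<xi>. liminf (\<lambda>n. ennreal (e n \<xi>) * ennreal ((cmod (FT c g \<xi>))\<^sup>2)) \<partial>lborel)"
  proof (intro nn_integral_cong)
    fix \<xi>
    have "(\<lambda>n. ennreal (e n \<xi> * (cmod (FT c g \<xi>))\<^sup>2)) \<longlonglongrightarrow> ennreal (1 * (cmod (FT c g \<xi>))\<^sup>2)"
      by (intro tendsto_ennrealI tendsto_intros e_lim)
    hence "(\<lambda>n. ennreal (e n \<xi>) * ennreal ((cmod (FT c g \<xi>))\<^sup>2)) \<longlonglongrightarrow> ennreal ((cmod (FT c g \<xi>))\<^sup>2)"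
      by (simp add: e_def ennreal_mult)
    from lim_imp_Liminf[OF _ this] show "ennreal ((cmod (FT c g \<xi>))\<^sup>2) = liminf (\<lambda>n. ennreal (e n \<xi>) * ennreal ((cmod (FT c g \<xi>))\<^sup>2))"
      by simp
  qed
  also have "\<dots> \<le> liminf (\<lambda>n. \<integral>\<^sup>+\<xi>. ennreal (e n \<xi>) * ennreal ((cmod (FT c g \<xi>))\<^sup>2) \<partial>lborel)"
    by (rule nn_integral_liminf) measurable
  also have "\<dots> \<le> liminf (\<lambda>n::nat. ennreal (2 * pi) * G)"
    by (intro Liminf_mono always_eventually allI step)
  also have "\<dots> = ennreal (2 * pi) * G" by (simp add: Liminf_const)
  finally show ?thesis unfolding G_def .
qed

section \<open>Square-integrable functions and Sobolev spaces\<close>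

lemma integrable_mult_L2:
  fixes f g :: "'a \<Rightarrow> complex"
  assumes [measurable]: "f \<in> borel_measurable M" "g \<in> borel_measurable M"
    and "integrable M (\<lambda>x. (cmod (f x))\<^sup>2)" "integrable M (\<lambda>x. (cmod (g x))\<^sup>2)"
  shows "integrable M (\<lambda>x. f x * g x)"
proof (rule Bochner_Integration.integrable_bound)
  show "integrable M (\<lambda>x. (cmod (f x))\<^sup>2 + (cmod (g x))\<^sup>2)" using assms by simp
  show "AE x in M. norm (f x * g x) \<le> norm ((cmod (f x))\<^sup>2 + (cmod (g x))\<^sup>2)"
  proof (rule AE_I2)
    fix x
    have "2 * (cmod (f x) * cmod (g x)) \<le> (cmod (f x))\<^sup>2 + (cmod (g x))\<^sup>2"
      using sum_squares_bound[of "cmod (f x)" "cmod (g x)"] by simp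
    moreover have "0 \<le> cmod (f x) * cmod (g x)" by simp
    ultimately have "cmod (f x) * cmod (g x) \<le> (cmod (f x))\<^sup>2 + (cmod (g x))\<^sup>2" by linarith
    thus "norm (f x * g x) \<le> norm ((cmod (f x))\<^sup>2 + (cmod (g x))\<^sup>2)" by (simp add: norm_mult)
  qed
qed auto

lemma nn_integral_L2_eq:
  assumes "integrable M (\<lambda>x. (cmod (f x))\<^sup>2)"
  shows "(\<integral>\<^sup>+x. ennreal ((cmod (f x))\<^sup>2) \<partial>M) = ennreal (LINT x|M. (cmod (f x))\<^sup>2)"
  by (rule nn_integral_eq_integral[OF assms]) auto

lemma integrable_L2I:
  assumes [measurable]: "f \<in> borel_measurable M" and "(\<integral>\<^sup>+x. ennreal ((cmod (f x))\<^sup>2) \<partial>M) < \<infinity>"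
  shows "integrable M (\<lambda>x. (cmod (f x))\<^sup>2)"
  by (rule integrableI_bounded) (use assms in auto)

lemma schwartz_L2:
  assumes f: "f \<in> schwartz" shows "integrable lborel (\<lambda>x. (cmod (f x))\<^sup>2)"
proof -
  obtain B where B: "\<And>x. norm (f x) \<le> B" using schwartz_bounded[OF f, of 0] by (auto simp: bounded_iff)
  have [measurable]: "f \<in> borel_measurable borel" by (rule schwartz_measurable[OF f])
  show ?thesis
  proof (rule Bochner_Integration.integrable_bound)
    show "integrable lborel (\<lambda>x. B * norm (f x))" using schwartz_integrable[OF f] by simp
    show "AE x in lborel. norm ((cmod (f x))\<^sup>2) \<le> norm (B * norm (f x))"
    proof (rule AE_I2)
      fix x
      have "cmod (f x) * cmod (f x) \<le> B * cmod (f x)" by (intro mult_right_mono B) auto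
      thus "norm ((cmod (f x))\<^sup>2) \<le> norm (B * norm (f x))" by (simp add: power2_eq_square)
    qed
  qed auto
qed

lemma FT_diff:
  assumes "integrable lborel f" "integrable lborel g"
  shows "FT c (\<lambda>x. f x - g x) \<xi> = FT c f \<xi> - FT c g \<xi>"
proof -
  have "FT c (\<lambda>x. f x - g x) \<xi> = (LINT x|lborel. cis (c * x * \<xi>) * f x - cis (c * x * \<xi>) * g x)"
    unfolding FT_def by (simp add: right_diff_distrib)
  also have "\<dots> = FT c f \<xi> - FT c g \<xi>" unfolding FT_def
    by (rule Bochner_Integration.integral_diff; rule integrable_cis_mult) (use assms in auto)
  finally show ?thesis .
qed

lemma summable_of_weighted_square_bound:
  fixes d :: "nat \<Rightarrow> 'a :: banach"
  assumes "\<And>k. 2 ^ k * (norm (d k))\<^sup>2 \<le> D"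
  shows "summable d"
proof (rule summable_norm_cancel, rule summable_comparison_test_ev)
  show "\<forall>\<^sub>F k in sequentially. norm (norm (d k)) \<le> sqrt D * (sqrt (1/2)) ^ k"
  proof (intro always_eventually allI)
    fix k
    have "(norm (d k))\<^sup>2 \<le> D * (1/2) ^ k" using assms[of k] by (simp add: field_simps)
    hence "norm (d k) \<le> sqrt (D * (1/2) ^ k)" by (rule real_le_rsqrt)
    thus "norm (norm (d k)) \<le> sqrt D * (sqrt (1/2)) ^ k" by (simp add: real_sqrt_mult real_sqrt_power real_sqrt_divide power_divide)
  qed
  show "summable (\<lambda>k. sqrt D * (sqrt (1/2)) ^ k)"
    by (intro summable_mult summable_geometric) (simp add: real_sqrt_lt_1_iff)
qed

text \<open>The truncations \<open>h 1\<^bsub>[-n,n]\<^esub>\<close> have Fourier transforms that form a Cauchy sequence in \<open>L\<^sup>2\<close>;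
  along a fast subsequence they converge almost everywhere, since the weighted square function
  \<open>\<Sum> 2\<^sup>k \<bar>d\<^sub>k\<bar>\<^sup>2\<close> of the increments has a finite integral.\<close>

lemma L2_fourier_extension:
  assumes h[measurable]: "h \<in> borel_measurable borel" and h2: "integrable lborel (\<lambda>x. (cmod (h x))\<^sup>2)" and c: "c * c = 1"
  obtains H where "H \<in> borel_measurable borel"
    "(\<integral>\<^sup>+x. ennreal ((cmod (H x))\<^sup>2) \<partial>lborel) \<le> ennreal (2 * pi) * (\<integral>\<^sup>+x. ennreal ((cmod (h x))\<^sup>2) \<partial>lborel)"
    "\<And>\<phi>. \<phi> \<in> schwartz \<Longrightarrow> (LINT x|lborel. h x * FT c \<phi> x) = (LINT x|lborel. H x * \<phi> x)"
proof -
  define t where "t = (\<lambda>n x. indicator {- real n..real n} x *\<^sub>R h x)"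
  have [measurable]: "t n \<in> borel_measurable borel" for n unfolding t_def by measurable
  have tle: "cmod (t n x) \<le> cmod (h x)" for n x by (auto simp: t_def indicator_def)
  have tlim: "(\<lambda>n. t n x) \<longlonglongrightarrow> h x" for x
  proof -
    obtain N :: nat where N: "\<bar>x\<bar> \<le> real N" using real_arch_simple by blast
    have "\<forall>\<^sub>F n in sequentially. t n x = h x"
      using eventually_ge_at_top[of N] by eventually_elim (use N in \<open>auto simp: t_def indicator_def\<close>)
    thus ?thesis by (rule tendsto_eventually)
  qed
  have tdiff: "cmod (t n x - t k x) \<le> cmod (h x - t k x)" if "k \<le> n" for n k x
    using that by (auto simp: t_def indicator_def)
  have t1: "integrable lborel (t n)" for n
  proof (rule Bochner_Integration.integrable_bound)
    show "integrable lborel (\<lambda>x. indicat_real {- real n..real n} x + (cmod (h x))\<^sup>2)"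
      using h2 by (intro Bochner_Integration.integrable_add integrable_real_indicator) auto
    show "AE x in lborel. norm (t n x) \<le> norm (indicat_real {- real n..real n} x + (cmod (h x))\<^sup>2)"
    proof (rule AE_I2)
      fix x
      have "cmod (h x) \<le> 1 + (cmod (h x))\<^sup>2" using sum_squares_bound[of "cmod (h x)" 1] zero_le_power2[of "cmod (h x)"] norm_ge_zero[of "h x"]
        by (simp only: mult_1_right one_power2)
      thus "norm (t n x) \<le> norm (indicat_real {- real n..real n} x + (cmod (h x))\<^sup>2)"
        by (auto simp: t_def indicator_def)
    qed
  qed auto
  define a where "a = (\<lambda>n. LINT x|lborel. (cmod (h x - t n x))\<^sup>2)"
  have hdle: "cmod (h x - t n x) \<le> cmod (h x)" for n x by (auto simp: t_def indicator_def)
  have hd2: "integrable lborel (\<lambda>x. (cmod (h x - t n x))\<^sup>2)" for n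
    by (rule Bochner_Integration.integrable_bound[OF h2]) (use hdle in \<open>auto intro!: power_mono\<close>)
  have "a \<longlonglongrightarrow> (LINT x::real|lborel. (0::real))"
    unfolding a_def
  proof (rule integral_dominated_convergence[where w = "\<lambda>x. (cmod (h x))\<^sup>2"])
    show "integrable lborel (\<lambda>x. (cmod (h x))\<^sup>2)" by (rule h2)
    show "AE x in lborel. (\<lambda>n. (cmod (h x - t n x))\<^sup>2) \<longlonglongrightarrow> 0"
    proof (rule AE_I2)
      fix x
      have "(\<lambda>n. (cmod (h x - t n x))\<^sup>2) \<longlonglongrightarrow> (cmod (h x - h x))\<^sup>2" by (intro tendsto_intros tlim)
      thus "(\<lambda>n. (cmod (h x - t n x))\<^sup>2) \<longlonglongrightarrow> 0" by simp
    qed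
  qed (use hdle in \<open>auto intro!: power_mono AE_I2\<close>)
  hence a0: "a \<longlonglongrightarrow> 0" by simp
  \<comment> \<open>Squared tails below 4^(-k) survive the weight 2^k of the square function and
    leave the convergent series of 2^(-k).\<close>
  have "\<exists>r. strict_mono r \<and> (\<forall>k. a (r k) < (1/4) ^ k)"
  proof -
    have "\<exists>r. \<forall>k. a (r k) < (1/4) ^ k \<and> r k < r (Suc k)"
    proof (rule dependent_nat_choice)
      show "\<exists>n. a n < (1/4) ^ 0" using order_tendstoD(2)[OF a0, of "(1/4)^0"] by (auto simp: eventually_sequentially)
      fix n k
      have "\<forall>\<^sub>F m in sequentially. a m < (1/4) ^ Suc k" by (rule order_tendstoD(2)[OF a0]) simp
      hence "\<forall>\<^sub>F m in sequentially. a m < (1/4) ^ Suc k \<and> n < m" using eventually_gt_at_top by (rule eventually_conj)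
      thus "\<exists>m. a m < (1/4) ^ Suc k \<and> n < m" by (auto simp: eventually_sequentially)
    qed
    thus ?thesis by (auto simp: strict_mono_Suc_iff)
  qed
  then obtain r where r: "strict_mono r" "\<And>k. a (r k) < (1/4) ^ k" by blast
  have rmono: "r k \<le> r j" if "k \<le> j" for k j using r(1) that by (simp add: strict_mono_less_eq)
  define G where "G = (\<lambda>k. FT c (t (r k)))"
  have [measurable]: "G k \<in> borel_measurable borel" for k unfolding G_def by measurable
  have Gdiff: "(\<integral>\<^sup>+x. ennreal ((cmod (G j x - G k x))\<^sup>2) \<partial>lborel) \<le> ennreal (2 * pi * (1/4) ^ k)" if "k \<le> j" for j k
  proof -
    have "(\<integral>\<^sup>+x. ennreal ((cmod (G j x - G k x))\<^sup>2) \<partial>lborel) = (\<integral>\<^sup>+x. ennreal ((cmod (FT c (\<lambda>x. t (r j) x - t (r k) x) x))\<^sup>2) \<partial>lborel)"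
      unfolding G_def by (simp add: FT_diff[OF t1 t1])
    also have "\<dots> \<le> ennreal (2 * pi) * (\<integral>\<^sup>+x. ennreal ((cmod (t (r j) x - t (r k) x))\<^sup>2) \<partial>lborel)"
      by (rule FT_plancherel_le[OF _ c]) (use t1 in auto)
    also have "\<dots> \<le> ennreal (2 * pi) * (\<integral>\<^sup>+x. ennreal ((cmod (h x - t (r k) x))\<^sup>2) \<partial>lborel)"
      using tdiff[OF rmono[OF that]] by (intro mult_left_mono nn_integral_mono ennreal_leI power_mono) auto
    also have "(\<integral>\<^sup>+x. ennreal ((cmod (h x - t (r k) x))\<^sup>2) \<partial>lborel) = ennreal (a (r k))"
      unfolding a_def by (rule nn_integral_L2_eq[OF hd2])
    also have "\<dots> \<le> ennreal ((1/4) ^ k)" using r(2)[of k] by (intro ennreal_leI) simp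
    also have "ennreal (2 * pi) * ennreal ((1/4) ^ k) = ennreal (2 * pi * (1/4) ^ k)" by (rule ennreal_mult[symmetric]) auto
    finally show ?thesis by (simp add: mult_left_mono)
  qed
  define D where "D = (\<lambda>x. \<Sum>k. ennreal (2 ^ k * (cmod (G (Suc k) x - G k x))\<^sup>2))"
  have "(\<integral>\<^sup>+x. D x \<partial>lborel) = (\<Sum>k. \<integral>\<^sup>+x. ennreal (2 ^ k * (cmod (G (Suc k) x - G k x))\<^sup>2) \<partial>lborel)"
    unfolding D_def by (rule nn_integral_suminf) measurable
  also have "\<dots> \<le> (\<Sum>k. ennreal (2 * pi * (1/2) ^ k))"
  proof (intro suminf_le summableI)
    fix k :: nat
    have "(\<integral>\<^sup>+x. ennreal (2 ^ k * (cmod (G (Suc k) x - G k x))\<^sup>2) \<partial>lborel) = ennreal (2 ^ k) * (\<integral>\<^sup>+x. ennreal ((cmod (G (Suc k) x - G k x))\<^sup>2) \<partial>lborel)"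
      by (subst nn_integral_cmult[symmetric]) (auto simp: ennreal_mult)
    also have "\<dots> \<le> ennreal (2 ^ k) * ennreal (2 * pi * (1/4) ^ k)" by (intro mult_left_mono Gdiff) auto
    also have "\<dots> = ennreal (2 ^ k * (2 * pi * (1/4) ^ k))" by (rule ennreal_mult[symmetric]) auto
    also have "2 ^ k * (2 * pi * (1/4) ^ k) = 2 * pi * (1/2) ^ k"
      using power_mult_distrib[of "2::real" "1/4" k] by simp
    finally show "(\<integral>\<^sup>+x. ennreal (2 ^ k * (cmod (G (Suc k) x - G k x))\<^sup>2) \<partial>lborel) \<le> ennreal (2 * pi * (1/2) ^ k)" .
  qed
  also have "\<dots> < \<infinity>"
    by (subst suminf_ennreal2) (auto intro!: summable_mult summable_geometric)
  finally have "AE x in lborel. D x \<noteq> \<infinity>"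
    by (intro nn_integral_PInf_AE) (auto simp: D_def)
  hence conv: "AE x in lborel. convergent (\<lambda>k. G k x)"
  proof eventually_elim
    case (elim x)
    have "2 ^ k * (norm (G (Suc k) x - G k x))\<^sup>2 \<le> enn2real (D x)" for k
    proof -
      have "(\<Sum>j\<in>{k}. ennreal (2 ^ j * (cmod (G (Suc j) x - G j x))\<^sup>2)) \<le> D x"
        unfolding D_def by (rule sum_le_suminf) auto
      hence "enn2real (ennreal (2 ^ k * (cmod (G (Suc k) x - G k x))\<^sup>2)) \<le> enn2real (D x)"
        using elim by (intro enn2real_mono) (auto simp: less_top)
      thus ?thesis by (simp add: enn2real_ennreal)
    qed
    from summable_of_weighted_square_bound[OF this] have "summable (\<lambda>k. G (Suc k) x - G k x)" .
    hence "convergent (\<lambda>n. \<Sum>k<n. G (Suc k) x - G k x)" by (simp add: summable_iff_convergent)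
    moreover have "(\<Sum>k<n. G (Suc k) x - G k x) = G n x - G 0 x" for n
      by (rule sum_lessThan_telescope)
    ultimately have "convergent (\<lambda>n. G n x - G 0 x)" by simp
    from convergent_add[OF this convergent_const[of "G 0 x"]] show ?case by simp
  qed
  \<comment> \<open>On the null set where the sequence diverges the value of \<open>lim\<close> is
    immaterial; H is measurable in any case.\<close>
  define H where "H = (\<lambda>x. lim (\<lambda>k. G k x))"
  have [measurable]: "H \<in> borel_measurable borel"
    unfolding H_def by (rule borel_measurable_lim_metric) measurable
  have Hlim: "AE x in lborel. (\<lambda>k. G k x) \<longlonglongrightarrow> H x"
    using conv by eventually_elim (simp add: H_def convergent_LIMSEQ_iff)
  \<comment> \<open>Carries L^2 bounds from the sequence to its limit. It is used against
    \<open>g = 0\<close> for the norm of H, and against \<open>g = G k\<close> for the distance from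
    H to the sequence.\<close>
  have fatou: "(\<integral>\<^sup>+x. ennreal ((cmod (H x - g x))\<^sup>2) \<partial>lborel) \<le> B"
    if [measurable]: "g \<in> borel_measurable borel" and B: "\<And>j. j \<ge> k \<Longrightarrow> (\<integral>\<^sup>+x. ennreal ((cmod (G j x - g x))\<^sup>2) \<partial>lborel) \<le> B" for g B k
  proof -
    have "(\<integral>\<^sup>+x. ennreal ((cmod (H x - g x))\<^sup>2) \<partial>lborel) = (\<integral>\<^sup>+x. liminf (\<lambda>j. ennreal ((cmod (G (j + k) x - g x))\<^sup>2)) \<partial>lborel)"
    proof (rule nn_integral_cong_AE)
      show "AE x in lborel. ennreal ((cmod (H x - g x))\<^sup>2) = liminf (\<lambda>j. ennreal ((cmod (G (j + k) x - g x))\<^sup>2))"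
        using Hlim
      proof eventually_elim
        case (elim x)
        have "(\<lambda>j. ennreal ((cmod (G (j + k) x - g x))\<^sup>2)) \<longlonglongrightarrow> ennreal ((cmod (H x - g x))\<^sup>2)"
          by (intro tendsto_ennrealI tendsto_intros LIMSEQ_ignore_initial_segment elim)
        from lim_imp_Liminf[OF _ this] show ?case by simp
      qed
    qed
    also have "\<dots> \<le> liminf (\<lambda>j. \<integral>\<^sup>+x. ennreal ((cmod (G (j + k) x - g x))\<^sup>2) \<partial>lborel)"
      by (rule nn_integral_liminf) measurable
    also have "\<dots> \<le> liminf (\<lambda>j::nat. B)" by (intro Liminf_mono always_eventually allI B) simp
    also have "\<dots> = B" by (simp add: Liminf_const)
    finally show ?thesis .
  qed
  have HG: "(\<integral>\<^sup>+x. ennreal ((cmod (H x - G k x))\<^sup>2) \<partial>lborel) \<le> ennreal (2 * pi * (1/4) ^ k)" for k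
    by (rule fatou[of _ k]) (use Gdiff in auto)
  have G2: "(\<integral>\<^sup>+x. ennreal ((cmod (G j x))\<^sup>2) \<partial>lborel) \<le> ennreal (2 * pi) * (\<integral>\<^sup>+x. ennreal ((cmod (h x))\<^sup>2) \<partial>lborel)" for j
  proof -
    have "(\<integral>\<^sup>+x. ennreal ((cmod (G j x))\<^sup>2) \<partial>lborel) \<le> ennreal (2 * pi) * (\<integral>\<^sup>+x. ennreal ((cmod (t (r j) x))\<^sup>2) \<partial>lborel)"
      unfolding G_def by (rule FT_plancherel_le[OF t1 c])
    also have "\<dots> \<le> ennreal (2 * pi) * (\<integral>\<^sup>+x. ennreal ((cmod (h x))\<^sup>2) \<partial>lborel)"
      using tle by (intro mult_left_mono nn_integral_mono ennreal_leI power_mono) auto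
    finally show ?thesis .
  qed
  have H2: "(\<integral>\<^sup>+x. ennreal ((cmod (H x))\<^sup>2) \<partial>lborel) \<le> ennreal (2 * pi) * (\<integral>\<^sup>+x. ennreal ((cmod (h x))\<^sup>2) \<partial>lborel)"
    using fatou[of "\<lambda>_. 0" 0] G2 by simp
  have fin: "ennreal (2 * pi) * (\<integral>\<^sup>+x. ennreal ((cmod (h x))\<^sup>2) \<partial>lborel) < \<infinity>"
    unfolding nn_integral_L2_eq[OF h2] by (simp add: ennreal_mult_less_top)
  have Hi: "integrable lborel (\<lambda>x. (cmod (H x))\<^sup>2)" by (rule integrable_L2I) (use H2 fin in auto)
  have Gi: "integrable lborel (\<lambda>x. (cmod (G j x))\<^sup>2)" for j
    by (rule integrable_L2I) (use le_less_trans[OF G2 fin] in auto)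
  show thesis
  proof (rule that)
    fix \<phi> assume \<phi>: "\<phi> \<in> schwartz"
    have [measurable]: "\<phi> \<in> borel_measurable borel" by (rule schwartz_measurable[OF \<phi>])
    have F: "FT c \<phi> \<in> schwartz" by (rule schwartz_FT[OF \<phi>]) (use c in auto)
    have [measurable]: "FT c \<phi> \<in> borel_measurable borel" by (rule schwartz_measurable[OF F])
    have hF: "integrable lborel (\<lambda>x. h x * FT c \<phi> x)"
      by (rule integrable_mult_L2[OF _ _ h2 schwartz_L2[OF F]]) auto
    have 1: "(\<lambda>k. LINT x|lborel. t (r k) x * FT c \<phi> x) \<longlonglongrightarrow> (LINT x|lborel. h x * FT c \<phi> x)"
    proof (rule integral_dominated_convergence[where w = "\<lambda>x. norm (h x * FT c \<phi> x)"])
      show "integrable lborel (\<lambda>x. norm (h x * FT c \<phi> x))" by (rule integrable_norm[OF hF])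
      show "AE x in lborel. (\<lambda>k. t (r k) x * FT c \<phi> x) \<longlonglongrightarrow> h x * FT c \<phi> x"
        using LIMSEQ_subseq_LIMSEQ[OF tlim r(1)] by (intro AE_I2 tendsto_intros) (simp add: comp_def)
      show "AE x in lborel. norm (t (r k) x * FT c \<phi> x) \<le> norm (h x * FT c \<phi> x)" for k
        using tle by (intro AE_I2) (simp add: norm_mult mult_right_mono)
    qed auto
    have eq: "(LINT x|lborel. t (r k) x * FT c \<phi> x) = (LINT x|lborel. G k x * \<phi> x)" for k
      unfolding G_def by (rule FT_multiplication_formula[OF t1 schwartz_integrable[OF \<phi>]])
    define P where "P = (LINT x|lborel. (cmod (\<phi> x))\<^sup>2)"
    have P: "P \<ge> 0" by (simp add: P_def)
    \<comment> \<open>Cauchy-Schwarz converts the L^2 distance 2 pi 4^(-k), taken squared, into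
      convergence of the pairings with \<open>\<phi>\<close> at the rate 2^(-k).\<close>
    have b: "norm ((LINT x|lborel. G k x * \<phi> x) - (LINT x|lborel. H x * \<phi> x)) \<le> sqrt (2 * pi * P) * (1/2) ^ k" for k
    proof -
      have "(LINT x|lborel. G k x * \<phi> x) - (LINT x|lborel. H x * \<phi> x) = (LINT x|lborel. G k x * \<phi> x - H x * \<phi> x)"
        by (rule Bochner_Integration.integral_diff[symmetric]; rule integrable_mult_L2) (use Gi Hi schwartz_L2[OF \<phi>] in auto)
      hence "ennreal (norm ((LINT x|lborel. G k x * \<phi> x) - (LINT x|lborel. H x * \<phi> x))) \<le> (\<integral>\<^sup>+x. ennreal (norm (G k x * \<phi> x - H x * \<phi> x)) \<partial>lborel)"
        using integral_norm_bound_ennreal[of lborel "\<lambda>x. G k x * \<phi> x - H x * \<phi> x"]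
        by (cases "integrable lborel (\<lambda>x. G k x * \<phi> x - H x * \<phi> x)") (auto simp: not_integrable_integral_eq)
      also have "\<dots> = (\<integral>\<^sup>+x. ennreal (cmod (H x - G k x)) * ennreal (cmod (\<phi> x)) \<partial>lborel)"
        by (intro nn_integral_cong) (simp add: norm_mult[symmetric] left_diff_distrib norm_minus_commute flip: ennreal_mult)
      finally have "(ennreal (norm ((LINT x|lborel. G k x * \<phi> x) - (LINT x|lborel. H x * \<phi> x))))\<^sup>2 \<le> \<dots>\<^sup>2"
        by (rule power_mono) simp
      also have "\<dots> \<le> (\<integral>\<^sup>+x. (ennreal (cmod (H x - G k x)))\<^sup>2 \<partial>lborel) * (\<integral>\<^sup>+x. (ennreal (cmod (\<phi> x)))\<^sup>2 \<partial>lborel)"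
        by (rule Cauchy_Schwarz_nn_integral) auto
      also have "\<dots> = (\<integral>\<^sup>+x. ennreal ((cmod (H x - G k x))\<^sup>2) \<partial>lborel) * ennreal P"
        unfolding P_def nn_integral_L2_eq[OF schwartz_L2[OF \<phi>], symmetric] by (simp add: ennreal_power)
      also have "\<dots> \<le> ennreal (2 * pi * (1/4) ^ k) * ennreal P" by (intro mult_right_mono HG) auto
      also have "\<dots> = ennreal (2 * pi * (1/4) ^ k * P)" using P by (intro ennreal_mult[symmetric]) auto
      finally have "(norm ((LINT x|lborel. G k x * \<phi> x) - (LINT x|lborel. H x * \<phi> x)))\<^sup>2 \<le> 2 * pi * (1/4) ^ k * P"
        using P by (simp add: ennreal_power ennreal_le_iff)
      also have "\<dots> = (sqrt (2 * pi * P) * (1/2) ^ k)\<^sup>2"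
      proof -
        have "(4::real) ^ k = (2 ^ k)\<^sup>2" by (simp add: power2_eq_square flip: power_mult_distrib)
        thus ?thesis using P by (simp add: power_mult_distrib power_divide)
      qed
      finally show ?thesis by (rule power2_le_imp_le) (use P in auto)
    qed
    have "(\<lambda>k. sqrt (2 * pi * P) * (1/2) ^ k) \<longlonglongrightarrow> 0"
      by (intro tendsto_mult_right_zero LIMSEQ_power_zero) auto
    from Lim_null_comparison[OF always_eventually[OF allI[OF b]] this]
    have "(\<lambda>k. (LINT x|lborel. G k x * \<phi> x) - (LINT x|lborel. H x * \<phi> x)) \<longlonglongrightarrow> 0" .
    hence "(\<lambda>k. LINT x|lborel. G k x * \<phi> x) \<longlonglongrightarrow> (LINT x|lborel. H x * \<phi> x)" by (rule LIM_zero_cancel)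
    with 1 show "(LINT x|lborel. h x * FT c \<phi> x) = (LINT x|lborel. H x * \<phi> x)"
      unfolding eq by (rule LIMSEQ_unique)
  qed (use H2 in auto)
qed

section \<open>Uniqueness of representing functions\<close>

text \<open>The positive and the negative part of v have equal Fourier transforms, and by the
  frequency t = 0 equal mass. Divided by that mass they are densities of two probability measures
  with the same characteristic function, hence equal by Levy's uniqueness theorem. If the mass is 0,
  both parts vanish almost everywhere.\<close>

lemma L1_eq_0_of_fourier_eq_0_real:
  fixes v :: "real \<Rightarrow> real"
  assumes v: "integrable lborel v"
    and F: "\<And>t. (LINT x|lborel. cis (t * x) * complex_of_real (v x)) = 0"
  shows "AE x in lborel. v x = 0"
proof -
  have [measurable]: "v \<in> borel_measurable borel" using v by auto
  define p where "p = (\<lambda>x. max 0 (v x))"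
  define n where "n = (\<lambda>x. max 0 (- v x))"
  have [measurable]: "p \<in> borel_measurable borel" "n \<in> borel_measurable borel" unfolding p_def n_def by measurable
  have pn: "v x = p x - n x" "p x \<ge> 0" "n x \<ge> 0" for x by (auto simp: p_def n_def max_def)
  have pi: "integrable lborel p" unfolding p_def using v by (intro integrable_max) auto
  have ni: "integrable lborel n" unfolding n_def using v by (intro integrable_max) auto
  have Ip: "integrable lborel (\<lambda>x. cis (t * x) * complex_of_real (p x))" for t using pi by (intro integrable_cis_mult) auto
  have In: "integrable lborel (\<lambda>x. cis (t * x) * complex_of_real (n x))" for t using ni by (intro integrable_cis_mult) auto
  have eq: "(LINT x|lborel. cis (t * x) * complex_of_real (p x)) = (LINT x|lborel. cis (t * x) * complex_of_real (n x))" for t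
  proof -
    have "0 = (LINT x|lborel. cis (t * x) * complex_of_real (p x) - cis (t * x) * complex_of_real (n x))"
      using F[of t] by (simp add: pn(1) right_diff_distrib)
    also have "\<dots> = (LINT x|lborel. cis (t * x) * complex_of_real (p x)) - (LINT x|lborel. cis (t * x) * complex_of_real (n x))"
      by (rule Bochner_Integration.integral_diff[OF Ip In])
    finally show ?thesis by simp
  qed
  define C where "C = (LINT x|lborel. p x)"
  have Cn: "C = (LINT x|lborel. n x)"
  proof -
    have "complex_of_real C = complex_of_real (LINT x|lborel. n x)"
      using eq[of 0] by (simp add: C_def)
    thus ?thesis by (simp only: of_real_eq_iff)
  qed
  have C0: "C \<ge> 0" unfolding C_def using pn by (intro integral_nonneg_AE) auto
  have "AE x in lborel. p x = n x"
  proof (cases "C = 0")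
    case True
    have "AE x in lborel. p x = 0" using integral_nonneg_eq_0_iff_AE[OF pi] pn True by (simp add: C_def)
    moreover have "AE x in lborel. n x = 0" using integral_nonneg_eq_0_iff_AE[OF ni] pn True by (simp add: Cn)
    ultimately show ?thesis by eventually_elim simp
  next
    case False
    hence C: "C > 0" using C0 by simp
    define M where "M = (\<lambda>w::real\<Rightarrow>real. density lborel (\<lambda>x. ennreal (w x / C)))"
    have dist: "real_distribution (M w)" if [measurable]: "w \<in> borel_measurable borel" and w: "integrable lborel w" "\<And>x. w x \<ge> 0" "(LINT x|lborel. w x) = C" for w
    proof -
      have "emeasure (M w) (space (M w)) = (\<integral>\<^sup>+x. ennreal (w x / C) \<partial>lborel)"
        by (simp add: M_def emeasure_density)
      also have "\<dots> = ennreal (LINT x|lborel. w x / C)"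
        by (rule nn_integral_eq_integral) (use w C in auto)
      also have "\<dots> = 1" using w C by simp
      finally have "prob_space (M w)" by (rule prob_spaceI)
      thus ?thesis by (simp add: real_distribution_def real_distribution_axioms_def M_def)
    qed
    have char: "char (M w) t = (LINT x|lborel. cis (t * x) * complex_of_real (w x)) / complex_of_real C"
      if [measurable]: "w \<in> borel_measurable borel" and w: "\<And>x. w x \<ge> 0" for w t
    proof -
      have "char (M w) t = (LINT x|lborel. (w x / C) *\<^sub>R iexp (t * x))"
        unfolding char_def M_def by (rule integral_density) (use w C in auto)
      also have "\<dots> = (LINT x|lborel. (cis (t * x) * complex_of_real (w x)) / complex_of_real C)"
        by (intro Bochner_Integration.integral_cong) (auto simp: scaleR_conv_of_real cis_conv_exp)
      finally show ?thesis by simp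
    qed
    have "M p = M n"
      by (rule Levy_uniqueness) (use dist[OF _ pi] dist[OF _ ni] pn C_def Cn char eq in \<open>auto simp: fun_eq_iff\<close>)
    hence "AE x in lborel. ennreal (p x / C) = ennreal (n x / C)"
      unfolding M_def by (intro sigma_finite_measure.density_unique[OF lborel.sigma_finite_measure_axioms]) auto
    thus ?thesis by eventually_elim (use pn C in auto)
  qed
  thus ?thesis by eventually_elim (simp add: pn(1))
qed

text \<open>The transform of cnj u at t is the conjugate of the transform of u at -t, so it vanishes
  as well; real and imaginary part are combinations of u and cnj u.\<close>

lemma L1_eq_0_of_fourier_eq_0:
  fixes u :: "real \<Rightarrow> complex"
  assumes u: "integrable lborel u" and F: "\<And>t. (LINT x|lborel. cis (t * x) * u x) = 0"
  shows "AE x in lborel. u x = 0"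
proof -
  have cF: "(LINT x|lborel. cis (t * x) * cnj (u x)) = 0" for t
  proof -
    have "(LINT x|lborel. cis (t * x) * cnj (u x)) = (LINT x|lborel. cnj (cis ((- t) * x) * u x))" by (simp add: cis_cnj)
    also have "\<dots> = cnj (LINT x|lborel. cis ((- t) * x) * u x)" by (rule Bochner_Integration.integral_cnj)
    finally show ?thesis using F[of "- t"] by simp
  qed
  have cu: "integrable lborel (\<lambda>x. cnj (u x))" using u by simp
  have i: "integrable lborel (\<lambda>x. cis (t * x) * u x)" "integrable lborel (\<lambda>x. cis (t * x) * cnj (u x))" for t
    using u cu by (auto intro!: integrable_cis_mult)
  have "AE x in lborel. Re (u x) = 0"
  proof (rule L1_eq_0_of_fourier_eq_0_real)
    fix t
    have "(LINT x|lborel. cis (t * x) * complex_of_real (Re (u x))) = (LINT x|lborel. (cis (t * x) * u x + cis (t * x) * cnj (u x)) / 2)"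
    proof (intro Bochner_Integration.integral_cong refl)
      fix x
      have "complex_of_real (Re (u x)) = (u x + cnj (u x)) / 2" by (simp add: complex_add_cnj)
      thus "cis (t * x) * complex_of_real (Re (u x)) = (cis (t * x) * u x + cis (t * x) * cnj (u x)) / 2"
        by (simp only: distrib_left times_divide_eq_right)
    qed
    also have "\<dots> = 0" using F cF i by simp
    finally show "(LINT x|lborel. cis (t * x) * complex_of_real (Re (u x))) = 0" .
  qed (use u in auto)
  moreover have "AE x in lborel. Im (u x) = 0"
  proof (rule L1_eq_0_of_fourier_eq_0_real)
    fix t
    have "(LINT x|lborel. cis (t * x) * complex_of_real (Im (u x))) = (LINT x|lborel. (cis (t * x) * u x - cis (t * x) * cnj (u x)) / (2 * \<i>))"
    proof (intro Bochner_Integration.integral_cong refl)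
      fix x
      have "complex_of_real (Im (u x)) = (u x - cnj (u x)) / (2 * \<i>)"
        by (simp add: complex_eq_iff Re_divide Im_divide power2_eq_square)
      thus "cis (t * x) * complex_of_real (Im (u x)) = (cis (t * x) * u x - cis (t * x) * cnj (u x)) / (2 * \<i>)"
        by (simp only: right_diff_distrib times_divide_eq_right)
    qed
    also have "\<dots> = 0" using F cF i by simp
    finally show "(LINT x|lborel. cis (t * x) * complex_of_real (Im (u x))) = 0" .
  qed (use u in auto)
  ultimately show ?thesis by eventually_elim (simp add: complex_eq_iff)
qed

text \<open>The difference of two representatives need not be integrable, but its product with
  exp(-x^2) is. The functions cis(t x) exp(-x^2) are admissible test functions, and testing against
  them says that the Fourier transform of this product is 0.\<close>

lemma represents_unique:
  assumes "represents g T" "represents g' T"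
  shows "AE x in lborel. g x = g' x"
proof -
  let ?e = "\<lambda>x::real. complex_of_real (exp (- x\<^sup>2))"
  define u where "u = (\<lambda>x. (g x - g' x) * ?e x)"
  have s: "(\<lambda>x. cis (t * x) * ?e x) \<in> schwartz" for t by (intro schwartz_intros)
  have i: "integrable lborel (\<lambda>x. g x * ?e x)" "integrable lborel (\<lambda>x. g' x * ?e x)"
    using assms s[of 0] by (auto simp: represents_def)
  have "AE x in lborel. u x = 0"
  proof (rule L1_eq_0_of_fourier_eq_0)
    show "integrable lborel u" unfolding u_def left_diff_distrib by (intro Bochner_Integration.integrable_diff i)
    fix t
    have "(LINT x|lborel. cis (t * x) * u x) = (LINT x|lborel. g x * (cis (t * x) * ?e x) - g' x * (cis (t * x) * ?e x))"
      unfolding u_def by (simp add: algebra_simps)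
    also have "\<dots> = (LINT x|lborel. g x * (cis (t * x) * ?e x)) - (LINT x|lborel. g' x * (cis (t * x) * ?e x))"
      using assms s[of t] by (intro Bochner_Integration.integral_diff) (auto simp: represents_def)
    also have "\<dots> = T (\<lambda>x. cis (t * x) * ?e x) - T (\<lambda>x. cis (t * x) * ?e x)"
      using assms s[of t] by (simp add: represents_def)
    finally show "(LINT x|lborel. cis (t * x) * u x) = 0" by simp
  qed
  thus ?thesis by eventually_elim (simp add: u_def)
qed

section \<open>Sobolev data on the Fourier side\<close>

lemma bessel_eq: "bessel s f \<phi> = f (fourier (\<lambda>\<xi>. japanese (s / 2) \<xi> * inv_fourier \<phi> \<xi>))"
  by (simp add: bessel_def inv_fourier_dist_def mult_dist_def fourier_dist_def japanese_def)

lemma japanese_mult: "japanese a x * japanese b x = japanese (a + b) x"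
  by (simp add: japanese_def powr_add)

lemma japanese_0 [simp]: "japanese 0 x = 1"
  by (simp add: japanese_def)

lemma japanese_measurable [measurable]: "japanese a \<in> borel_measurable borel"
  unfolding japanese_def[abs_def] by measurable

lemma represents_fhat: "represents g (fourier_dist f) \<Longrightarrow> represents (fhat f) (fourier_dist f)"
  unfolding fhat_def by (rule someI[where P = "\<lambda>g. represents g (fourier_dist f)"])

text \<open>Any two representatives agree almost everywhere, so the choice made by
  \<open>SOME\<close> does not affect the norm.\<close>

lemma sobolev_norm_eq:
  assumes h: "L2_fun h" "represents h (bessel s f)"
  shows "sobolev_norm s f = L2_norm h"
proof -
  define h' where "h' = (SOME h. L2_fun h \<and> represents h (bessel s f))"
  have h': "L2_fun h' \<and> represents h' (bessel s f)" unfolding h'_def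
    by (rule someI[where P = "\<lambda>h. L2_fun h \<and> represents h (bessel s f)"]) (use h in blast)
  have ae: "AE x in lborel. h' x = h x" using represents_unique h h' by blast
  have "(LINT x|lborel. (cmod (h' x))\<^sup>2) = (LINT x|lborel. (cmod (h x))\<^sup>2)"
  proof (rule Bochner_Integration.integral_cong_AE)
    show "AE x in lborel. (cmod (h' x))\<^sup>2 = (cmod (h x))\<^sup>2" using ae by eventually_elim simp
  qed (use h h' in \<open>auto simp: L2_fun_def\<close>)
  thus ?thesis by (simp add: sobolev_norm_def L2_norm_def h'_def)
qed

text \<open>The L^2 function h behind \<open>bessel s f\<close> has a transform H in L^2, and (1 +
  \<xi>^2)^(-s/2) H represents the distributional transform of f. By uniqueness
  \<open>fhat f\<close> equals this function almost everywhere, so its weighted norm is that of H,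
  which the L^2 extension bounds by 2 pi times the square of the Sobolev norm.\<close>

lemma sobolev_fhat:
  assumes f: "f \<in> sobolev s"
  shows "fhat f \<in> borel_measurable borel"
    and "(\<integral>\<^sup>+\<xi>. ennreal ((1 + \<xi>\<^sup>2) powr s * (cmod (fhat f \<xi>))\<^sup>2) \<partial>lborel) \<le> ennreal (2 * pi * (sobolev_norm s f)\<^sup>2)"
proof -
  obtain h where h: "L2_fun h" "represents h (bessel s f)" using f by (auto simp: sobolev_def)
  have [measurable]: "h \<in> borel_measurable borel" and h2: "integrable lborel (\<lambda>x. (cmod (h x))\<^sup>2)"
    using h by (auto simp: L2_fun_def)
  obtain H where [measurable]: "H \<in> borel_measurable borel" and
    H2: "(\<integral>\<^sup>+x. ennreal ((cmod (H x))\<^sup>2) \<partial>lborel) \<le> ennreal (2 * pi) * (\<integral>\<^sup>+x. ennreal ((cmod (h x))\<^sup>2) \<partial>lborel)" and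
    H: "\<And>\<phi>. \<phi> \<in> schwartz \<Longrightarrow> (LINT x|lborel. h x * FT (-1) \<phi> x) = (LINT x|lborel. H x * \<phi> x)"
    using L2_fourier_extension[of h "-1"] h2 by auto
  have hn: "(\<integral>\<^sup>+x. ennreal ((cmod (h x))\<^sup>2) \<partial>lborel) = ennreal ((sobolev_norm s f)\<^sup>2)"
    unfolding sobolev_norm_eq[OF h] nn_integral_L2_eq[OF h2] by (simp add: L2_norm_def)
  have H2': "(\<integral>\<^sup>+x. ennreal ((cmod (H x))\<^sup>2) \<partial>lborel) \<le> ennreal (2 * pi * (sobolev_norm s f)\<^sup>2)"
    using H2 unfolding hn by (simp add: ennreal_mult)
  have Hi: "integrable lborel (\<lambda>x. (cmod (H x))\<^sup>2)"
    by (rule integrable_L2I) (use le_less_trans[OF H2'] in auto)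
  define g where "g = (\<lambda>\<xi>. japanese (- (s / 2)) \<xi> * H \<xi>)"
  have g: "represents g (fourier_dist f)"
    unfolding represents_def
  proof (intro conjI ballI)
    show "g \<in> borel_measurable borel" unfolding g_def by measurable
    fix \<phi> assume \<phi>: "\<phi> \<in> schwartz"
    \<comment> \<open>The weight is moved onto the test function. Applied to the transform of
      \<open>\<phi>'\<close>, the functional \<open>bessel s f\<close> multiplies by the inverse
      weight and gives back \<open>f (fourier \<phi>)\<close>.\<close>
    define \<phi>' where "\<phi>' = (\<lambda>\<xi>. japanese (- (s / 2)) \<xi> * \<phi> \<xi>)"
    have \<phi>': "\<phi>' \<in> schwartz" unfolding \<phi>'_def by (intro schwartz_intros \<phi>)
    have [measurable]: "\<phi>' \<in> borel_measurable borel" by (rule schwartz_measurable[OF \<phi>'])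
    have g\<phi>: "g x * \<phi> x = H x * \<phi>' x" for x by (simp add: g_def \<phi>'_def mult_ac)
    show "integrable lborel (\<lambda>x. g x * \<phi> x)"
      unfolding g\<phi> by (rule integrable_mult_L2[OF _ _ Hi schwartz_L2[OF \<phi>']]) auto
    have "japanese (s / 2) \<xi> * \<phi>' \<xi> = \<phi> \<xi>" for \<xi>
      by (simp add: \<phi>'_def japanese_mult flip: mult.assoc)
    hence "fourier_dist f \<phi> = bessel s f (fourier \<phi>')"
      by (simp add: bessel_eq inv_fourier_fourier[OF \<phi>'] fourier_dist_def)
    also have "\<dots> = (LINT x|lborel. h x * FT (-1) \<phi>' x)"
      using h(2) schwartz_fourier[OF \<phi>'] by (simp add: represents_def fourier_eq_FT)
    also have "\<dots> = (LINT x|lborel. g x * \<phi> x)" unfolding H[OF \<phi>'] g\<phi> ..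
    finally show "fourier_dist f \<phi> = (LINT x|lborel. g x * \<phi> x)" .
  qed
  have r: "represents (fhat f) (fourier_dist f)" by (rule represents_fhat[OF g])
  thus "fhat f \<in> borel_measurable borel" by (simp add: represents_def)
  have "(\<integral>\<^sup>+\<xi>. ennreal ((1 + \<xi>\<^sup>2) powr s * (cmod (fhat f \<xi>))\<^sup>2) \<partial>lborel) = (\<integral>\<^sup>+\<xi>. ennreal ((cmod (H \<xi>))\<^sup>2) \<partial>lborel)"
  proof (rule nn_integral_cong_AE)
    show "AE \<xi> in lborel. ennreal ((1 + \<xi>\<^sup>2) powr s * (cmod (fhat f \<xi>))\<^sup>2) = ennreal ((cmod (H \<xi>))\<^sup>2)"
      using represents_unique[OF r g]
    proof eventually_elim
      case (elim \<xi>)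
      have "((1 + \<xi>\<^sup>2) powr (- (s / 2)))\<^sup>2 = (1 + \<xi>\<^sup>2) powr (- s)"
        by (simp add: power2_eq_square flip: powr_add)
      hence "(1 + \<xi>\<^sup>2) powr s * (cmod (fhat f \<xi>))\<^sup>2 = (1 + \<xi>\<^sup>2) powr s * ((1 + \<xi>\<^sup>2) powr (- s) * (cmod (H \<xi>))\<^sup>2)"
        by (simp add: elim g_def norm_mult power_mult_distrib)
      also have "\<dots> = (cmod (H \<xi>))\<^sup>2" by (simp add: powr_minus)
      finally show ?case by simp
    qed
  qed
  thus "(\<integral>\<^sup>+\<xi>. ennreal ((1 + \<xi>\<^sup>2) powr s * (cmod (fhat f \<xi>))\<^sup>2) \<partial>lborel) \<le> ennreal (2 * pi * (sobolev_norm s f)\<^sup>2)"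
    using H2' by simp
qed

text \<open>Every bounded compactly supported \<open>g\<close> is the Fourier transform of an element of every Sobolev
  space, namely of the function \<open>inv_fourier g\<close>.\<close>

lemma sobolev_with_fhat:
  assumes g[measurable]: "g \<in> borel_measurable borel" and B: "\<And>\<xi>. cmod (g \<xi>) \<le> B"
    and supp: "\<And>\<xi>. L < \<bar>\<xi>\<bar> \<Longrightarrow> g \<xi> = 0"
  obtains f where "AE \<xi> in lborel. fhat f \<xi> = g \<xi>" "fhat f \<in> borel_measurable borel" "\<And>s. f \<in> sobolev s"
    "\<And>s. ennreal ((sobolev_norm s f)\<^sup>2) \<le> (\<integral>\<^sup>+\<xi>. ennreal ((1 + \<xi>\<^sup>2) powr s * (cmod (g \<xi>))\<^sup>2) \<partial>lborel)"
proof -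
  have B0: "B \<ge> 0" using B[of 0] norm_ge_zero order_trans by blast
  \<comment> \<open>Applied with w = 1, with w a test function and with w a Bessel weight; a
    continuous w is bounded on the compact support of g.\<close>
  have int: "integrable lborel (\<lambda>\<xi>. w \<xi> * g \<xi>)" and int2: "integrable lborel (\<lambda>\<xi>. (cmod (w \<xi> * g \<xi>))\<^sup>2)"
    if w: "continuous_on UNIV w" for w :: "real \<Rightarrow> complex"
  proof -
    have [measurable]: "w \<in> borel_measurable borel" using w by (rule borel_measurable_continuous_onI)
    have "compact (w ` {-L..L})" by (intro compact_continuous_image continuous_on_subset[OF w]) auto
    then obtain W where W: "\<And>\<xi>. \<xi> \<in> {-L..L} \<Longrightarrow> cmod (w \<xi>) \<le> W" using compact_imp_bounded by (force simp: bounded_iff)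
    have bd: "cmod (w \<xi> * g \<xi>) \<le> \<bar>W\<bar> * B * indicator {-L..L} \<xi>" for \<xi>
    proof (cases "\<bar>\<xi>\<bar> \<le> L")
      case True
      hence "cmod (w \<xi>) \<le> W" by (intro W) auto
      thus ?thesis using True B[of \<xi>] by (auto simp: norm_mult indicator_def intro!: mult_mono)
    qed (use supp[of \<xi>] B0 in \<open>auto simp: indicator_def\<close>)
    have ind: "integrable lborel (\<lambda>\<xi>. a * indicat_real {-L..L} \<xi>)" for a
      by (intro integrable_mult_right integrable_real_indicator) (auto simp: emeasure_lborel_Icc_eq)
    show "integrable lborel (\<lambda>\<xi>. w \<xi> * g \<xi>)"
      by (rule Bochner_Integration.integrable_bound[OF ind[of "\<bar>W\<bar> * B"]]) (use bd B0 in \<open>auto simp: indicator_def intro!: AE_I2\<close>)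
    show "integrable lborel (\<lambda>\<xi>. (cmod (w \<xi> * g \<xi>))\<^sup>2)"
    proof (rule Bochner_Integration.integrable_bound[OF ind[of "(\<bar>W\<bar> * B)\<^sup>2"]])
      show "AE \<xi> in lborel. norm ((cmod (w \<xi> * g \<xi>))\<^sup>2) \<le> norm ((\<bar>W\<bar> * B)\<^sup>2 * indicat_real {-L..L} \<xi>)"
      proof (rule AE_I2)
        fix \<xi>
        have "(cmod (w \<xi> * g \<xi>))\<^sup>2 \<le> (\<bar>W\<bar> * B * indicator {-L..L} \<xi>)\<^sup>2" by (intro power_mono bd) auto
        thus "norm ((cmod (w \<xi> * g \<xi>))\<^sup>2) \<le> norm ((\<bar>W\<bar> * B)\<^sup>2 * indicat_real {-L..L} \<xi>)"
          by (auto simp: indicator_def power_mult_distrib)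
      qed
    qed auto
  qed
  have gi: "integrable lborel g" using int[of "\<lambda>_. 1"] by simp
  define F where "F = inv_fourier g"
  have F_eq: "F x = complex_of_real (1 / (2 * pi)) * FT 1 g x" for x unfolding F_def by (rule inv_fourier_eq_FT)
  have [measurable]: "F \<in> borel_measurable borel" unfolding F_eq[abs_def] by measurable
  define FB where "FB = 1 / (2 * pi) * (LINT x|lborel. norm (g x))"
  have FB: "cmod (F x) \<le> FB" for x
    unfolding F_eq FB_def norm_mult norm_of_real by (intro mult_mono norm_FT_le gi) auto
  have FB0: "FB \<ge> 0" using FB[of 0] norm_ge_zero order_trans by blast
  define f where "f = (\<lambda>\<phi>. LINT x|lborel. F x * \<phi> x)"
  have Fi: "integrable lborel (\<lambda>x. F x * \<phi> x)" if "\<phi> \<in> schwartz" for \<phi>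
  proof -
    have [measurable]: "\<phi> \<in> borel_measurable borel" by (rule schwartz_measurable[OF that])
    show ?thesis
    proof (rule Bochner_Integration.integrable_bound)
      show "integrable lborel (\<lambda>x. FB * norm (\<phi> x))" using schwartz_integrable[OF that] by simp
      show "AE x in lborel. norm (F x * \<phi> x) \<le> norm (FB * norm (\<phi> x))"
        using FB FB0 by (intro AE_I2) (simp add: norm_mult mult_right_mono)
    qed auto
  qed
  have f_FT: "f (fourier \<phi>) = (LINT x|lborel. g x * \<phi> x)" if "\<phi> \<in> schwartz" for \<phi>
  proof -
    have "f (fourier \<phi>) = (LINT x|lborel. complex_of_real (1 / (2 * pi)) * (FT 1 g x * FT (-1) \<phi> x))"
      unfolding f_def F_eq fourier_eq_FT by (simp add: mult.assoc)
    also have "\<dots> = complex_of_real (1 / (2 * pi)) * (LINT x|lborel. FT 1 g x * FT (-1) \<phi> x)"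
      by (rule integral_mult_right_zero)
    also have "(LINT x|lborel. FT 1 g x * FT (-1) \<phi> x) = (LINT x|lborel. g x * FT 1 (FT (-1) \<phi>) x)"
      by (rule FT_multiplication_formula[symmetric, OF gi schwartz_integrable[OF schwartz_FT[OF that]]]) simp
    also have "\<dots> = (LINT x|lborel. complex_of_real (2 * pi) * (g x * \<phi> x))"
      using FT_inversion[OF that, of "-1"] by (simp add: mult_ac)
    also have "\<dots> = complex_of_real (2 * pi) * (LINT x|lborel. g x * \<phi> x)" by (rule integral_mult_right_zero)
    finally show ?thesis by simp
  qed
  have tempered: "tempered f"
    unfolding tempered_def
  proof (intro conjI ballI allI)
    fix \<phi> \<psi> assume "\<phi> \<in> schwartz" "\<psi> \<in> schwartz"
    thus "f (\<lambda>x. \<phi> x + \<psi> x) = f \<phi> + f \<psi>" unfolding f_def by (simp add: distrib_left Fi)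
  next
    fix \<phi> and a :: complex
    show "f (\<lambda>x. a * \<phi> x) = a * f \<phi>" unfolding f_def by (simp add: mult.left_commute[of _ a])
  next
    define I where "I = (LINT x|lborel. 1 / (1 + (x::real)\<^sup>2))"
    have I0: "I \<ge> 0" unfolding I_def by (intro integral_nonneg_AE) auto
    \<comment> \<open>Two seminorms control |\<phi>| (1 + x^2), and 1 / (1 + x^2) is integrable
      while F is bounded. Both occur in the double sum with K = 2.\<close>
    have "norm (f \<phi>) \<le> (FB * I) * (\<Sum>n\<le>2. \<Sum>k\<le>2. schwartz_seminorm n k \<phi>)" if \<phi>: "\<phi> \<in> schwartz" for \<phi>
    proof -
      have bdd: "bdd_above (range (\<lambda>x. norm (x ^ n *\<^sub>R (vderiv ^^ k) \<phi> x)))" for n k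
        using \<phi> unfolding schwartz_def bounded_iff bdd_above_def by fastforce
      have sn: "norm (x ^ n *\<^sub>R (vderiv ^^ k) \<phi> x) \<le> schwartz_seminorm n k \<phi>" for n k x
        unfolding schwartz_seminorm_def by (rule cSUP_upper[OF _ bdd]) auto
      have sn0: "0 \<le> schwartz_seminorm n k \<phi>" for n k using sn[of 0 n k] norm_ge_zero order_trans by blast
      define S where "S = schwartz_seminorm 0 0 \<phi> + schwartz_seminorm 2 0 \<phi>"
      have S: "norm (\<phi> x) \<le> S * (1 / (1 + x\<^sup>2))" for x
      proof -
        have "norm (\<phi> x) * (1 + x\<^sup>2) \<le> S" using sn[of x 0 0] sn[of x 2 0] by (simp add: S_def algebra_simps)
        thus ?thesis by (simp add: field_simps)
      qed
      have "norm (f \<phi>) \<le> (LINT x|lborel. (FB * S) * (1 / (1 + x\<^sup>2)))"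
        unfolding f_def
      proof (rule norm_integral_le_integral[OF Fi[OF \<phi>]])
        show "integrable lborel (\<lambda>x. (FB * S) * (1 / (1 + x\<^sup>2)))" by (intro integrable_mult_right integrable_1_div_1_plus_square)
        fix x
        have "norm (F x) * norm (\<phi> x) \<le> FB * (S * (1 / (1 + x\<^sup>2)))" by (intro mult_mono FB S FB0) auto
        thus "norm (F x * \<phi> x) \<le> (FB * S) * (1 / (1 + x\<^sup>2))" by (simp add: norm_mult)
      qed
      also have "\<dots> = (FB * I) * S" unfolding I_def integral_mult_right_zero by (simp add: mult_ac)
      also have "\<dots> \<le> (FB * I) * (\<Sum>n\<le>2. \<Sum>k\<le>2. schwartz_seminorm n k \<phi>)"
      proof (intro mult_left_mono)
        show "S \<le> (\<Sum>n\<le>2. \<Sum>k\<le>2. schwartz_seminorm n k \<phi>)"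
          using sn0 by (simp add: S_def numeral_2_eq_2 add_increasing add_increasing2 add_mono)
      qed (use FB0 I0 in auto)
      finally show ?thesis .
    qed
    thus "\<exists>C K. \<forall>\<phi>\<in>schwartz. norm (f \<phi>) \<le> C * (\<Sum>n\<le>K. \<Sum>k\<le>K. schwartz_seminorm n k \<phi>)" by blast
  qed
  have rep: "represents g (fourier_dist f)"
    unfolding represents_def
  proof (intro conjI ballI)
    fix \<phi> assume \<phi>: "\<phi> \<in> schwartz"
    show "fourier_dist f \<phi> = (LINT x|lborel. g x * \<phi> x)" using f_FT[OF \<phi>] by (simp add: fourier_dist_def)
    have "continuous_on UNIV \<phi>" using schwartz_isCont[OF \<phi>] by (simp add: continuous_at_imp_continuous_on)
    from int[OF this] show "integrable lborel (\<lambda>x. g x * \<phi> x)" by (simp add: mult.commute)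
  qed (rule g)
  have rep': "represents (fhat f) (fourier_dist f)" by (rule represents_fhat[OF rep])
  have sob: "f \<in> sobolev s \<and> ennreal ((sobolev_norm s f)\<^sup>2) \<le> (\<integral>\<^sup>+\<xi>. ennreal ((1 + \<xi>\<^sup>2) powr s * (cmod (g \<xi>))\<^sup>2) \<partial>lborel)" for s
  proof -
    define w where "w = (\<lambda>\<xi>. japanese (s / 2) \<xi> * g \<xi>)"
    have [measurable]: "w \<in> borel_measurable borel" unfolding w_def by measurable
    have jc: "continuous_on UNIV (japanese (s / 2))"
      unfolding japanese_def[abs_def] by (intro continuous_intros) auto
    have wi: "integrable lborel w" and w2: "integrable lborel (\<lambda>\<xi>. (cmod (w \<xi>))\<^sup>2)"
      unfolding w_def by (rule int[OF jc], rule int2[OF jc])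
    define h where "h = (\<lambda>x. complex_of_real (1 / (2 * pi)) * FT 1 w x)"
    have [measurable]: "h \<in> borel_measurable borel" unfolding h_def by measurable
    have wn: "(\<integral>\<^sup>+\<xi>. ennreal ((cmod (w \<xi>))\<^sup>2) \<partial>lborel) = (\<integral>\<^sup>+\<xi>. ennreal ((1 + \<xi>\<^sup>2) powr s * (cmod (g \<xi>))\<^sup>2) \<partial>lborel)"
    proof (intro nn_integral_cong)
      fix \<xi>
      have "((1 + \<xi>\<^sup>2) powr (s / 2))\<^sup>2 = (1 + \<xi>\<^sup>2) powr s" by (simp add: power2_eq_square flip: powr_add)
      thus "ennreal ((cmod (w \<xi>))\<^sup>2) = ennreal ((1 + \<xi>\<^sup>2) powr s * (cmod (g \<xi>))\<^sup>2)"
        by (simp add: w_def norm_mult power_mult_distrib)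
    qed
    have "(\<integral>\<^sup>+x. ennreal ((cmod (h x))\<^sup>2) \<partial>lborel) = ennreal ((1 / (2 * pi))\<^sup>2) * (\<integral>\<^sup>+x. ennreal ((cmod (FT 1 w x))\<^sup>2) \<partial>lborel)"
      unfolding h_def norm_mult norm_of_real power_mult_distrib
      by (subst nn_integral_cmult[symmetric]) (auto simp: ennreal_mult)
    also have "\<dots> \<le> ennreal ((1 / (2 * pi))\<^sup>2) * (ennreal (2 * pi) * (\<integral>\<^sup>+x. ennreal ((cmod (w x))\<^sup>2) \<partial>lborel))"
      by (intro mult_left_mono FT_plancherel_le wi) auto
    also have "\<dots> = ennreal (1 / (2 * pi)) * (\<integral>\<^sup>+x. ennreal ((cmod (w x))\<^sup>2) \<partial>lborel)"
      unfolding mult.assoc[symmetric] by (subst ennreal_mult[symmetric]) (auto simp: power2_eq_square)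
    \<comment> \<open>The normalisation contributes (1 / (2 pi))^2 and the Plancherel bound 2 pi;
      the remaining 1 / (2 pi) is at most 1 and is dropped.\<close>
    also have "\<dots> \<le> 1 * (\<integral>\<^sup>+x. ennreal ((cmod (w x))\<^sup>2) \<partial>lborel)"
    proof (intro mult_right_mono)
      have "1 / (2 * pi) \<le> 1" using pi_gt3 by simp
      thus "ennreal (1 / (2 * pi)) \<le> 1" using ennreal_leI by fastforce
    qed auto
    finally have hw: "(\<integral>\<^sup>+x. ennreal ((cmod (h x))\<^sup>2) \<partial>lborel) \<le> (\<integral>\<^sup>+x. ennreal ((cmod (w x))\<^sup>2) \<partial>lborel)" by simp
    have h2: "integrable lborel (\<lambda>x. (cmod (h x))\<^sup>2)"
      by (rule integrable_L2I) (use le_less_trans[OF hw] nn_integral_L2_eq[OF w2] in auto)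
    have L2: "L2_fun h" using h2 by (simp add: L2_fun_def)
    have hrep: "represents h (bessel s f)"
      unfolding represents_def
    proof (intro conjI ballI)
      fix \<phi> assume \<phi>: "\<phi> \<in> schwartz"
      have [measurable]: "\<phi> \<in> borel_measurable borel" by (rule schwartz_measurable[OF \<phi>])
      show "integrable lborel (\<lambda>x. h x * \<phi> x)" by (rule integrable_mult_L2[OF _ _ h2 schwartz_L2[OF \<phi>]]) auto
      have "bessel s f \<phi> = (LINT x|lborel. g x * (japanese (s / 2) x * inv_fourier \<phi> x))"
        unfolding bessel_eq by (intro f_FT schwartz_intros schwartz_inv_fourier \<phi>)
      also have "\<dots> = (LINT x|lborel. complex_of_real (1 / (2 * pi)) * (w x * FT 1 \<phi> x))"
        unfolding w_def inv_fourier_eq_FT by (simp only: mult_ac)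
      also have "\<dots> = complex_of_real (1 / (2 * pi)) * (LINT x|lborel. w x * FT 1 \<phi> x)"
        by (rule integral_mult_right_zero)
      also have "(LINT x|lborel. w x * FT 1 \<phi> x) = (LINT x|lborel. FT 1 w x * \<phi> x)"
        by (rule FT_multiplication_formula[OF wi schwartz_integrable[OF \<phi>]])
      also have "complex_of_real (1 / (2 * pi)) * \<dots> = (LINT x|lborel. complex_of_real (1 / (2 * pi)) * (FT 1 w x * \<phi> x))"
        by (rule integral_mult_right_zero[symmetric])
      also have "\<dots> = (LINT x|lborel. h x * \<phi> x)" unfolding h_def by (simp only: mult.assoc)
      finally show "bessel s f \<phi> = (LINT x|lborel. h x * \<phi> x)" .
    qed auto
    have "ennreal ((sobolev_norm s f)\<^sup>2) = (\<integral>\<^sup>+x. ennreal ((cmod (h x))\<^sup>2) \<partial>lborel)"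
      unfolding sobolev_norm_eq[OF L2 hrep] nn_integral_L2_eq[OF h2] by (simp add: L2_norm_def)
    with hw wn have "ennreal ((sobolev_norm s f)\<^sup>2) \<le> (\<integral>\<^sup>+\<xi>. ennreal ((1 + \<xi>\<^sup>2) powr s * (cmod (g \<xi>))\<^sup>2) \<partial>lborel)" by simp
    thus ?thesis using tempered L2 hrep by (auto simp: sobolev_def)
  qed
  show thesis
    by (rule that[of f]) (use represents_unique[OF rep' rep] rep' sob in \<open>auto simp: represents_def\<close>)
qed

section \<open>Necessity\<close>

text \<open>The function |g| dominates the damped integrands for all N, so the limit exists at every
  point and time. Test data can therefore be evaluated along the whole curve without exceptional
  points.\<close>

lemma evol_compactly_supported:
  assumes fg: "AE \<xi> in lborel. fhat f \<xi> = g \<xi>" and [measurable]: "fhat f \<in> borel_measurable borel"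
    and g: "integrable lborel g"
  shows "evol m f t x = complex_of_real (1 / (2 * pi)) * (LINT \<xi>|lborel. cis (x * \<xi> + t * \<bar>\<xi>\<bar> powr m) * g \<xi>)" (is "_ = ?v")
proof -
  have [measurable]: "g \<in> borel_measurable borel" using g by auto
  have "((\<lambda>N. LINT \<xi>|lborel. cis (x * \<xi> + t * \<bar>\<xi>\<bar> powr m) * complex_of_real (exp (- (\<bar>\<xi>\<bar>\<^sup>2 / N\<^sup>2))) * fhat f \<xi>) \<longlongrightarrow>
     (LINT \<xi>|lborel. cis (x * \<xi> + t * \<bar>\<xi>\<bar> powr m) * g \<xi>)) at_top"
  proof (rule integral_dominated_convergence_at_top[where w = "\<lambda>\<xi>. norm (g \<xi>)"])
    show "integrable lborel (\<lambda>\<xi>. norm (g \<xi>))" using g by simp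
    show "AE \<xi> in lborel. ((\<lambda>N. cis (x * \<xi> + t * \<bar>\<xi>\<bar> powr m) * complex_of_real (exp (- (\<bar>\<xi>\<bar>\<^sup>2 / N\<^sup>2))) * fhat f \<xi>) \<longlongrightarrow>
        cis (x * \<xi> + t * \<bar>\<xi>\<bar> powr m) * g \<xi>) at_top"
      using fg
    proof eventually_elim
      case (elim \<xi>)
      have "((\<lambda>N::real. exp (- (\<bar>\<xi>\<bar>\<^sup>2 / N\<^sup>2))) \<longlongrightarrow> 1) at_top" by real_asymp
      hence "((\<lambda>N. cis (x * \<xi> + t * \<bar>\<xi>\<bar> powr m) * complex_of_real (exp (- (\<bar>\<xi>\<bar>\<^sup>2 / N\<^sup>2))) * fhat f \<xi>) \<longlongrightarrow>
        cis (x * \<xi> + t * \<bar>\<xi>\<bar> powr m) * complex_of_real 1 * fhat f \<xi>) at_top"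
        by (intro tendsto_mult tendsto_const tendsto_of_real)
      thus ?case by (simp add: elim)
    qed
    show "\<forall>\<^sub>F N in at_top. AE \<xi> in lborel. norm (cis (x * \<xi> + t * \<bar>\<xi>\<bar> powr m) * complex_of_real (exp (- (\<bar>\<xi>\<bar>\<^sup>2 / N\<^sup>2))) * fhat f \<xi>) \<le> norm (g \<xi>)"
    proof (rule always_eventually, rule allI)
      fix N :: real
      show "AE \<xi> in lborel. norm (cis (x * \<xi> + t * \<bar>\<xi>\<bar> powr m) * complex_of_real (exp (- (\<bar>\<xi>\<bar>\<^sup>2 / N\<^sup>2))) * fhat f \<xi>) \<le> norm (g \<xi>)"
        using fg by eventually_elim (simp add: norm_mult mult_left_le_one_le)
    qed
  qed auto
  hence lim: "((\<lambda>N. evol_reg m f N t x) \<longlongrightarrow> ?v) at_top"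
    unfolding evol_reg_def by (intro tendsto_mult tendsto_const)
  hence "evol_defined m f t x" by (auto simp: evol_defined_def)
  moreover have "Lim at_top (\<lambda>N. evol_reg m f N t x) = ?v" by (rule tendsto_Lim[OF _ lim]) simp
  ultimately show ?thesis by (simp add: evol_def)
qed

section \<open>Coherent test data and the scheme common to both counterexamples\<close>

text \<open>A phase within 1/2 of a constant p keeps each value of \<open>cis\<close> within 1/2 of
  cis p, so the integral differs from (b - a) cis p by at most half its modulus.\<close>

lemma norm_integral_almost_constant_phase:
  fixes \<Theta> :: "real \<Rightarrow> real"
  assumes "a \<le> b" and [measurable]: "\<Theta> \<in> borel_measurable borel" and \<Theta>: "\<And>\<xi>. \<xi> \<in> {a..b} \<Longrightarrow> \<bar>\<Theta> \<xi> - p\<bar> \<le> 1/2"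
  shows "(b - a) / 2 \<le> norm (LINT \<xi>|lborel. indicator {a..b} \<xi> *\<^sub>R cis (\<Theta> \<xi>))"
proof -
  have ind: "integrable lborel (\<lambda>\<xi>. indicat_real {a..b} \<xi>)" using assms(1) by (intro integrable_real_indicator) auto
  have I1: "integrable lborel (\<lambda>\<xi>. indicat_real {a..b} \<xi> *\<^sub>R cis (\<Theta> \<xi>))"
    by (rule Bochner_Integration.integrable_bound[OF ind]) auto
  have I2: "integrable lborel (\<lambda>\<xi>. indicat_real {a..b} \<xi> *\<^sub>R cis p)"
    by (rule Bochner_Integration.integrable_bound[OF ind]) auto
  have v2: "(LINT \<xi>|lborel. indicat_real {a..b} \<xi> *\<^sub>R cis p) = (b - a) *\<^sub>R cis p"
    using assms(1) by (subst integral_scaleR_left) (use ind in auto)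
  have "norm ((LINT \<xi>|lborel. indicat_real {a..b} \<xi> *\<^sub>R cis (\<Theta> \<xi>)) - (b - a) *\<^sub>R cis p)
      = norm (LINT \<xi>|lborel. indicat_real {a..b} \<xi> *\<^sub>R cis (\<Theta> \<xi>) - indicat_real {a..b} \<xi> *\<^sub>R cis p)"
    unfolding v2[symmetric] using I1 I2 by (subst Bochner_Integration.integral_diff) auto
  also have "\<dots> \<le> (LINT \<xi>|lborel. indicat_real {a..b} \<xi> * (1/2))"
  proof (rule norm_integral_le_integral)
    fix \<xi>
    show "norm (indicat_real {a..b} \<xi> *\<^sub>R cis (\<Theta> \<xi>) - indicat_real {a..b} \<xi> *\<^sub>R cis p) \<le> indicat_real {a..b} \<xi> * (1/2)"
      using \<Theta>[of \<xi>] norm_cis_diff_le[of "\<Theta> \<xi>" p] by (auto simp: indicator_def)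
  qed (use I1 I2 ind in auto)
  also have "\<dots> = (b - a) / 2" using assms(1) by simp
  finally have "norm ((LINT \<xi>|lborel. indicat_real {a..b} \<xi> *\<^sub>R cis (\<Theta> \<xi>)) - (b - a) *\<^sub>R cis p) \<le> (b - a) / 2" .
  moreover have "norm ((b - a) *\<^sub>R cis p) = b - a" using assms(1) by simp
  ultimately show ?thesis
    using norm_triangle_ineq2[of "(b - a) *\<^sub>R cis p" "LINT \<xi>|lborel. indicat_real {a..b} \<xi> *\<^sub>R cis (\<Theta> \<xi>)"]
    by (simp add: norm_minus_commute)
qed

text \<open>The transform of f is unimodular on [R, b] with phase -\<psi>, where \<psi> is the phase
  that the evolution should cancel. Where the phases align up to 1/2, half of the length b - R
  survives, and the factor 1 / (2 pi) turns this into (b - R) / (4 pi).\<close>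

lemma sobolev_test_function:
  fixes \<psi> :: "real \<Rightarrow> real"
  assumes R: "1 \<le> R" and b: "R \<le> b" "b \<le> 2 * R" and [measurable]: "\<psi> \<in> borel_measurable borel"
  obtains f where "\<And>s. f \<in> sobolev s" "\<And>s. sobolev_norm s f \<le> 5 powr (\<bar>s\<bar> / 2) * R powr s * sqrt (b - R)"
    "\<And>x t m p. (\<And>\<xi>. \<xi> \<in> {R..b} \<Longrightarrow> \<bar>x * \<xi> + t * \<xi> powr m - \<psi> \<xi> - p\<bar> \<le> 1/2) \<Longrightarrow> (b - R) / (4 * pi) \<le> cmod (evol m f t x)"
proof -
  define g where "g = (\<lambda>\<xi>. indicator {R..b} \<xi> *\<^sub>R cis (- \<psi> \<xi>))"
  have [measurable]: "g \<in> borel_measurable borel" unfolding g_def by measurable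
  have ind: "integrable lborel (\<lambda>\<xi>. indicat_real {R..b} \<xi>)" using b by (intro integrable_real_indicator) auto
  have gi: "integrable lborel g"
    by (rule Bochner_Integration.integrable_bound[OF ind]) (auto simp: g_def)
  obtain f where f: "AE \<xi> in lborel. fhat f \<xi> = g \<xi>" "fhat f \<in> borel_measurable borel" "\<And>s. f \<in> sobolev s"
    "\<And>s. ennreal ((sobolev_norm s f)\<^sup>2) \<le> (\<integral>\<^sup>+\<xi>. ennreal ((1 + \<xi>\<^sup>2) powr s * (cmod (g \<xi>))\<^sup>2) \<partial>lborel)"
  proof (rule sobolev_with_fhat[of g 1 b])
    show "g \<xi> = 0" if "b < \<bar>\<xi>\<bar>" for \<xi> using that R b by (auto simp: g_def indicator_def)
    show "cmod (g \<xi>) \<le> 1" for \<xi> by (auto simp: g_def indicator_def)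
  qed auto
  show thesis
  proof (rule that)
    show "f \<in> sobolev s" for s by (rule f(3))
    show "sobolev_norm s f \<le> 5 powr (\<bar>s\<bar> / 2) * R powr s * sqrt (b - R)" for s
    proof -
      \<comment> \<open>On the support 1 + \<xi>^2 lies between R^2 and 5 R^2; the exponent |s|
        covers positive and negative s together.\<close>
      define W where "W = 5 powr \<bar>s\<bar> * R powr (2 * s)"
      have W: "(1 + \<xi>\<^sup>2) powr s \<le> W" if "\<xi> \<in> {R..b}" for \<xi>
      proof -
        define z where "z = (1 + \<xi>\<^sup>2) / R\<^sup>2"
        have r: "R\<^sup>2 \<le> \<xi>\<^sup>2" "\<xi>\<^sup>2 \<le> (2 * R)\<^sup>2" "1 \<le> R\<^sup>2"
          by (rule power_mono; use that R b in simp)+ (use R in \<open>simp add: one_le_power\<close>)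
        have "(2 * R)\<^sup>2 = 4 * R\<^sup>2" by (simp add: power_mult_distrib)
        hence "R\<^sup>2 \<le> 1 + \<xi>\<^sup>2" "1 + \<xi>\<^sup>2 \<le> 5 * R\<^sup>2" using r by linarith+
        hence z: "1 \<le> z" "z \<le> 5" using R by (simp_all add: z_def divide_le_eq)
        have "1 + \<xi>\<^sup>2 = z * R\<^sup>2" using R by (simp add: z_def)
        hence "(1 + \<xi>\<^sup>2) powr s = z powr s * (R\<^sup>2) powr s" using z by (simp add: powr_mult)
        also have "(R\<^sup>2) powr s = R powr (2 * s)" using R by (simp add: powr_powr flip: powr_numeral)
        also have "z powr s \<le> z powr \<bar>s\<bar>" using z by (intro powr_mono) auto
        also have "z powr \<bar>s\<bar> \<le> 5 powr \<bar>s\<bar>" using z by (intro powr_mono2) auto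
        finally show ?thesis by (simp add: W_def mult_right_mono)
      qed
      have "ennreal ((sobolev_norm s f)\<^sup>2) \<le> (\<integral>\<^sup>+\<xi>. ennreal W * indicator {R..b} \<xi> \<partial>lborel)"
      proof (rule order_trans[OF f(4)[of s]], intro nn_integral_mono)
        fix \<xi>
        show "ennreal ((1 + \<xi>\<^sup>2) powr s * (cmod (g \<xi>))\<^sup>2) \<le> ennreal W * indicator {R..b} \<xi>"
          using W[of \<xi>] by (auto simp: g_def indicator_def intro!: ennreal_leI)
      qed
      also have "\<dots> = ennreal (W * (b - R))"
        using b by (simp add: nn_integral_cmult_indicator ennreal_mult W_def)
      finally have "(sobolev_norm s f)\<^sup>2 \<le> W * (b - R)" using b by (simp add: ennreal_le_iff W_def)
      hence "sobolev_norm s f \<le> sqrt (W * (b - R))" by (rule real_le_rsqrt)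
      also have "\<dots> = sqrt (5 powr \<bar>s\<bar>) * sqrt (R powr (2 * s)) * sqrt (b - R)" by (simp add: W_def real_sqrt_mult)
      also have "sqrt (5 powr \<bar>s\<bar>) = 5 powr (\<bar>s\<bar> / 2)" by (simp add: powr_half_sqrt[symmetric] powr_powr)
      also have "sqrt (R powr (2 * s)) = R powr s" by (simp add: powr_half_sqrt[symmetric] powr_powr)
      finally show ?thesis .
    qed
    fix x t m p :: real
    assume *: "\<And>\<xi>. \<xi> \<in> {R..b} \<Longrightarrow> \<bar>x * \<xi> + t * \<xi> powr m - \<psi> \<xi> - p\<bar> \<le> 1/2"
    have "(b - R) / 2 \<le> norm (LINT \<xi>|lborel. indicator {R..b} \<xi> *\<^sub>R cis (x * \<xi> + t * \<bar>\<xi>\<bar> powr m - \<psi> \<xi>))"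
      by (rule norm_integral_almost_constant_phase[where p = p]) (use b R * in auto)
    also have "(\<lambda>\<xi>. indicator {R..b} \<xi> *\<^sub>R cis (x * \<xi> + t * \<bar>\<xi>\<bar> powr m - \<psi> \<xi>)) = (\<lambda>\<xi>. cis (x * \<xi> + t * \<bar>\<xi>\<bar> powr m) * g \<xi>)"
      by (auto simp: fun_eq_iff g_def cis_mult indicator_def)
    finally have "(b - R) / 2 \<le> norm (LINT \<xi>|lborel. cis (x * \<xi> + t * \<bar>\<xi>\<bar> powr m) * g \<xi>)" .
    hence "1 / (2 * pi) * ((b - R) / 2) \<le> 1 / (2 * pi) * norm (LINT \<xi>|lborel. cis (x * \<xi> + t * \<bar>\<xi>\<bar> powr m) * g \<xi>)"
      by (intro mult_left_mono) auto
    thus "(b - R) / (4 * pi) \<le> cmod (evol m f t x)"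
      unfolding evol_compactly_supported[OF f(1,2) gi] norm_mult norm_of_real by simp
  qed
qed

lemma mixed_norm_ge:
  assumes q: "0 < q" and E: "E \<in> sets \<mu>" "E \<subseteq> {0<..<1}" "emeasure \<mu> E = ennreal M" and M: "0 \<le> M" and L: "0 \<le> L"
    and F: "\<And>x. x \<in> E \<Longrightarrow> \<exists>t\<in>{0<..<1}. L \<le> cmod (F x t)"
  shows "ennreal (L * M powr (1/q)) \<le> mixed_norm q \<mu> F"
proof -
  define J where "J = (\<integral>\<^sup>+x\<in>{0<..<1}. (SUP t\<in>{0<..<1}. ennreal (cmod (F x t) powr q)) \<partial>\<mu>)"
  have "ennreal (L powr q * M) = (\<integral>\<^sup>+x. ennreal (L powr q) * indicator E x \<partial>\<mu>)"
    using E M by (simp add: nn_integral_cmult_indicator ennreal_mult)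
  also have "\<dots> \<le> J"
    unfolding J_def
  proof (intro nn_integral_mono)
    fix x
    show "ennreal (L powr q) * indicator E x \<le> (SUP t\<in>{0<..<1}. ennreal (cmod (F x t) powr q)) * indicator {0<..<1} x"
    proof (cases "x \<in> E")
      case True
      obtain t where t: "t \<in> {0<..<1}" "L \<le> cmod (F x t)" using F[OF True] by auto
      have "ennreal (L powr q) \<le> ennreal (cmod (F x t) powr q)" using t L q by (intro ennreal_leI powr_mono2) auto
      also have "\<dots> \<le> (SUP t\<in>{0<..<1}. ennreal (cmod (F x t) powr q))" using t by (intro SUP_upper) auto
      finally show ?thesis using True E(2) by auto
    qed auto
  qed
  finally have J: "ennreal (L powr q * M) \<le> J" .
  show ?thesis
  proof (cases "J = \<infinity>")
    case False
    have "L powr q * M \<le> enn2real J" using J False M by (metis enn2real_ennreal enn2real_mono infinity_ennreal_def less_top mult_nonneg_nonneg powr_ge_zero)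
    hence "(L powr q * M) powr (1/q) \<le> enn2real J powr (1/q)" using M q by (intro powr_mono2) auto
    moreover have "(L powr q * M) powr (1/q) = L * M powr (1/q)" using M L q by (simp add: powr_mult powr_powr)
    ultimately have "ennreal (L * M powr (1/q)) \<le> ennreal (enn2real J powr (1/q))" by (simp add: ennreal_leI)
    thus ?thesis using False by (simp add: mixed_norm_def ennreal_powr_def J_def[symmetric])
  qed (simp add: mixed_norm_def ennreal_powr_def J_def[symmetric])
qed

lemma powr_growth_contradiction:
  fixes a s K :: real
  assumes "s < a" and "\<forall>\<^sub>F R in at_top. R powr a \<le> K * R powr s"
  shows False
proof -
  have "filterlim (\<lambda>R::real. R powr (a - s)) at_top at_top" using assms(1) by real_asymp
  hence "\<forall>\<^sub>F R in at_top. K < R powr (a - s)" by (simp add: filterlim_at_top_dense)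
  hence "\<forall>\<^sub>F R::real in at_top. False"
    using assms(2) eventually_gt_at_top[of 0]
  proof eventually_elim
    case (elim R)
    have "K * R powr s < R powr (a - s) * R powr s" using elim by (intro mult_strict_right_mono) auto
    thus ?case using elim by (simp flip: powr_add)
  qed
  thus False by simp
qed

text \<open>Both counterexamples are of this type: a frequency window of width R^\<beta> above R,
  and a set of mass R^(-\<sigma>) on which the solution attains its full size. The estimate would
  give R^(\<beta> - \<sigma>/q) \<le> K R^(s + \<beta>/2) for all large R, hence s \<ge> \<beta>/2 -
  \<sigma>/q. Focusing uses \<beta> = 1 and \<sigma> = m \<alpha>; the wave packet uses \<beta> = 1
  - m/2 and \<sigma> = 0.\<close>

lemma maximal_estimate_fails:
  fixes \<gamma> :: "real \<Rightarrow> real \<Rightarrow> real" and b \<delta> :: "real \<Rightarrow> real" and \<psi> :: "real \<Rightarrow> real"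
  assumes q: "0 < q" and sets: "sets \<mu> = sets borel" and c: "0 < c1" "0 < c2" and s: "s < \<beta> / 2 - \<sigma> / q"
    and b: "\<forall>\<^sub>F R in at_top. b R = R + c1 * R powr \<beta> \<and> b R \<le> 2 * R"
    and \<delta>: "\<forall>\<^sub>F R in at_top. \<delta> R \<le> 1 \<and> emeasure \<mu> {0<..<\<delta> R} = ennreal (c2 * R powr (- \<sigma>))"
    and [measurable]: "\<psi> \<in> borel_measurable borel"
    and t: "\<forall>\<^sub>F R in at_top. \<forall>x\<in>{0<..<\<delta> R}. \<exists>t\<in>{0<..<1}. \<exists>p. \<forall>\<xi>\<in>{R..b R}. \<bar>\<gamma> x t * \<xi> + t * \<xi> powr m - \<psi> \<xi> - p\<bar> \<le> 1/2"
  shows "\<not> (\<exists>C::real. \<forall>f\<in>sobolev s. mixed_norm q \<mu> (\<lambda>x t. evol m f t (\<gamma> x t)) \<le> ennreal (C * sobolev_norm s f))"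
proof
  assume "\<exists>C::real. \<forall>f\<in>sobolev s. mixed_norm q \<mu> (\<lambda>x t. evol m f t (\<gamma> x t)) \<le> ennreal (C * sobolev_norm s f)"
  then obtain C where C: "\<And>f. f \<in> sobolev s \<Longrightarrow> mixed_norm q \<mu> (\<lambda>x t. evol m f t (\<gamma> x t)) \<le> ennreal (C * sobolev_norm s f)" by blast
  define K where "K = \<bar>C\<bar> * 5 powr (\<bar>s\<bar> / 2) * (4 * pi) / (sqrt c1 * c2 powr (1/q))"
  have "\<forall>\<^sub>F R in at_top. R powr (\<beta> / 2 - \<sigma> / q) \<le> K * R powr s"
    using b \<delta> t eventually_ge_at_top[of 1]
  proof eventually_elim
    case (elim R)
    hence R: "1 \<le> R" and b: "b R = R + c1 * R powr \<beta>" "b R \<le> 2 * R" and \<delta>: "\<delta> R \<le> 1" "emeasure \<mu> {0<..<\<delta> R} = ennreal (c2 * R powr (- \<sigma>))"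
      by auto
    have w: "b R - R = c1 * R powr \<beta>" "b R \<ge> R" using b c by auto
    obtain f where f: "f \<in> sobolev s" "sobolev_norm s f \<le> 5 powr (\<bar>s\<bar> / 2) * R powr s * sqrt (b R - R)"
      "\<And>x t m p. (\<And>\<xi>. \<xi> \<in> {R..b R} \<Longrightarrow> \<bar>x * \<xi> + t * \<xi> powr m - \<psi> \<xi> - p\<bar> \<le> 1/2) \<Longrightarrow> (b R - R) / (4 * pi) \<le> cmod (evol m f t x)"
      using sobolev_test_function[OF R w(2) b(2), of \<psi>] by (auto, metis)
    have "ennreal ((b R - R) / (4 * pi) * (c2 * R powr (- \<sigma>)) powr (1/q)) \<le> mixed_norm q \<mu> (\<lambda>x t. evol m f t (\<gamma> x t))"
    proof (rule mixed_norm_ge[OF q])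
      show "{0<..<\<delta> R} \<in> sets \<mu>" unfolding sets by simp
      show "\<exists>t\<in>{0<..<1}. (b R - R) / (4 * pi) \<le> cmod (evol m f t (\<gamma> x t))" if "x \<in> {0<..<\<delta> R}" for x
        using elim(3) that f(3) by meson
    qed (use \<delta> c w in auto)
    also have "\<dots> \<le> ennreal (C * sobolev_norm s f)" by (rule C[OF f(1)])
    also have "\<dots> \<le> ennreal (\<bar>C\<bar> * (5 powr (\<bar>s\<bar> / 2) * R powr s * sqrt (b R - R)))"
    proof (rule ennreal_leI)
      have "0 \<le> sobolev_norm s f" by (simp add: sobolev_norm_def L2_norm_def)
      hence "C * sobolev_norm s f \<le> \<bar>C\<bar> * sobolev_norm s f" by (intro mult_right_mono) auto
      also have "\<dots> \<le> \<bar>C\<bar> * (5 powr (\<bar>s\<bar> / 2) * R powr s * sqrt (b R - R))" using f(2) by (intro mult_left_mono) auto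
      finally show "C * sobolev_norm s f \<le> \<bar>C\<bar> * (5 powr (\<bar>s\<bar> / 2) * R powr s * sqrt (b R - R))" .
    qed
    finally have main: "(b R - R) / (4 * pi) * (c2 * R powr (- \<sigma>)) powr (1/q) \<le> \<bar>C\<bar> * (5 powr (\<bar>s\<bar> / 2) * R powr s * sqrt (b R - R))"
      using w by (subst (asm) ennreal_le_iff) auto
    \<comment> \<open>The width of the window enters the lower bound to the first power and the norm
      of the data under a square root; cancelling one factor S leaves R^(\<beta>/2).\<close>
    define S where "S = sqrt (b R - R)"
    have SS: "b R - R = S * S" using w by (simp add: S_def)
    have "S * (S / (4 * pi) * (c2 * R powr (- \<sigma>)) powr (1/q)) \<le> S * (\<bar>C\<bar> * (5 powr (\<bar>s\<bar> / 2) * R powr s))"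
      using main unfolding S_def[symmetric] unfolding SS by (simp add: mult_ac)
    moreover have "S > 0" using w c R by (simp add: S_def)
    ultimately have "S / (4 * pi) * (c2 * R powr (- \<sigma>)) powr (1/q) \<le> \<bar>C\<bar> * (5 powr (\<bar>s\<bar> / 2) * R powr s)"
      by (simp only: mult_le_cancel_left_pos)
    moreover have "S = sqrt c1 * R powr (\<beta> / 2)"
      unfolding S_def w(1) by (simp add: real_sqrt_mult powr_half_sqrt[symmetric] powr_powr)
    moreover have "(c2 * R powr (- \<sigma>)) powr (1/q) = c2 powr (1/q) * R powr (- \<sigma> / q)"
      using c by (simp add: powr_mult powr_powr)
    moreover have "R powr (\<beta> / 2 - \<sigma> / q) = R powr (\<beta> / 2) * R powr (- \<sigma> / q)" by (simp flip: powr_add)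
    ultimately show ?case using c by (simp add: K_def field_simps)
  qed
  thus False by (rule powr_growth_contradiction[OF s])
qed

section \<open>Test measures\<close>

lemma fractal_measure_density:
  fixes w :: "real \<Rightarrow> real"
  assumes [measurable]: "w \<in> borel_measurable borel" and w: "\<And>x. x \<notin> {0<..<1} \<Longrightarrow> w x = 0"
    and C: "0 \<le> C" "\<And>x r. 0 < r \<Longrightarrow> (\<integral>\<^sup>+y. ennreal (w y) * indicator (ball x r) y \<partial>lborel) \<le> ennreal (C * r powr \<alpha>)"
  shows "density lborel (\<lambda>x. ennreal (w x)) \<in> fractal_measures \<alpha>"
proof -
  let ?\<mu> = "density lborel (\<lambda>x. ennreal (w x))"
  have "(SUP (x, r)\<in>UNIV \<times> {0<..}. emeasure ?\<mu> (ball x r) / ennreal (r powr \<alpha>)) \<le> ennreal C"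
  proof (intro SUP_least)
    fix p :: "real \<times> real" assume "p \<in> UNIV \<times> {0<..}"
    then obtain x r where p: "p = (x, r)" "0 < r" by auto
    have "emeasure ?\<mu> (ball x r) / ennreal (r powr \<alpha>) \<le> ennreal (C * r powr \<alpha>) / ennreal (r powr \<alpha>)"
      by (intro divide_right_mono_ennreal) (use C(2)[OF p(2), of x] in \<open>simp add: emeasure_density\<close>)
    also have "\<dots> = ennreal C" using p C(1) by (simp add: divide_ennreal)
    finally show "(case p of (x, r) \<Rightarrow> emeasure ?\<mu> (ball x r) / ennreal (r powr \<alpha>)) \<le> ennreal C" by (simp add: p)
  qed
  hence "alpha_dimensional \<alpha> ?\<mu>" unfolding alpha_dimensional_def by (rule le_less_trans) simp
  moreover have "emeasure ?\<mu> (- ball 0 1) = 0"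
  proof -
    have "emeasure ?\<mu> (- ball 0 1) = (\<integral>\<^sup>+y. ennreal (w y) * indicator (- ball 0 1) y \<partial>lborel)"
      by (simp add: emeasure_density)
    also have "\<dots> = (\<integral>\<^sup>+y. 0 \<partial>(lborel :: real measure))"
    proof (intro nn_integral_cong)
      fix y :: real
      show "ennreal (w y) * indicator (- ball 0 1) y = 0"
        using w[of y] by (cases "y \<in> {0<..<1}") (auto simp: indicator_def dist_real_def)
    qed
    finally show ?thesis by simp
  qed
  ultimately show ?thesis by (simp add: fractal_measures_def)
qed

lemma nn_integral_powr_from_0:
  assumes "0 < \<alpha>" "0 \<le> c"
  shows "(\<integral>\<^sup>+y. indicator {0..c} y * ennreal (y powr (\<alpha> - 1)) \<partial>lborel) = ennreal (c powr \<alpha> / \<alpha>)"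
proof -
  have "((\<lambda>y. y powr (\<alpha> - 1)) has_integral (c powr ((\<alpha> - 1) + 1) / ((\<alpha> - 1) + 1))) {0..c}"
    by (rule has_integral_powr_from_0) (use assms in auto)
  hence "((\<lambda>y. y powr (\<alpha> - 1)) has_integral (c powr \<alpha> / \<alpha>)) {0..c}" by simp
  from nn_integral_has_integral_lebesgue[OF _ this]
  have "(\<integral>\<^sup>+y. ennreal (indicator {0..c} y * y powr (\<alpha> - 1)) \<partial>lborel) = ennreal (c powr \<alpha> / \<alpha>)" by simp
  moreover have "ennreal (indicator {0..c} y * y powr (\<alpha> - 1)) = indicator {0..c} y * ennreal (y powr (\<alpha> - 1))" for y :: real
    by (auto simp: indicator_def)
  ultimately show ?thesis by simp
qed

text \<open>This measure gives (0, d) the mass d^\<alpha> / \<alpha>, the largest order that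
  dimension \<alpha> permits near one point. For the ball condition the weight is split at y = r:
  the part below has mass at most r^\<alpha> / \<alpha>, and above it the weight is at most
  r^(\<alpha> - 1) on an interval of length 2 r.\<close>

lemma power_weight_fractal:
  assumes \<alpha>: "0 < \<alpha>" "\<alpha> \<le> 1"
  shows "density lborel (\<lambda>x. ennreal (indicator {0<..<1} x * x powr (\<alpha> - 1))) \<in> fractal_measures \<alpha>"
proof (rule fractal_measure_density[where C = "1 / \<alpha> + 2"])
  fix x r :: real assume r: "0 < r"
  have ball: "ball x r = {x - r<..<x + r}" by (rule ball_eq_greaterThanLessThan)
  have "(\<integral>\<^sup>+y. ennreal (indicator {0<..<1} y * y powr (\<alpha> - 1)) * indicator (ball x r) y \<partial>lborel)
     \<le> (\<integral>\<^sup>+y. indicator {0..r} y * ennreal (y powr (\<alpha> - 1)) + ennreal (r powr (\<alpha> - 1)) * indicator (ball x r) y \<partial>lborel)"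
  proof (intro nn_integral_mono)
    fix y
    show "ennreal (indicator {0<..<1} y * y powr (\<alpha> - 1)) * indicator (ball x r) y \<le>
      indicator {0..r} y * ennreal (y powr (\<alpha> - 1)) + ennreal (r powr (\<alpha> - 1)) * indicator (ball x r) y"
    proof (cases "0 < y \<and> r < y")
      case True
      hence "y powr (\<alpha> - 1) \<le> r powr (\<alpha> - 1)" using \<alpha> r by (intro powr_mono2') auto
      thus ?thesis by (auto simp: indicator_def intro: ennreal_leI)
    qed (auto simp: indicator_def)
  qed
  also have "\<dots> = ennreal (r powr \<alpha> / \<alpha>) + ennreal (r powr (\<alpha> - 1)) * emeasure lborel (ball x r)"
    unfolding ball nn_integral_powr_from_0[OF \<alpha>(1) less_imp_le[OF r], symmetric]
    by (subst nn_integral_add) (auto simp: nn_integral_cmult_indicator)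
  also have "emeasure lborel (ball x r) = ennreal (2 * r)"
    unfolding ball using r by simp
  also have "ennreal (r powr \<alpha> / \<alpha>) + ennreal (r powr (\<alpha> - 1)) * ennreal (2 * r) = ennreal (r powr \<alpha> / \<alpha> + r powr (\<alpha> - 1) * (2 * r))"
    using \<alpha> r by (simp flip: ennreal_mult ennreal_plus)
  also have "r powr \<alpha> / \<alpha> + r powr (\<alpha> - 1) * (2 * r) = (1 / \<alpha> + 2) * r powr \<alpha>"
    using r by (simp add: powr_diff field_simps)
  finally show "(\<integral>\<^sup>+y. ennreal (indicator {0<..<1} y * y powr (\<alpha> - 1)) * indicator (ball x r) y \<partial>lborel) \<le> ennreal ((1 / \<alpha> + 2) * r powr \<alpha>)" .
qed (use \<alpha> in auto)

text \<open>For r \<le> 1 the length 2 r is at most 2 r^\<alpha> since \<alpha> \<le> 1; for larger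
  r the total mass 1 is the better bound.\<close>

lemma lebesgue_fractal:
  assumes \<alpha>: "0 < \<alpha>" "\<alpha> \<le> 1"
  shows "density lborel (\<lambda>x. ennreal (indicator {0<..<1} x)) \<in> fractal_measures \<alpha>"
proof (rule fractal_measure_density[where C = 2])
  fix x r :: real assume r: "0 < r"
  have a: "(\<integral>\<^sup>+y. ennreal (indicator {0<..<1} y) * indicator (ball x r) y \<partial>lborel) \<le> (\<integral>\<^sup>+y. indicator {0<..<1::real} y \<partial>lborel)"
    by (intro nn_integral_mono) (auto simp: indicator_def)
  have b: "(\<integral>\<^sup>+y. ennreal (indicator {0<..<1} y) * indicator (ball x r) y \<partial>lborel) \<le> (\<integral>\<^sup>+y. indicator (ball x r) y \<partial>lborel)"
    by (intro nn_integral_mono) (auto simp: indicator_def)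
  have l: "(\<integral>\<^sup>+y. indicator (ball x r) y \<partial>lborel) = ennreal (2 * r)"
    unfolding ball_eq_greaterThanLessThan using r by simp
  show "(\<integral>\<^sup>+y. ennreal (indicator {0<..<1} y) * indicator (ball x r) y \<partial>lborel) \<le> ennreal (2 * r powr \<alpha>)"
  proof (cases "r \<le> 1")
    case True
    have "r powr 1 \<le> r powr \<alpha>" using True r \<alpha> by (intro powr_mono') auto
    hence "ennreal (2 * r) \<le> ennreal (2 * r powr \<alpha>)" using r by (intro ennreal_leI) simp
    with b[unfolded l] show ?thesis by (rule order_trans)
  next
    case False
    have "1 \<le> r powr \<alpha>" using False \<alpha> by (intro ge_one_powr_ge_zero) auto
    hence 1: "ennreal 1 \<le> ennreal (2 * r powr \<alpha>)" by (intro ennreal_leI) simp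
    have "(\<integral>\<^sup>+y. indicator {0<..<1::real} y \<partial>lborel) = ennreal 1" by simp
    with order_trans[OF a] 1 show ?thesis by (simp only:)
  qed
qed auto

text \<open>The frequencies in \<open>[R, 2 R]\<close> are all made to focus on the curve near the time \<open>1/2\<close>.\<close>

lemma necessity_focusing:
  fixes m \<alpha> q \<kappa> \<theta> s :: real and \<gamma> :: "real \<Rightarrow> real \<Rightarrow> real"
  assumes m: "0 < m" "m < 1" and \<alpha>: "0 < \<alpha>" "\<alpha> \<le> 1" and q: "q \<ge> 2" and \<kappa>: "\<kappa> \<ge> 1" and \<theta>: "\<theta> > 0"
    and \<gamma>: "\<And>x t. \<gamma> x t = x - \<theta> * t powr \<kappa>" and s: "s < 1/2 - m * \<alpha> / q"
  shows "\<exists>\<mu>\<in>fractal_measures \<alpha>. \<not> (\<exists>C::real. \<forall>f\<in>sobolev s.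
               mixed_norm q \<mu> (\<lambda>x t. evol m f t (\<gamma> x t)) \<le> ennreal (C * sobolev_norm s f))"
proof (rule bexI[OF _ power_weight_fractal[OF \<alpha>]])
  define \<mu> where "\<mu> = density lborel (\<lambda>x. ennreal (indicator {0<..<1} x * x powr (\<alpha> - 1)))"
  \<comment> \<open>Reciprocal of a lower bound for the derivative of \<theta> t^\<kappa> on t \<ge>
    1/2; it converts a displacement x into a time difference of at most D x.\<close>
  define D where "D = 1 / (\<theta> * \<kappa> * (1/2) powr (\<kappa> - 1))"
  have D: "D > 0" using \<theta> \<kappa> by (simp add: D_def)
  \<comment> \<open>The three entries serve in turn to stay inside (0, 1), to keep the focusing time
    below 1 through x / \<theta> < 1/2, and to keep the phase error 2 D x R^m below 1/2.\<close>
  define c0 where "c0 = min 1 (min (\<theta> / 2) (1 / (4 * D)))"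
  have c0: "c0 > 0" "c0 \<le> 1" "c0 \<le> \<theta> / 2" "c0 \<le> 1 / (4 * D)" using \<theta> D by (auto simp: c0_def)
  \<comment> \<open>The phase of the evolution at time 1/2 at the point \<gamma>(0, 1/2) = -\<theta>
    (1/2)^\<kappa>; the data cancel it, so all frequencies meet there in phase.\<close>
  define \<psi> where "\<psi> = (\<lambda>\<xi>. - (\<theta> * (1/2) powr \<kappa>) * \<xi> + 1/2 * \<xi> powr m)"
  show "\<not> (\<exists>C::real. \<forall>f\<in>sobolev s.
        mixed_norm q (density lborel (\<lambda>x. ennreal (indicator {0<..<1} x * x powr (\<alpha> - 1)))) (\<lambda>x t. evol m f t (\<gamma> x t)) \<le> ennreal (C * sobolev_norm s f))"
    unfolding \<mu>_def[symmetric]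
  proof (rule maximal_estimate_fails[where b = "\<lambda>R. 2 * R" and \<delta> = "\<lambda>R. c0 * R powr (- m)" and \<psi> = \<psi>
      and ?c1.0 = 1 and ?c2.0 = "c0 powr \<alpha> / \<alpha>" and \<beta> = 1 and \<sigma> = "m * \<alpha>"])
    show "sets \<mu> = sets borel" by (simp add: \<mu>_def)
    show "s < 1 / 2 - m * \<alpha> / q" by (rule s)
    show "\<forall>\<^sub>F R::real in at_top. 2 * R = R + 1 * R powr 1 \<and> 2 * R \<le> 2 * R"
      using eventually_ge_at_top[of 0] by eventually_elim simp
    show "\<psi> \<in> borel_measurable borel" unfolding \<psi>_def by measurable
    show "\<forall>\<^sub>F R in at_top. c0 * R powr - m \<le> 1 \<and> emeasure \<mu> {0<..<c0 * R powr - m} = ennreal (c0 powr \<alpha> / \<alpha> * R powr - (m * \<alpha>))"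
      using eventually_ge_at_top[of 1]
    proof eventually_elim
      case (elim R)
      define d where "d = c0 * R powr - m"
      have "R powr (- m) \<le> 1" using elim m powr_mono[of "- m" 0 R] by simp
      hence d: "0 < d" "d \<le> 1" using c0 elim mult_le_one[of c0 "R powr (- m)"] by (auto simp: d_def)
      have "emeasure \<mu> {0<..<d} = (\<integral>\<^sup>+y. ennreal (indicator {0<..<1} y * y powr (\<alpha> - 1)) * indicator {0<..<d} y \<partial>lborel)"
        by (simp add: \<mu>_def emeasure_density)
      also have "\<dots> = (\<integral>\<^sup>+y. indicator {0..d} y * ennreal (y powr (\<alpha> - 1)) \<partial>lborel)"
      proof (rule nn_integral_cong_AE)
        show "AE y in lborel. ennreal (indicator {0<..<1} y * y powr (\<alpha> - 1)) * indicator {0<..<d} y = indicator {0..d} y * ennreal (y powr (\<alpha> - 1))"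
          using AE_lborel_singleton[of 0] AE_lborel_singleton[of d]
          by eventually_elim (use d in \<open>auto simp: indicator_def\<close>)
      qed
      also have "\<dots> = ennreal (d powr \<alpha> / \<alpha>)" using \<alpha> d by (intro nn_integral_powr_from_0) auto
      also have "d powr \<alpha> / \<alpha> = c0 powr \<alpha> / \<alpha> * R powr - (m * \<alpha>)"
        using c0 elim by (simp add: d_def powr_mult powr_powr)
      finally show ?case using d by (simp add: d_def)
    qed
    show "\<forall>\<^sub>F R in at_top. \<forall>x\<in>{0<..<c0 * R powr - m}. \<exists>t\<in>{0<..<1}. \<exists>p. \<forall>\<xi>\<in>{R..2 * R}. \<bar>\<gamma> x t * \<xi> + t * \<xi> powr m - \<psi> \<xi> - p\<bar> \<le> 1/2"
      using eventually_ge_at_top[of 1]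
    proof (eventually_elim, intro ballI)
      fix R x :: real assume R: "1 \<le> R" and x: "x \<in> {0<..<c0 * R powr - m}"
      have Rm: "R powr (- m) \<le> 1" using R m powr_mono[of "- m" 0 R] by simp
      have "c0 * R powr (- m) \<le> c0 * 1" using c0 by (intro mult_left_mono Rm) auto
      hence xc: "x < c0" using x by auto
      \<comment> \<open>The time t with t^\<kappa> = y solves \<gamma>(x, t) = \<gamma>(0, 1/2): the
        curve through x passes the focal point at a slightly later time. Only the time shift t - 1/2
        then contributes to the phase error.\<close>
      define y where "y = (1/2) powr \<kappa> + x / \<theta>"
      define t where "t = y powr (1 / \<kappa>)"
      have h: "(1/2::real) powr \<kappa> \<le> (1/2) powr 1" using \<kappa> by (intro powr_mono') auto
      have y: "(1/2) powr \<kappa> < y" "y < 1" "0 < y"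
      proof -
        have "x / \<theta> < 1/2" using xc c0 \<theta> by (simp add: field_simps)
        moreover have "0 < x / \<theta>" using x \<theta> by simp
        moreover have "0 \<le> (1/2::real) powr \<kappa>" by simp
        ultimately show "(1/2) powr \<kappa> < y" "y < 1" "0 < y" using h by (simp_all only: y_def powr_one)
      qed
      have tk: "t powr \<kappa> = y" using y \<kappa> by (simp add: t_def powr_powr)
      have t1: "t < 1" using y \<kappa> powr_less_mono2[of "1/\<kappa>" y 1] by (simp add: t_def)
      have t2: "1/2 < t"
      proof -
        have "((1/2) powr \<kappa>) powr (1/\<kappa>) < y powr (1/\<kappa>)" using y \<kappa> by (intro powr_less_mono2) auto
        thus ?thesis using \<kappa> by (simp add: t_def powr_powr)
      qed
      have "\<exists>z. 1/2 < z \<and> z < t \<and> t powr \<kappa> - (1/2) powr \<kappa> = (t - 1/2) * (\<kappa> * z powr (\<kappa> - 1))"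
        by (rule MVT2[OF t2]) (auto intro!: derivative_eq_intros)
      then obtain z where z: "1/2 < z" "t powr \<kappa> - (1/2) powr \<kappa> = (t - 1/2) * (\<kappa> * z powr (\<kappa> - 1))" by blast
      have "(1/2) powr (\<kappa> - 1) \<le> z powr (\<kappa> - 1)" using z \<kappa> by (intro powr_mono2) auto
      hence "(t - 1/2) * (\<kappa> * (1/2) powr (\<kappa> - 1)) \<le> x / \<theta>"
        using z(2) tk t2 \<kappa> mult_left_mono[of "(1/2) powr (\<kappa> - 1)" "z powr (\<kappa> - 1)" "(t - 1/2) * \<kappa>"]
        by (simp add: y_def mult.assoc)
      hence td: "t - 1/2 \<le> D * x" using \<theta> \<kappa> by (simp add: D_def field_simps)
      show "\<exists>t\<in>{0<..<1}. \<exists>p. \<forall>\<xi>\<in>{R..2 * R}. \<bar>\<gamma> x t * \<xi> + t * \<xi> powr m - \<psi> \<xi> - p\<bar> \<le> 1/2"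
      proof (intro bexI exI ballI)
        show "t \<in> {0<..<1}" using t1 t2 by auto
        fix \<xi> assume \<xi>: "\<xi> \<in> {R..2 * R}"
        have g: "\<gamma> x t = - (\<theta> * (1/2) powr \<kappa>)" unfolding \<gamma> tk y_def using \<theta> by (simp add: algebra_simps)
        have "\<gamma> x t * \<xi> + t * \<xi> powr m - \<psi> \<xi> - 0 = (t - 1/2) * \<xi> powr m"
          unfolding g \<psi>_def by (simp add: algebra_simps)
        also have "\<bar>\<dots>\<bar> \<le> (D * x) * (2 * R powr m)"
        proof -
          have "\<xi> powr m \<le> (2 * R) powr m" using \<xi> R m by (intro powr_mono2) auto
          also have "\<dots> = 2 powr m * R powr m" using R by (simp add: powr_mult)
          also have "2 powr m \<le> (2::real) powr 1" using m by (intro powr_mono) auto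
          finally have "\<xi> powr m \<le> 2 * R powr m" by (simp add: mult_right_mono)
          thus ?thesis using td t2 by (simp add: abs_mult mult_mono)
        qed
        also have "\<dots> \<le> (D * (1 / (4 * D) * R powr - m)) * (2 * R powr m)"
        proof -
          have "c0 * R powr - m \<le> 1 / (4 * D) * R powr - m" using c0 by (intro mult_right_mono) auto
          hence "x \<le> 1 / (4 * D) * R powr - m" using x by auto
          thus ?thesis using D by (intro mult_right_mono mult_left_mono) auto
        qed
        also have "\<dots> = 1/2" using D R by (simp add: powr_minus field_simps)
        finally show "\<bar>\<gamma> x t * \<xi> + t * \<xi> powr m - \<psi> \<xi> - 0\<bar> \<le> 1/2" .
      qed
    qed
  qed (use q c0 \<alpha> in auto)
qed

text \<open>A wave packet of frequency width \<open>R\<^bsup>1 - m/2\<^esup>\<close> stays coherent for unit time and moves with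
  speed \<open>m R\<^bsup>m - 1\<^esup>\<close>, so that the curve through every \<open>x\<close> of a fixed interval meets it.\<close>

lemma necessity_wave_packet:
  fixes m \<alpha> q \<kappa> \<theta> s :: real and \<gamma> :: "real \<Rightarrow> real \<Rightarrow> real"
  assumes m: "0 < m" "m < 1" and \<alpha>: "0 < \<alpha>" "\<alpha> \<le> 1" and q: "q \<ge> 2" and \<kappa>: "\<kappa> \<ge> 1" and \<theta>: "\<theta> > 0"
    and \<gamma>: "\<And>x t. \<gamma> x t = x - \<theta> * t powr \<kappa>" and s: "s < 1/2 - m / 4"
  shows "\<exists>\<mu>\<in>fractal_measures \<alpha>. \<not> (\<exists>C::real. \<forall>f\<in>sobolev s.
               mixed_norm q \<mu> (\<lambda>x t. evol m f t (\<gamma> x t)) \<le> ennreal (C * sobolev_norm s f))"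
proof (rule bexI[OF _ lebesgue_fractal[OF \<alpha>]])
  define \<mu> where "\<mu> = density lborel (\<lambda>x. ennreal (indicator {0<..<1::real} x))"
  \<comment> \<open>With x < \<theta> / 2 and R large enough for R^(m - 1) < \<theta> / 2, the value
    h 1 below exceeds x, so that the intermediate value theorem applies.\<close>
  define c0 where "c0 = min 1 (\<theta> / 2)"
  have c0: "c0 > 0" "c0 \<le> 1" "c0 \<le> \<theta> / 2" using \<theta> by (auto simp: c0_def)
  show "\<not> (\<exists>C::real. \<forall>f\<in>sobolev s.
        mixed_norm q (density lborel (\<lambda>x. ennreal (indicator {0<..<1} x))) (\<lambda>x t. evol m f t (\<gamma> x t)) \<le> ennreal (C * sobolev_norm s f))"
    unfolding \<mu>_def[symmetric]
  proof (rule maximal_estimate_fails[where b = "\<lambda>R. R + 1/2 * R powr (1 - m / 2)" and \<delta> = "\<lambda>R. c0" and \<psi> = "\<lambda>_. 0"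
      and ?c1.0 = "1/2" and ?c2.0 = "c0" and \<beta> = "1 - m / 2" and \<sigma> = 0])
    show "sets \<mu> = sets borel" by (simp add: \<mu>_def)
    show "s < (1 - m / 2) / 2 - 0 / q" using s by simp
    show "\<forall>\<^sub>F R::real in at_top. R + 1 / 2 * R powr (1 - m / 2) = R + 1 / 2 * R powr (1 - m / 2) \<and> R + 1 / 2 * R powr (1 - m / 2) \<le> 2 * R"
      using eventually_ge_at_top[of 1]
    proof eventually_elim
      case (elim R)
      have "R powr (1 - m / 2) \<le> R powr 1" using elim m by (intro powr_mono) auto
      thus ?case using elim by simp
    qed
    show "\<forall>\<^sub>F R::real in at_top. c0 \<le> 1 \<and> emeasure \<mu> {0<..<c0} = ennreal (c0 * R powr - 0)"
      using eventually_gt_at_top[of 0]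
    proof eventually_elim
      case (elim R)
      have "emeasure \<mu> {0<..<c0} = (\<integral>\<^sup>+y. ennreal (indicator {0<..<1} y) * indicator {0<..<c0} y \<partial>lborel)"
        by (simp add: \<mu>_def emeasure_density)
      also have "\<dots> = (\<integral>\<^sup>+y. indicator {0<..<c0} y \<partial>lborel)"
        using c0 by (intro nn_integral_cong) (auto simp: indicator_def)
      also have "\<dots> = ennreal c0" using c0 by simp
      finally show ?case using elim c0 by simp
    qed
    have "((\<lambda>R::real. R powr (m - 1)) \<longlongrightarrow> 0) at_top" using m by real_asymp
    hence "\<forall>\<^sub>F R::real in at_top. R powr (m - 1) < \<theta> / 2" using \<theta> by (intro order_tendstoD(2)) auto
    thus "\<forall>\<^sub>F R in at_top. \<forall>x\<in>{0<..<c0}. \<exists>t\<in>{0<..<1}. \<exists>p. \<forall>\<xi>\<in>{R..R + 1 / 2 * R powr (1 - m / 2)}. \<bar>\<gamma> x t * \<xi> + t * \<xi> powr m - 0 - p\<bar> \<le> 1/2"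
      using eventually_ge_at_top[of 1]
    proof (eventually_elim, intro ballI)
      fix R x :: real assume R2: "R powr (m - 1) < \<theta> / 2" and R: "1 \<le> R" and x: "x \<in> {0<..<c0}"
      \<comment> \<open>Solving h t = x places the point \<gamma>(x, t) at -m t R^(m - 1), which is
        where the packet centred at frequency R sits at time t.\<close>
      define h where "h = (\<lambda>t. \<theta> * t powr \<kappa> - m * t * R powr (m - 1))"
      have h0: "h 0 = 0" using \<kappa> by (simp add: h_def)
      have "m * R powr (m - 1) \<le> 1 * R powr (m - 1)" using m by (intro mult_right_mono) auto
      hence h1: "x < h 1" using x c0 R2 by (simp add: h_def)
      have "continuous_on {0..1} h" unfolding h_def using \<kappa>
        by (intro continuous_intros continuous_on_powr') auto
      then obtain t where t: "0 \<le> t" "t \<le> 1" "h t = x" using IVT'[of h 0 x 1] h0 h1 x by auto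
      have t01: "t \<in> {0<..<1}" using t h0 h1 x by (auto simp: less_le)
      show "\<exists>t\<in>{0<..<1}. \<exists>p. \<forall>\<xi>\<in>{R..R + 1 / 2 * R powr (1 - m / 2)}. \<bar>\<gamma> x t * \<xi> + t * \<xi> powr m - 0 - p\<bar> \<le> 1/2"
      proof (intro bexI exI ballI)
        show "t \<in> {0<..<1}" by (rule t01)
        fix \<xi> assume \<xi>: "\<xi> \<in> {R..R + 1 / 2 * R powr (1 - m / 2)}"
        \<comment> \<open>The remainder of \<xi>^m after its tangent at R. At the centre of the
          packet the linear part in \<xi> cancels, and the constant part goes into p.\<close>
        define e where "e = (\<xi> powr m - R powr m) - m * R powr (m - 1) * (\<xi> - R)"
        have g: "\<gamma> x t = - (m * t * R powr (m - 1))" unfolding \<gamma> t(3)[symmetric] h_def by simp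
        have eq: "\<gamma> x t * \<xi> + t * \<xi> powr m - 0 - (- (m * t * R powr (m - 1)) * R + t * R powr m) = t * e"
          unfolding g e_def by (simp add: algebra_simps)
        have "\<bar>e\<bar> \<le> 1/2"
        proof (cases "\<xi> = R")
          case False
          hence \<xi>R: "R < \<xi>" using \<xi> by simp
          have "\<exists>z. R < z \<and> z < \<xi> \<and> \<xi> powr m - R powr m = (\<xi> - R) * (m * z powr (m - 1))"
            by (rule MVT2[OF \<xi>R]) (use R in \<open>auto intro!: derivative_eq_intros\<close>)
          then obtain z where z: "R < z" "z < \<xi>" "\<xi> powr m - R powr m = (\<xi> - R) * (m * z powr (m - 1))" by blast
          have "\<exists>w. R < w \<and> w < z \<and> z powr (m - 1) - R powr (m - 1) = (z - R) * ((m - 1) * w powr (m - 1 - 1))"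
            by (rule MVT2[OF z(1)]) (use R in \<open>auto intro!: derivative_eq_intros\<close>)
          then obtain w where w: "R < w" "z powr (m - 1) - R powr (m - 1) = (z - R) * ((m - 1) * w powr (m - 2))" by auto
          have "e = (\<xi> - R) * m * (z powr (m - 1) - R powr (m - 1))" unfolding e_def z by (simp add: algebra_simps)
          also have "\<bar>\<dots>\<bar> = (\<xi> - R) * (z - R) * (m * (1 - m)) * w powr (m - 2)"
            unfolding w using \<xi>R z m by (simp add: abs_mult)
          \<comment> \<open>Two applications of the mean value theorem produce two factors of at
            most R^(1 - m/2) / 2; the curvature R^(m - 2) compensates exactly. This fixes the width
            of the packet.\<close>
          also have "\<dots> \<le> (1/2 * R powr (1 - m / 2)) * (1/2 * R powr (1 - m / 2)) * (1 * 1) * R powr (m - 2)"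
            using \<xi> \<xi>R z w m R by (intro mult_mono powr_mono2') auto
          also have "\<dots> = 1/4 * (R powr (1 - m / 2) * R powr (1 - m / 2) * R powr (m - 2))" by simp
          also have "\<dots> = 1/4" using R by (simp flip: powr_add)
          finally show ?thesis by simp
        qed (simp add: e_def)
        hence "\<bar>t * e\<bar> \<le> 1 * (1/2)" unfolding abs_mult using t by (intro mult_mono) auto
        thus "\<bar>\<gamma> x t * \<xi> + t * \<xi> powr m - 0 - (- (m * t * R powr (m - 1)) * R + t * R powr m)\<bar> \<le> 1/2"
          unfolding eq by simp
      qed
    qed
  qed (use q c0 in auto)
qed

section \<open>Fractal measures\<close>

lemma fractal_ball_bound:
  assumes "\<mu> \<in> fractal_measures \<alpha>"
  obtains C where "0 \<le> C" "\<And>x r. 0 < r \<Longrightarrow> emeasure \<mu> (ball x r) \<le> ennreal (C * r powr \<alpha>)"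
proof -
  define S where "S = (SUP (x, r)\<in>UNIV \<times> {0<..}. emeasure \<mu> (ball x r) / ennreal (r powr \<alpha>))"
  have S: "S < \<infinity>" using assms by (simp add: fractal_measures_def alpha_dimensional_def S_def)
  define C where "C = enn2real S"
  have SC: "S = ennreal C" using S by (simp add: C_def)
  have "emeasure \<mu> (ball x r) \<le> ennreal (C * r powr \<alpha>)" if r: "0 < r" for x r
  proof -
    define p where "p = r powr \<alpha>"
    have p: "p > 0" using r by (simp add: p_def)
    have "emeasure \<mu> (ball x r) / ennreal p \<le> S"
      unfolding S_def p_def by (rule SUP_upper2[of "(x, r)"]) (use r in auto)
    hence "emeasure \<mu> (ball x r) / ennreal p * ennreal p \<le> ennreal C * ennreal p"
      unfolding SC by (intro mult_right_mono) auto
    also have "emeasure \<mu> (ball x r) / ennreal p * ennreal p = emeasure \<mu> (ball x r) * (ennreal (inverse p) * ennreal p)"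
      using p by (simp add: divide_ennreal_def inverse_ennreal mult.assoc)
    also have "ennreal (inverse p) * ennreal p = 1" using p by (simp flip: ennreal_mult)
    also have "ennreal C * ennreal p = ennreal (C * p)" using p by (simp add: ennreal_mult C_def)
    finally show ?thesis by (simp add: p_def)
  qed
  thus thesis by (intro that[of C]) (auto simp: C_def)
qed

lemma fractal_space: "\<mu> \<in> fractal_measures \<alpha> \<Longrightarrow> space \<mu> = UNIV"
  using sets_eq_imp_space_eq[of \<mu> borel] by (simp add: fractal_measures_def)

lemma fractal_finite_measure:
  assumes \<mu>: "\<mu> \<in> fractal_measures \<alpha>"
  shows "finite_measure \<mu>"
proof (rule finite_measureI)
  obtain C where C: "0 \<le> C" "\<And>x r. 0 < r \<Longrightarrow> emeasure \<mu> (ball x r) \<le> ennreal (C * r powr \<alpha>)"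
    using fractal_ball_bound[OF \<mu>] by blast
  have s: "sets \<mu> = sets borel" "emeasure \<mu> (- ball 0 1) = 0" using \<mu> by (auto simp: fractal_measures_def)
  have "emeasure \<mu> (space \<mu>) = emeasure \<mu> (ball 0 1 \<union> - ball 0 1)" by (simp add: fractal_space[OF \<mu>])
  also have "\<dots> \<le> emeasure \<mu> (ball 0 1) + emeasure \<mu> (- ball 0 1)"
    by (rule emeasure_subadditive) (auto simp: s)
  also have "\<dots> \<le> ennreal C" using C(2)[of 1 0] s by simp
  also have "\<dots> < \<infinity>" by simp
  finally show "emeasure \<mu> (space \<mu>) \<noteq> \<infinity>" by simp
qed

lemma half_power_eq_powr: "(1/2::real) ^ n = 2 powr (- real n)"
  by (simp add: powr_minus powr_realpow power_one_over inverse_eq_divide)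

text \<open>Dyadic shells around x: where |x - y| is between 2^(-j-1) and 2^(-j) the integrand is at
  most 2^(\<sigma> (j + 1)), and the ball has mass at most C 2^(-j \<alpha>). The resulting series
  is geometric because \<sigma> < \<alpha>, with a sum independent of x.\<close>

lemma riesz_potential_bound:
  assumes \<mu>: "\<mu> \<in> fractal_measures \<alpha>" and \<sigma>: "0 \<le> \<sigma>" "\<sigma> < \<alpha>"
  obtains E where "0 < E" "\<And>x. (\<integral>\<^sup>+y. ennreal (\<bar>x - y\<bar> powr (- \<sigma>)) \<partial>\<mu>) \<le> ennreal E"
proof -
  interpret finite_measure \<mu> by (rule fractal_finite_measure[OF \<mu>])
  have s[measurable_cong]: "sets \<mu> = sets borel" using \<mu> by (simp add: fractal_measures_def)
  have [measurable]: "Measurable.pred borel (\<lambda>y. y \<in> ball x r)" for x r :: real unfolding mem_ball by measurable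
  obtain C where C: "0 \<le> C" "\<And>x r. 0 < r \<Longrightarrow> emeasure \<mu> (ball x r) \<le> ennreal (C * r powr \<alpha>)"
    using fractal_ball_bound[OF \<mu>] by blast
  define c where "c = (\<lambda>j::nat. 2 powr (\<sigma> * (real j + 1)))"
  define a where "a = (\<lambda>j::nat. C * 2 powr \<sigma> * (2 powr (\<sigma> - \<alpha>)) ^ j)"
  have sa: "summable a" unfolding a_def using \<sigma> by (intro summable_mult summable_geometric) (simp add: powr_less_one)
  have a0: "0 \<le> a j" for j using C by (simp add: a_def)
  define M where "M = measure \<mu> (space \<mu>)"
  have "(\<integral>\<^sup>+y. ennreal (\<bar>x - y\<bar> powr (- \<sigma>)) \<partial>\<mu>) \<le> ennreal (M + suminf a + 1)" for x
  proof -
    have "(\<integral>\<^sup>+y. ennreal (\<bar>x - y\<bar> powr (- \<sigma>)) \<partial>\<mu>) \<le> (\<integral>\<^sup>+y. 1 + (\<Sum>j. ennreal (c j) * indicator (ball x ((1/2) ^ j)) y) \<partial>\<mu>)"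
    proof (intro nn_integral_mono)
      fix y
      define d where "d = \<bar>x - y\<bar>"
      show "ennreal (\<bar>x - y\<bar> powr (- \<sigma>)) \<le> 1 + (\<Sum>j. ennreal (c j) * indicator (ball x ((1/2) ^ j)) y)"
      proof (cases "0 < d \<and> d < 1")
        case True
        hence d: "0 < d" "d < 1" by auto
        obtain n0 where n0: "(1/2) ^ n0 < d" using real_arch_pow_inv[OF d(1), of "1/2"] by auto
        \<comment> \<open>The least such n brackets the distance as (1/2)^n \<le> d < (1/2)^(n - 1);
          d < 1 excludes n = 0, so the predecessor j indexes the ball.\<close>
        define n where "n = (LEAST n. (1/2) ^ n \<le> d)"
        have n: "(1/2) ^ n \<le> d" unfolding n_def by (rule LeastI[of _ n0]) (use n0 in simp)
        have "n \<noteq> 0" using n d by (cases n) auto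
        then obtain j where j: "n = Suc j" by (cases n) auto
        have "\<not> (1/2) ^ j \<le> d" using not_less_Least[of j "\<lambda>n. (1/2) ^ n \<le> d"] j by (simp add: n_def)
        hence yb: "y \<in> ball x ((1/2) ^ j)" by (simp add: dist_real_def d_def)
        have "d powr (- \<sigma>) \<le> ((1/2) ^ Suc j) powr (- \<sigma>)" using n j \<sigma> by (intro powr_mono2') auto
        also have "(1/2::real) ^ Suc j = 2 powr (- (real j + 1))"
          unfolding half_power_eq_powr by (simp add: add.commute)
        also have "(2 powr (- (real j + 1))) powr (- \<sigma>) = c j" by (simp add: c_def powr_powr algebra_simps)
        finally have "ennreal (d powr (- \<sigma>)) \<le> ennreal (c j)" by (rule ennreal_leI)
        also have "\<dots> = (\<Sum>i\<in>{j}. ennreal (c i) * indicator (ball x ((1/2) ^ i)) y)" using yb by simp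
        also have "\<dots> \<le> (\<Sum>i. ennreal (c i) * indicator (ball x ((1/2) ^ i)) y)" by (rule sum_le_suminf) auto
        also have "\<dots> \<le> 1 + \<dots>" by simp
        finally show ?thesis by (simp add: d_def)
      next
        case False
        \<comment> \<open>Besides d \<ge> 1 this covers y = x, where
          \<open>0 powr (- \<sigma>)\<close> is 0 by convention.\<close>
        have "d powr (- \<sigma>) \<le> 1"
        proof (cases "d = 0")
          case False
          hence "1 \<le> d" using \<open>\<not> (0 < d \<and> d < 1)\<close> by (auto simp: d_def)
          thus ?thesis using \<sigma> powr_mono[of "- \<sigma>" 0 d] by simp
        qed simp
        hence "ennreal (d powr (- \<sigma>)) \<le> ennreal 1" by (rule ennreal_leI)
        also have "\<dots> \<le> 1 + (\<Sum>j. ennreal (c j) * indicator (ball x ((1/2) ^ j)) y)" by simp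
        finally show ?thesis by (simp add: d_def)
      qed
    qed
    also have "\<dots> = (\<integral>\<^sup>+y. 1 \<partial>\<mu>) + (\<integral>\<^sup>+y. (\<Sum>j. ennreal (c j) * indicator (ball x ((1/2) ^ j)) y) \<partial>\<mu>)"
      by (rule nn_integral_add) measurable
    also have "(\<integral>\<^sup>+y. (\<Sum>j. ennreal (c j) * indicator (ball x ((1/2) ^ j)) y) \<partial>\<mu>) = (\<Sum>j. \<integral>\<^sup>+y. ennreal (c j) * indicator (ball x ((1/2) ^ j)) y \<partial>\<mu>)"
      by (rule nn_integral_suminf) measurable
    also have "\<dots> = (\<Sum>j. ennreal (c j) * emeasure \<mu> (ball x ((1/2) ^ j)))"
      by (intro suminf_cong nn_integral_cmult_indicator) (simp add: s)
    also have "\<dots> \<le> (\<Sum>j. ennreal (a j))"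
    proof (intro suminf_le summableI)
      fix j
      have "ennreal (c j) * emeasure \<mu> (ball x ((1/2) ^ j)) \<le> ennreal (c j) * ennreal (C * ((1/2) ^ j) powr \<alpha>)"
        by (intro mult_left_mono C(2)) auto
      also have "\<dots> = ennreal (c j * (C * ((1/2) ^ j) powr \<alpha>))" using C by (simp add: ennreal_mult c_def)
      also have "c j * (C * ((1/2) ^ j) powr \<alpha>) = a j"
      proof -
        have "((1/2::real) ^ j) powr \<alpha> = 2 powr (- (real j * \<alpha>))" unfolding half_power_eq_powr powr_powr by simp
        moreover have "((2::real) powr (\<sigma> - \<alpha>)) ^ j = 2 powr (real j * \<sigma> - real j * \<alpha>)"
          by (simp add: powr_power right_diff_distrib)
        moreover have "c j = 2 powr \<sigma> * 2 powr (real j * \<sigma>)" by (simp add: c_def algebra_simps powr_add)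
        moreover have "(2::real) powr (real j * \<sigma> - real j * \<alpha>) = 2 powr (real j * \<sigma>) * 2 powr (- (real j * \<alpha>))"
          unfolding powr_add[symmetric] by simp
        ultimately show ?thesis by (simp add: a_def)
      qed
      finally show "ennreal (c j) * emeasure \<mu> (ball x ((1/2) ^ j)) \<le> ennreal (a j)" .
    qed
    also have "\<dots> = ennreal (suminf a)" by (rule suminf_ennreal2[OF a0 sa])
    also have "(\<integral>\<^sup>+y. 1 \<partial>\<mu>) = ennreal M" by (simp add: M_def emeasure_eq_measure)
    also have "ennreal M + ennreal (suminf a) \<le> ennreal (M + suminf a + 1)"
      using suminf_nonneg[OF sa a0] by (simp add: M_def flip: ennreal_plus)
    finally show ?thesis by (simp add: add_left_mono)
  qed
  moreover have "0 \<le> M" by (simp add: M_def)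
  hence "0 < M + suminf a + 1" using suminf_nonneg[OF sa a0] by linarith
  ultimately show thesis using that by blast
qed

text \<open>Shrinking balls exclude atoms. The diagonal has to be discarded because the decaying
  kernel bound is available only for distinct points, and its right-hand side would read as 0
  there.\<close>

lemma fractal_AE_neq:
  assumes \<mu>: "\<mu> \<in> fractal_measures \<alpha>" and \<alpha>: "0 < \<alpha>"
  shows "AE y in \<mu>. y \<noteq> x"
proof (rule AE_I)
  obtain C where C: "0 \<le> C" "\<And>x r. 0 < r \<Longrightarrow> emeasure \<mu> (ball x r) \<le> ennreal (C * r powr \<alpha>)"
    using fractal_ball_bound[OF \<mu>] by blast
  have s: "sets \<mu> = sets borel" using \<mu> by (auto simp: fractal_measures_def)
  show "{y \<in> space \<mu>. \<not> y \<noteq> x} \<subseteq> {x}" by auto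
  show "{x} \<in> sets \<mu>" by (simp add: s)
  have "(\<lambda>n. ennreal (C * inverse (real (Suc n)) powr \<alpha>)) \<longlonglongrightarrow> ennreal (C * 0 powr \<alpha>)"
    using \<alpha> by (intro tendsto_ennrealI tendsto_mult tendsto_const tendsto_powr' LIMSEQ_inverse_real_of_nat) auto
  hence "(\<lambda>n. ennreal (C * inverse (real (Suc n)) powr \<alpha>)) \<longlonglongrightarrow> 0" by simp
  moreover have "emeasure \<mu> {x} \<le> ennreal (C * inverse (real (Suc n)) powr \<alpha>)" for n
  proof -
    have "emeasure \<mu> {x} \<le> emeasure \<mu> (ball x (inverse (real (Suc n))))" by (rule emeasure_mono) (auto simp: s)
    also have "\<dots> \<le> ennreal (C * inverse (real (Suc n)) powr \<alpha>)" by (rule C) simp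
    finally show ?thesis .
  qed
  ultimately have "emeasure \<mu> {x} \<le> 0" by (intro tendsto_lowerbound[OF _ always_eventually]) auto
  thus "emeasure \<mu> {x} = 0" by simp
qed

section \<open>Dyadic pieces of the evolution\<close>

text \<open>Sharp frequency cut-offs. Piece 0 absorbs all low frequencies up to 2, where no
  oscillation is exploited; piece k \<ge> 1 begins at 2^k.\<close>

definition dyad :: "nat \<Rightarrow> real set" where
  "dyad k = (if k = 0 then {\<xi>. \<bar>\<xi>\<bar> < 2} else annulus (2 ^ k))"

lemma dyad_sets [measurable]: "dyad k \<in> sets borel"
  unfolding dyad_def by auto

lemma dyad_bounded: "\<xi> \<in> dyad k \<Longrightarrow> \<bar>\<xi>\<bar> < 2 * 2 ^ k"
  by (auto simp: dyad_def annulus_def split: if_splits)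

lemma dyad_subset: "dyad k \<subseteq> {- (2 * 2 ^ k)..2 * 2 ^ k}"
  using dyad_bounded by force

lemma emeasure_dyad: "emeasure lborel (dyad k) < \<infinity>"
proof -
  have "emeasure lborel (dyad k) \<le> emeasure lborel {- (2 * 2 ^ k)..2 * 2 ^ k :: real}"
    by (rule emeasure_mono[OF dyad_subset]) simp
  also have "\<dots> < \<infinity>" by (simp add: emeasure_lborel_Icc_eq)
  finally show ?thesis .
qed

lemma sum_indicator_dyad: "(\<Sum>k<n. indicator (dyad k) \<xi> :: real) = (if n = 0 then 0 else indicator {\<xi>. \<bar>\<xi>\<bar> < 2 ^ n} \<xi>)"
proof (induction n)
  case (Suc n)
  thus ?case by (cases "n = 0") (auto simp: dyad_def annulus_def indicator_def)
qed simp

lemma one_plus_square_ge_on_dyad: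
  assumes "0 \<le> s" "\<xi> \<in> dyad k"
  shows "2 powr (2 * s * real k) \<le> (1 + \<xi>\<^sup>2) powr s"
proof -
  have "(2 ^ k)\<^sup>2 \<le> 1 + \<xi>\<^sup>2"
  proof (cases "k = 0")
    case False
    hence "2 ^ k \<le> \<bar>\<xi>\<bar>" using assms by (auto simp: dyad_def annulus_def)
    hence "(2 ^ k)\<^sup>2 \<le> \<bar>\<xi>\<bar>\<^sup>2" by (intro power_mono) auto
    thus ?thesis by simp
  qed simp
  hence "((2 ^ k)\<^sup>2) powr s \<le> (1 + \<xi>\<^sup>2) powr s" using assms by (intro powr_mono2) auto
  also have "((2 ^ k :: real)\<^sup>2) powr s = 2 powr (2 * s * real k)"
    by (simp add: powr_realpow[symmetric] powr_powr mult_ac flip: powr_numeral)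
  finally show ?thesis .
qed

text \<open>The cut-off is placed in the measure, since the T T* estimate works over a finite
  measure space of frequencies.\<close>

definition dyad_measure :: "nat \<Rightarrow> real measure" where
  "dyad_measure k = density lborel (\<lambda>\<xi>. ennreal (indicator (dyad k) \<xi>))"

lemma sets_dyad_measure [measurable_cong]: "sets (dyad_measure k) = sets borel"
  by (simp add: dyad_measure_def)

lemma finite_dyad_measure: "finite_measure (dyad_measure k)"
proof (rule finite_measureI)
  have "emeasure (dyad_measure k) (space (dyad_measure k)) = emeasure lborel (dyad k)"
    by (simp add: dyad_measure_def emeasure_density ennreal_indicator)
  thus "emeasure (dyad_measure k) (space (dyad_measure k)) \<noteq> \<infinity>" using emeasure_dyad[of k] by simp
qed

lemma integral_dyad_measure:
  fixes f :: "real \<Rightarrow> complex"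
  assumes [measurable]: "f \<in> borel_measurable borel"
  shows "(LINT \<xi>|dyad_measure k. f \<xi>) = (LINT \<xi>|lborel. indicator (dyad k) \<xi> *\<^sub>R f \<xi>)"
  unfolding dyad_measure_def by (rule integral_density) auto

lemma nn_integral_dyad_measure:
  assumes [measurable]: "f \<in> borel_measurable borel"
  shows "(\<integral>\<^sup>+\<xi>. f \<xi> \<partial>dyad_measure k) = (\<integral>\<^sup>+\<xi>. indicator (dyad k) \<xi> * f \<xi> \<partial>lborel)"
  unfolding dyad_measure_def by (subst nn_integral_density) (auto simp: ennreal_indicator)

text \<open>The damping b plays the part of 1 / N^2, with b = 0 for the undamped wave.\<close>

definition damped_wave :: "real \<Rightarrow> real \<Rightarrow> real \<Rightarrow> real \<Rightarrow> real \<Rightarrow> complex" where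
  "damped_wave m t b x \<xi> = complex_of_real (exp (- b * \<xi>\<^sup>2)) * cis (x * \<xi> + t * \<bar>\<xi>\<bar> powr m)"

lemma norm_damped_wave_le: "0 \<le> b \<Longrightarrow> norm (damped_wave m t b x \<xi>) \<le> 1"
  by (simp add: damped_wave_def norm_mult)

text \<open>The T T* kernel stays within the same family: times and positions are subtracted while
  the dampings add up, so b + b' \<ge> 0 and the kernel bounds, uniform in the damping,
  apply.\<close>

lemma damped_wave_cnj:
  "damped_wave m t b x \<xi> * cnj (damped_wave m t' b' x' \<xi>) = damped_wave m (t - t') (b + b') (x - x') \<xi>"
proof -
  have e: "complex_of_real (exp (- b * \<xi>\<^sup>2)) * complex_of_real (exp (- b' * \<xi>\<^sup>2)) = complex_of_real (exp (- (b + b') * \<xi>\<^sup>2))"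
    by (simp add: algebra_simps flip: of_real_mult exp_add)
  have c: "cis (x * \<xi> + t * \<bar>\<xi>\<bar> powr m) * cnj (cis (x' * \<xi> + t' * \<bar>\<xi>\<bar> powr m)) = cis ((x - x') * \<xi> + (t - t') * \<bar>\<xi>\<bar> powr m)"
    by (simp add: cis_cnj cis_mult algebra_simps)
  have "damped_wave m t b x \<xi> * cnj (damped_wave m t' b' x' \<xi>)
    = (complex_of_real (exp (- b * \<xi>\<^sup>2)) * complex_of_real (exp (- b' * \<xi>\<^sup>2))) * (cis (x * \<xi> + t * \<bar>\<xi>\<bar> powr m) * cnj (cis (x' * \<xi> + t' * \<bar>\<xi>\<bar> powr m)))"
    unfolding damped_wave_def complex_cnj_mult complex_cnj_complex_of_real by (simp only: mult_ac)
  thus ?thesis unfolding e c damped_wave_def .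
qed

section \<open>Linearisation and the dyadic maximal estimate\<close>

lemma powr_lipschitz:
  fixes \<kappa> :: real
  assumes "1 \<le> \<kappa>" "t \<in> {0<..<1}" "t' \<in> {0<..<1}"
  shows "\<bar>t powr \<kappa> - t' powr \<kappa>\<bar> \<le> \<kappa> * \<bar>t - t'\<bar>"
proof -
  have *: "\<bar>v powr \<kappa> - u powr \<kappa>\<bar> \<le> \<kappa> * \<bar>v - u\<bar>" if "0 < u" "u < v" "v < 1" for u v :: real
  proof -
    have "\<exists>z. u < z \<and> z < v \<and> v powr \<kappa> - u powr \<kappa> = (v - u) * (\<kappa> * z powr (\<kappa> - 1))"
      by (rule MVT2) (use that in \<open>auto intro!: derivative_eq_intros\<close>)
    then obtain z where z: "u < z" "z < v" "v powr \<kappa> - u powr \<kappa> = (v - u) * (\<kappa> * z powr (\<kappa> - 1))" by blast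
    have "z powr (\<kappa> - 1) \<le> 1" using z that assms(1) by (intro powr_le1) auto
    hence "(v - u) * (\<kappa> * z powr (\<kappa> - 1)) \<le> (v - u) * (\<kappa> * 1)" using that assms(1) by (intro mult_left_mono) auto
    thus ?thesis unfolding z(3) using that assms(1) by (simp add: abs_mult mult.commute)
  qed
  consider "t < t'" | "t = t'" | "t' < t" by linarith
  thus ?thesis
  proof cases
    case 1 thus ?thesis using *[of t t'] assms by (simp add: abs_minus_commute)
  next
    case 3 thus ?thesis using *[of t' t] assms by simp
  qed simp
qed

text \<open>Among the first n functions an index attaining the maximum can be chosen measurably in
  x, so the integral of the finite maximum is a linearised one; monotone convergence passes to the
  full supremum.\<close>

lemma nn_integral_SUP_le_selection:
  fixes F :: "nat \<Rightarrow> 'a \<Rightarrow> ennreal"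
  assumes [measurable]: "\<And>i. F i \<in> borel_measurable M"
    and B: "\<And>j. j \<in> M \<rightarrow>\<^sub>M count_space UNIV \<Longrightarrow> (\<integral>\<^sup>+x. F (j x) x \<partial>M) \<le> B"
  shows "(\<integral>\<^sup>+x. (SUP i. F i x) \<partial>M) \<le> B"
proof -
  define G where "G = (\<lambda>n x. SUP i\<in>{..n}. F i x)"
  have [measurable]: "G n \<in> borel_measurable M" for n unfolding G_def by measurable
  have "(\<integral>\<^sup>+x. G n x \<partial>M) \<le> B" for n
  proof -
    define j where "j = (\<lambda>x. LEAST i. \<forall>i'\<in>{..n}. F i' x \<le> F i x)"
    have j[measurable]: "j \<in> M \<rightarrow>\<^sub>M count_space UNIV" unfolding j_def by measurable
    have "(\<integral>\<^sup>+x. G n x \<partial>M) \<le> (\<integral>\<^sup>+x. F (j x) x \<partial>M)"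
    proof (rule nn_integral_mono)
      fix x
      have "Max ((\<lambda>i. F i x) ` {..n}) \<in> (\<lambda>i. F i x) ` {..n}" by (intro Max_in) auto
      then obtain i where i: "Max ((\<lambda>i. F i x) ` {..n}) = F i x" by blast
      have "\<forall>i'\<in>{..n}. F i' x \<le> F i x" unfolding i[symmetric] by simp
      hence "\<forall>i'\<in>{..n}. F i' x \<le> F (j x) x" unfolding j_def by (rule LeastI)
      thus "G n x \<le> F (j x) x" unfolding G_def by (intro SUP_least) auto
    qed
    also have "\<dots> \<le> B" by (rule B[OF j])
    finally show ?thesis .
  qed
  moreover have "(\<integral>\<^sup>+x. (SUP n. G n x) \<partial>M) = (SUP n. \<integral>\<^sup>+x. G n x \<partial>M)"
    by (rule nn_integral_monotone_convergence_SUP) (auto simp: G_def incseq_def le_fun_def intro!: SUP_subset_mono)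
  moreover have "(SUP i. F i x) = (SUP n. G n x)" for x
  proof (rule antisym)
    show "(SUP i. F i x) \<le> (SUP n. G n x)"
    proof (rule SUP_least)
      fix i
      have "F i x \<le> G i x" unfolding G_def by (intro SUP_upper) auto
      also have "\<dots> \<le> (SUP n. G n x)" by (rule SUP_upper) auto
      finally show "F i x \<le> (SUP n. G n x)" .
    qed
    show "(SUP n. G n x) \<le> (SUP i. F i x)" unfolding G_def by (intro SUP_least SUP_upper) auto
  qed
  ultimately show ?thesis by (simp add: SUP_le_iff)
qed

lemma damped_wave_measurable [measurable (raw)]:
  assumes [measurable]: "t \<in> borel_measurable M" "b \<in> borel_measurable M" "x \<in> borel_measurable M" "\<xi> \<in> borel_measurable M"
  shows "(\<lambda>z. damped_wave m (t z) (b z) (x z) (\<xi> z)) \<in> borel_measurable M"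
  unfolding damped_wave_def by measurable

text \<open>With \<tau> and b functions of x the maximal operator becomes linear in g, as in the
  Kolmogorov-Seliverstov-Plessner method. The kernel at (x, y) decays like |x - y|^(-\<beta>); its
  power q/2 is a Riesz potential of order \<beta> q / 2 < \<alpha>, hence bounded. The constant C is
  the same for all selections \<tau>, b, which is what a maximal estimate requires.\<close>

lemma linearised_dyadic_estimate:
  fixes m \<alpha> q \<kappa> \<theta> \<beta> :: real and \<gamma> :: "real \<Rightarrow> real \<Rightarrow> real"
  assumes m: "0 < m" "m < 1" and \<alpha>: "0 < \<alpha>" and q: "q \<ge> 2" and \<kappa>: "\<kappa> \<ge> 1" and \<theta>: "\<theta> > 0"
    and \<gamma>: "\<And>x t. \<gamma> x t = x - \<theta> * t powr \<kappa>" and \<beta>: "0 \<le> \<beta>" "\<beta> \<le> 1/2" "\<beta> * q / 2 < \<alpha>"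
    and \<mu>: "\<mu> \<in> fractal_measures \<alpha>"
  obtains C where "0 < C"
    "\<And>k \<tau> b g B. \<tau> \<in> borel_measurable borel \<Longrightarrow> b \<in> borel_measurable borel \<Longrightarrow> (\<And>x. \<tau> x \<in> {0<..<1}) \<Longrightarrow> (\<And>x. 0 \<le> b x) \<Longrightarrow>
       g \<in> borel_measurable borel \<Longrightarrow> 0 \<le> B \<Longrightarrow> (\<integral>\<^sup>+\<xi>. ennreal ((cmod (g \<xi>))\<^sup>2) \<partial>dyad_measure k) \<le> ennreal (B\<^sup>2) \<Longrightarrow>
       (\<integral>\<^sup>+x. ennreal (cmod (LINT \<xi>|dyad_measure k. damped_wave m (\<tau> x) (b x) (\<gamma> x (\<tau> x)) \<xi> * g \<xi>) powr q) \<partial>\<mu>)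
         \<le> ennreal ((C * 2 powr (real k * ((1 - m * \<beta>) / 2)) * B) powr q)"
proof -
  have s[measurable_cong]: "sets \<mu> = sets borel" using \<mu> by (simp add: fractal_measures_def)
  obtain C0 where C0: "2 \<le> C0" "\<And>R u \<tau> b d \<beta>. 1 \<le> R \<Longrightarrow> 0 \<le> b \<Longrightarrow> d \<noteq> 0 \<Longrightarrow> \<bar>u - d\<bar> \<le> (\<theta> * \<kappa>) * \<bar>\<tau>\<bar> \<Longrightarrow> 0 \<le> \<beta> \<Longrightarrow> \<beta> \<le> 1/2 \<Longrightarrow>
    norm (LINT x|lborel. indicator (annulus R) x *\<^sub>R (complex_of_real (exp (- b * x\<^sup>2)) * cis (u * x + \<tau> * \<bar>x\<bar> powr m)))
      \<le> C0 * R * (R powr m * \<bar>d\<bar>) powr (- \<beta>)"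
    using annulus_kernel_decay[OF m, of "\<theta> * \<kappa>"] \<theta> \<kappa> by auto
  obtain E where E: "0 < E" "\<And>x. (\<integral>\<^sup>+y. ennreal (\<bar>x - y\<bar> powr (- (\<beta> * q / 2))) \<partial>\<mu>) \<le> ennreal E"
    using riesz_potential_bound[OF \<mu>, of "\<beta> * q / 2"] \<beta> q by auto
  define M where "M = measure \<mu> (space \<mu>)"
  have M: "0 \<le> M" by (simp add: M_def)
  have EM: "emeasure \<mu> (space \<mu>) = ennreal M"
    unfolding M_def by (rule finite_measure.emeasure_eq_measure[OF fractal_finite_measure[OF \<mu>]])
  \<comment> \<open>The first summand serves the annuli k \<ge> 1. The second serves k = 0, where
    the kernel is at most 4, the length of [-2, 2], and M is the total mass of \<mu>.\<close>
  define A0 where "A0 = C0 * E powr (2/q) + 4 * M powr (2/q)"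
  have A0: "A0 > 0" using C0 E by (simp add: A0_def add_pos_nonneg)
  show thesis
  proof (rule that[of "sqrt A0"])
    fix k :: nat and \<tau> b :: "real \<Rightarrow> real" and g :: "real \<Rightarrow> complex" and B :: real
    assume [measurable]: "\<tau> \<in> borel_measurable borel" "b \<in> borel_measurable borel" "g \<in> borel_measurable borel"
      and \<tau>: "\<And>x. \<tau> x \<in> {0<..<1}" and b: "\<And>x. 0 \<le> b x"
      and B: "0 \<le> B" "(\<integral>\<^sup>+\<xi>. ennreal ((cmod (g \<xi>))\<^sup>2) \<partial>dyad_measure k) \<le> ennreal (B\<^sup>2)"
    define U where "U = (\<lambda>x \<xi>. damped_wave m (\<tau> x) (b x) (\<gamma> x (\<tau> x)) \<xi>)"
    define A where "A = A0 * 2 powr (real k * (1 - m * \<beta>))"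
    have A: "A > 0" using A0 by (simp add: A_def)
    have K: "(\<integral>\<^sup>+y. ennreal (cmod (LINT \<xi>|dyad_measure k. U x \<xi> * cnj (U y \<xi>)) powr (q/2)) \<partial>\<mu>) \<le> ennreal (A powr (q/2))" for x
    proof -
      define K where "K = (\<lambda>y. LINT \<xi>|lborel. indicator (dyad k) \<xi> *\<^sub>R damped_wave m (\<tau> x - \<tau> y) (b x + b y) (\<gamma> x (\<tau> x) - \<gamma> y (\<tau> y)) \<xi>)"
      have KU: "(LINT \<xi>|dyad_measure k. U x \<xi> * cnj (U y \<xi>)) = K y" for y
        unfolding U_def damped_wave_cnj K_def by (rule integral_dyad_measure) measurable
      show ?thesis
        unfolding KU
      proof (cases "k = 0")
        case True
        have "cmod (K y) powr (q/2) \<le> 4 powr (q/2)" for y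
        proof -
          have "cmod (K y) \<le> (LINT \<xi>|lborel. indicat_real {-2..2::real} \<xi>)"
            unfolding K_def
          proof (rule norm_integral_le_integral)
            show ind: "integrable lborel (indicat_real {-2..2::real})" by (intro integrable_real_indicator) auto
            show *: "norm (indicator (dyad k) \<xi> *\<^sub>R damped_wave m (\<tau> x - \<tau> y) (b x + b y) (\<gamma> x (\<tau> x) - \<gamma> y (\<tau> y)) \<xi>) \<le> indicat_real {-2..2::real} \<xi>" for \<xi>
              using norm_damped_wave_le[OF add_nonneg_nonneg[OF b b]] True by (auto simp: dyad_def indicator_def)
            show "integrable lborel (\<lambda>\<xi>. indicator (dyad k) \<xi> *\<^sub>R damped_wave m (\<tau> x - \<tau> y) (b x + b y) (\<gamma> x (\<tau> x) - \<gamma> y (\<tau> y)) \<xi>)"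
              by (rule Bochner_Integration.integrable_bound[OF ind]) (use * in \<open>auto intro!: AE_I2\<close>)
          qed
          hence "cmod (K y) \<le> 4" by simp
          thus ?thesis using q by (intro powr_mono2) auto
        qed
        hence "(\<integral>\<^sup>+y. ennreal (cmod (K y) powr (q/2)) \<partial>\<mu>) \<le> (\<integral>\<^sup>+y. ennreal (4 powr (q/2)) \<partial>\<mu>)"
          by (intro nn_integral_mono ennreal_leI) auto
        also have "\<dots> = ennreal (4 powr (q/2) * M)" using M by (simp add: EM ennreal_mult)
        also have "4 powr (q/2) * M = (4 * M powr (2/q)) powr (q/2)" using M q by (simp add: powr_mult powr_powr)
        also have "\<dots> \<le> A powr (q/2)"
          using C0 E M q True by (intro powr_mono2) (auto simp: A_def A0_def)
        finally show "(\<integral>\<^sup>+y. ennreal (cmod (K y) powr (q/2)) \<partial>\<mu>) \<le> ennreal (A powr (q/2))" by (simp add: ennreal_leI)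
      next
        case False
        define R :: real where "R = 2 ^ k"
        have R: "1 \<le> R" by (simp add: R_def)
        define D where "D = C0 * R * (R powr m) powr (- \<beta>)"
        have D: "0 \<le> D" using C0 R by (simp add: D_def)
        have kb: "cmod (K y) powr (q/2) \<le> D powr (q/2) * \<bar>x - y\<bar> powr (- (\<beta> * q / 2))" if "y \<noteq> x" for y
        proof -
          have "cmod (K y) \<le> C0 * R * (R powr m * \<bar>x - y\<bar>) powr (- \<beta>)"
            unfolding K_def damped_wave_def using False unfolding dyad_def
          proof (simp only: if_False R_def[symmetric], intro C0(2))
            \<comment> \<open>The two curve points differ from x - y by \<theta> times a difference
              of \<kappa>-th powers; the Lipschitz bound supplies the kernel hypothesis with L =
              \<theta> \<kappa>.\<close>
            have "\<bar>\<tau> x powr \<kappa> - \<tau> y powr \<kappa>\<bar> \<le> \<kappa> * \<bar>\<tau> x - \<tau> y\<bar>" by (rule powr_lipschitz[OF \<kappa> \<tau> \<tau>])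
            hence "\<theta> * \<bar>\<tau> x powr \<kappa> - \<tau> y powr \<kappa>\<bar> \<le> \<theta> * (\<kappa> * \<bar>\<tau> x - \<tau> y\<bar>)" using \<theta> by (intro mult_left_mono) auto
            moreover have "\<gamma> x (\<tau> x) - \<gamma> y (\<tau> y) - (x - y) = - (\<theta> * (\<tau> x powr \<kappa> - \<tau> y powr \<kappa>))"
              unfolding \<gamma> by (simp add: algebra_simps)
            ultimately show "\<bar>\<gamma> x (\<tau> x) - \<gamma> y (\<tau> y) - (x - y)\<bar> \<le> \<theta> * \<kappa> * \<bar>\<tau> x - \<tau> y\<bar>"
              using \<theta> by (simp add: abs_mult mult.assoc)
          qed (use R b that \<beta> in auto)
          also have "\<dots> = D * \<bar>x - y\<bar> powr (- \<beta>)" using R by (simp add: D_def powr_mult)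
          finally have "cmod (K y) powr (q/2) \<le> (D * \<bar>x - y\<bar> powr (- \<beta>)) powr (q/2)" using q by (intro powr_mono2) auto
          also have "\<dots> = D powr (q/2) * \<bar>x - y\<bar> powr (- (\<beta> * q / 2))" using D by (simp add: powr_mult powr_powr)
          finally show ?thesis .
        qed
        have "(\<integral>\<^sup>+y. ennreal (cmod (K y) powr (q/2)) \<partial>\<mu>) \<le> (\<integral>\<^sup>+y. ennreal (D powr (q/2)) * ennreal (\<bar>x - y\<bar> powr (- (\<beta> * q / 2))) \<partial>\<mu>)"
        proof (rule nn_integral_mono_AE)
          show "AE y in \<mu>. ennreal (cmod (K y) powr (q/2)) \<le> ennreal (D powr (q/2)) * ennreal (\<bar>x - y\<bar> powr (- (\<beta> * q / 2)))"
            using fractal_AE_neq[OF \<mu> \<alpha>, of x] by eventually_elim (simp add: kb ennreal_leI flip: ennreal_mult)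
        qed
        also have "\<dots> = ennreal (D powr (q/2)) * (\<integral>\<^sup>+y. ennreal (\<bar>x - y\<bar> powr (- (\<beta> * q / 2))) \<partial>\<mu>)"
          by (rule nn_integral_cmult) measurable
        also have "\<dots> \<le> ennreal (D powr (q/2)) * ennreal E" by (intro mult_left_mono E) auto
        also have "\<dots> = ennreal (D powr (q/2) * E)" using E by (simp add: ennreal_mult)
        also have "D powr (q/2) * E = (D * E powr (2/q)) powr (q/2)" using D E q by (simp add: powr_mult powr_powr)
        also have "\<dots> \<le> A powr (q/2)"
        proof (rule powr_mono2)
          have "R * (R powr m) powr (- \<beta>) = R powr 1 * R powr (- (m * \<beta>))" using R by (simp add: powr_powr)
          also have "\<dots> = R powr (1 - m * \<beta>)" unfolding powr_add[symmetric] by simp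
          also have "\<dots> = 2 powr (real k * (1 - m * \<beta>))" by (simp add: R_def powr_realpow[symmetric] powr_powr)
          finally have "D = C0 * 2 powr (real k * (1 - m * \<beta>))" by (simp add: D_def mult.assoc)
          thus "D * E powr (2/q) \<le> A" using M by (simp add: A_def A0_def algebra_simps)
        qed (use q D in auto)
        finally show "(\<integral>\<^sup>+y. ennreal (cmod (K y) powr (q/2)) \<partial>\<mu>) \<le> ennreal (A powr (q/2))" by (simp add: ennreal_leI)
      qed
    qed
    have "(\<integral>\<^sup>+x. ennreal (cmod (LINT \<xi>|dyad_measure k. U x \<xi> * g \<xi>) powr q) \<partial>\<mu>) \<le> ennreal ((sqrt A * B) powr q)"
    proof (rule TTstar_estimate[OF fractal_finite_measure[OF \<mu>] finite_dyad_measure q _ _ _ B(2) B(1) A K])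
      show "(\<lambda>(x, \<xi>). U x \<xi>) \<in> borel_measurable (\<mu> \<Otimes>\<^sub>M dyad_measure k)"
        unfolding U_def \<gamma> by measurable
      show "norm (U x \<xi>) \<le> 1" for x \<xi> unfolding U_def by (rule norm_damped_wave_le[OF b])
    qed measurable
    also have "sqrt A = sqrt A0 * 2 powr (real k * ((1 - m * \<beta>) / 2))"
      unfolding A_def by (simp add: real_sqrt_mult powr_half_sqrt[symmetric] powr_powr)
    finally show "(\<integral>\<^sup>+x. ennreal (cmod (LINT \<xi>|dyad_measure k. damped_wave m (\<tau> x) (b x) (\<gamma> x (\<tau> x)) \<xi> * g \<xi>) powr q) \<partial>\<mu>)
         \<le> ennreal ((sqrt A0 * 2 powr (real k * ((1 - m * \<beta>) / 2)) * B) powr q)" by (simp only: U_def)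
  qed (use A0 in simp)
qed

lemma dyadic_piece_tendsto:
  assumes g: "integrable (dyad_measure k) g" and t: "t \<longlonglongrightarrow> t0" and b: "b \<longlonglongrightarrow> b0" "\<And>n. 0 \<le> b n" and x: "x \<longlonglongrightarrow> x0"
  shows "(\<lambda>n. LINT \<xi>|dyad_measure k. damped_wave m (t n) (b n) (x n) \<xi> * g \<xi>) \<longlonglongrightarrow>
     (LINT \<xi>|dyad_measure k. damped_wave m t0 b0 x0 \<xi> * g \<xi>)"
proof (rule integral_dominated_convergence[where w = "\<lambda>\<xi>. norm (g \<xi>)"])
  have [measurable]: "g \<in> borel_measurable borel" using g sets_dyad_measure[of k] by (auto cong: measurable_cong_sets)
  show "(\<lambda>\<xi>. damped_wave m t0 b0 x0 \<xi> * g \<xi>) \<in> borel_measurable (dyad_measure k)" by measurable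
  show "(\<lambda>\<xi>. damped_wave m (t n) (b n) (x n) \<xi> * g \<xi>) \<in> borel_measurable (dyad_measure k)" for n by measurable
  show "integrable (dyad_measure k) (\<lambda>\<xi>. norm (g \<xi>))" using g by simp
  show "AE \<xi> in dyad_measure k. (\<lambda>n. damped_wave m (t n) (b n) (x n) \<xi> * g \<xi>) \<longlonglongrightarrow> damped_wave m t0 b0 x0 \<xi> * g \<xi>"
    unfolding damped_wave_def by (intro AE_I2 tendsto_intros t b x)
  show "AE \<xi> in dyad_measure k. norm (damped_wave m (t n) (b n) (x n) \<xi> * g \<xi>) \<le> norm (g \<xi>)" for n
  proof (rule AE_I2)
    fix \<xi>
    have "norm (damped_wave m (t n) (b n) (x n) \<xi>) * norm (g \<xi>) \<le> 1 * norm (g \<xi>)"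
      by (intro mult_right_mono norm_damped_wave_le b) auto
    thus "norm (damped_wave m (t n) (b n) (x n) \<xi> * g \<xi>) \<le> norm (g \<xi>)" by (simp add: norm_mult)
  qed
qed

lemma integrable_dyad_of_L2:
  assumes [measurable]: "g \<in> borel_measurable borel" and "(\<integral>\<^sup>+\<xi>. ennreal ((cmod (g \<xi>))\<^sup>2) \<partial>dyad_measure k) < \<infinity>"
  shows "integrable (dyad_measure k) g"
proof -
  interpret finite_measure "dyad_measure k" by (rule finite_dyad_measure)
  have "integrable (dyad_measure k) (\<lambda>\<xi>. (cmod (g \<xi>))\<^sup>2)" by (rule integrable_L2I) (use assms in auto)
  thus ?thesis
    using square_integrable_imp_integrable[of "\<lambda>x. cmod (g x)"] integrable_norm_cancel[of "dyad_measure k" g] by simp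
qed

text \<open>The supremum over all times and damping parameters is reduced to a countable dense set of
  parameters, and that to a measurable choice of parameters.\<close>

lemma dyadic_maximal_estimate:
  fixes m \<alpha> q \<kappa> \<theta> \<beta> :: real and \<gamma> :: "real \<Rightarrow> real \<Rightarrow> real"
  assumes m: "0 < m" "m < 1" and \<alpha>: "0 < \<alpha>" and q: "q \<ge> 2" and \<kappa>: "\<kappa> \<ge> 1" and \<theta>: "\<theta> > 0"
    and \<gamma>: "\<And>x t. \<gamma> x t = x - \<theta> * t powr \<kappa>" and \<beta>: "0 \<le> \<beta>" "\<beta> \<le> 1/2" "\<beta> * q / 2 < \<alpha>"
    and \<mu>: "\<mu> \<in> fractal_measures \<alpha>"
  obtains C where "0 < C"
    "\<And>k g B. g \<in> borel_measurable borel \<Longrightarrow> 0 \<le> B \<Longrightarrow> (\<integral>\<^sup>+\<xi>. ennreal ((cmod (g \<xi>))\<^sup>2) \<partial>dyad_measure k) \<le> ennreal (B\<^sup>2) \<Longrightarrow>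
       \<exists>F \<in> borel_measurable borel. (\<integral>\<^sup>+x. F x \<partial>\<mu>) \<le> ennreal ((C * 2 powr (real k * ((1 - m * \<beta>) / 2)) * B) powr q) \<and>
         (\<forall>x. \<forall>t\<in>{0<..<1}. \<forall>b\<ge>0. ennreal (cmod (LINT \<xi>|dyad_measure k. damped_wave m t b (\<gamma> x t) \<xi> * g \<xi>) powr q) \<le> F x)"
proof -
  have s[measurable_cong]: "sets \<mu> = sets borel" using \<mu> by (simp add: fractal_measures_def)
  define P :: "(real \<times> real) set" where "P = ({0<..<1} \<inter> \<rat>) \<times> ({0..} \<inter> \<rat>)"
  have "countable P" unfolding P_def by (intro countable_SIGMA countable_Int2 countable_rat)
  moreover have "(1/2, 0) \<in> P" by (simp add: P_def)
  ultimately have Pr: "range (from_nat_into P) = P" by (intro range_from_nat_into) auto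
  define p where "p = from_nat_into P"
  have p: "fst (p i) \<in> {0<..<1}" "0 \<le> snd (p i)" for i
    using Pr rangeI[of "from_nat_into P" i] by (auto simp: p_def P_def)
  show thesis
  proof (rule linearised_dyadic_estimate[OF m \<alpha> q \<kappa> \<theta> \<gamma> \<beta> \<mu>])
    fix C :: real assume C: "0 < C"
    "\<And>k \<tau> b g B. \<tau> \<in> borel_measurable borel \<Longrightarrow> b \<in> borel_measurable borel \<Longrightarrow> (\<And>x. \<tau> x \<in> {0<..<1}) \<Longrightarrow> (\<And>x. 0 \<le> b x) \<Longrightarrow>
       g \<in> borel_measurable borel \<Longrightarrow> 0 \<le> B \<Longrightarrow> (\<integral>\<^sup>+\<xi>. ennreal ((cmod (g \<xi>))\<^sup>2) \<partial>dyad_measure k) \<le> ennreal (B\<^sup>2) \<Longrightarrow>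
       (\<integral>\<^sup>+x. ennreal (cmod (LINT \<xi>|dyad_measure k. damped_wave m (\<tau> x) (b x) (\<gamma> x (\<tau> x)) \<xi> * g \<xi>) powr q) \<partial>\<mu>)
         \<le> ennreal ((C * 2 powr (real k * ((1 - m * \<beta>) / 2)) * B) powr q)"
  show thesis
  proof (rule that[OF C(1)])
    fix k g and B :: real
    assume g[measurable]: "g \<in> borel_measurable borel" and B: "0 \<le> B" "(\<integral>\<^sup>+\<xi>. ennreal ((cmod (g \<xi>))\<^sup>2) \<partial>dyad_measure k) \<le> ennreal (B\<^sup>2)"
    interpret N: finite_measure "dyad_measure k" by (rule finite_dyad_measure)
    have gi: "integrable (dyad_measure k) g" by (rule integrable_dyad_of_L2[OF g le_less_trans[OF B(2)]]) simp
    define T where "T = (\<lambda>(t, b) x. LINT \<xi>|dyad_measure k. damped_wave m t b (\<gamma> x t) \<xi> * g \<xi>)"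
    have Tm[measurable]: "T z \<in> borel_measurable borel" for z
      unfolding T_def \<gamma> by (cases z) (simp, measurable)
    \<comment> \<open>A countable supremum, hence a measurable majorant; by continuity in the
      parameters it also dominates the value for every real time and damping.\<close>
    define F where "F = (\<lambda>x. SUP i. ennreal (cmod (T (p i) x) powr q))"
    have "(\<integral>\<^sup>+x. F x \<partial>\<mu>) \<le> ennreal ((C * 2 powr (real k * ((1 - m * \<beta>) / 2)) * B) powr q)"
      unfolding F_def
    proof (rule nn_integral_SUP_le_selection)
      fix j :: "real \<Rightarrow> nat" assume "j \<in> \<mu> \<rightarrow>\<^sub>M count_space UNIV"
      hence j: "j \<in> borel \<rightarrow>\<^sub>M count_space UNIV" using s by (simp cong: measurable_cong_sets)
      have [measurable]: "(\<lambda>x. fst (p (j x))) \<in> borel_measurable borel" "(\<lambda>x. snd (p (j x))) \<in> borel_measurable borel"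
        by (rule measurable_compose[OF j]; simp)+
      show "(\<integral>\<^sup>+x. ennreal (cmod (T (p (j x)) x) powr q) \<partial>\<mu>) \<le> ennreal ((C * 2 powr (real k * ((1 - m * \<beta>) / 2)) * B) powr q)"
        using C(2)[of "\<lambda>x. fst (p (j x))" "\<lambda>x. snd (p (j x))" g B k] p B by (simp add: T_def split_beta')
    qed measurable
    moreover have "ennreal (cmod (T (t, b) x) powr q) \<le> F x" if t: "t \<in> {0<..<1}" and b: "0 \<le> b" for x t b
    proof -
      \<comment> \<open>Approximating t and b from the right stays inside the parameter set: the
        times remain in (0, 1) and the dampings nonnegative, also for b = 0.\<close>
      have "\<exists>r\<in>\<rat>. t < r \<and> r < min 1 (t + inverse (real (Suc n)))" for n using t by (intro Rats_dense_in_real) auto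
      then obtain tn where tn: "\<And>n. tn n \<in> \<rat>" "\<And>n. t < tn n" "\<And>n. tn n < min 1 (t + inverse (real (Suc n)))" by metis
      have "\<exists>r\<in>\<rat>. b < r \<and> r < b + inverse (real (Suc n))" for n by (intro Rats_dense_in_real) auto
      then obtain bn where bn: "\<And>n. bn n \<in> \<rat>" "\<And>n. b < bn n" "\<And>n. bn n < b + inverse (real (Suc n))" by metis
      have li: "(\<lambda>n. c + inverse (real (Suc n))) \<longlonglongrightarrow> c" for c :: real
        using tendsto_add[OF tendsto_const LIMSEQ_inverse_real_of_nat, of c] by simp
      have tl: "tn \<longlonglongrightarrow> t"
        by (rule tendsto_sandwich[OF always_eventually always_eventually tendsto_const li[of t]]) (use tn in \<open>auto intro: less_imp_le\<close>)
      have bl: "bn \<longlonglongrightarrow> b"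
        by (rule tendsto_sandwich[OF always_eventually always_eventually tendsto_const li[of b]]) (use bn in \<open>auto intro: less_imp_le\<close>)
      have "(\<lambda>n. \<gamma> x (tn n)) \<longlonglongrightarrow> \<gamma> x t" unfolding \<gamma> using t by (intro tendsto_intros tl) auto
      hence "(\<lambda>n. T (tn n, bn n) x) \<longlonglongrightarrow> T (t, b) x"
        unfolding T_def split_conv using bn(2) b by (intro dyadic_piece_tendsto[OF gi tl bl]) (auto intro: less_imp_le order_trans)
      hence "(\<lambda>n. cmod (T (tn n, bn n) x) powr q) \<longlonglongrightarrow> cmod (T (t, b) x) powr q"
        using q by (intro tendsto_powr' tendsto_norm tendsto_const) auto
      hence lim: "(\<lambda>n. ennreal (cmod (T (tn n, bn n) x) powr q)) \<longlonglongrightarrow> ennreal (cmod (T (t, b) x) powr q)"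
        by (rule tendsto_ennrealI)
      have le: "ennreal (cmod (T (tn n, bn n) x) powr q) \<le> F x" for n
      proof -
        have "0 < tn n" using tn(2)[of n] t by auto
        moreover have "0 \<le> bn n" using bn(2)[of n] b by linarith
        ultimately have "(tn n, bn n) \<in> P" using tn(1,3)[of n] bn(1)[of n] by (auto simp: P_def)
        then obtain i where "p i = (tn n, bn n)" using Pr unfolding p_def by (metis rangeE)
        thus ?thesis unfolding F_def by (intro SUP_upper2[of i]) auto
      qed
      show ?thesis by (rule tendsto_upperbound[OF lim always_eventually]) (use le in auto)
    qed
    moreover have "F \<in> borel_measurable borel" unfolding F_def by measurable
    ultimately show "\<exists>F \<in> borel_measurable borel. (\<integral>\<^sup>+x. F x \<partial>\<mu>) \<le> ennreal ((C * 2 powr (real k * ((1 - m * \<beta>) / 2)) * B) powr q) \<and>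
         (\<forall>x. \<forall>t\<in>{0<..<1}. \<forall>b\<ge>0. ennreal (cmod (LINT \<xi>|dyad_measure k. damped_wave m t b (\<gamma> x t) \<xi> * g \<xi>) powr q) \<le> F x)"
      by (intro bexI[of _ F]) (auto simp: T_def)
  qed
  qed
qed

section \<open>Sufficiency\<close>

lemma mixed_norm_le:
  assumes q: "0 < q" and B: "0 \<le> B"
    and le: "(\<integral>\<^sup>+x\<in>{0<..<1}. (SUP t\<in>{0<..<1}. ennreal (cmod (F x t) powr q)) \<partial>\<mu>) \<le> ennreal (B powr q)"
  shows "mixed_norm q \<mu> F \<le> ennreal B"
proof -
  define J where "J = (\<integral>\<^sup>+x\<in>{0<..<1}. (SUP t\<in>{0<..<1}. ennreal (cmod (F x t) powr q)) \<partial>\<mu>)"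
  have J: "J \<le> ennreal (B powr q)" using le by (simp only: J_def)
  hence "J \<noteq> \<infinity>" by (auto simp: top_unique)
  moreover have "enn2real J \<le> B powr q" using J by (rule enn2real_leI[rotated]) simp
  hence "enn2real J powr (1/q) \<le> (B powr q) powr (1/q)" using q by (intro powr_mono2) auto
  hence "enn2real J powr (1/q) \<le> B" using q B by (simp add: powr_powr)
  ultimately show ?thesis by (simp add: mixed_norm_def ennreal_powr_def J_def[symmetric] ennreal_leI)
qed

lemma dyadic_sums:
  fixes h :: "real \<Rightarrow> complex"
  assumes h: "integrable lborel h"
  shows "(\<lambda>k. LINT \<xi>|dyad_measure k. h \<xi>) sums (LINT \<xi>|lborel. h \<xi>)"
proof -
  have [measurable]: "h \<in> borel_measurable borel" using h by auto
  have i: "integrable lborel (\<lambda>\<xi>. indicator (dyad k) \<xi> *\<^sub>R h \<xi>)" for k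
    by (rule Bochner_Integration.integrable_bound[OF h]) (auto simp: indicator_def)
  have "(\<lambda>n. LINT \<xi>|lborel. (\<Sum>k<n. indicator (dyad k) \<xi>) *\<^sub>R h \<xi>) \<longlonglongrightarrow> (LINT \<xi>|lborel. h \<xi>)"
  proof (rule integral_dominated_convergence[where w = "\<lambda>\<xi>. norm (h \<xi>)"])
    show "integrable lborel (\<lambda>\<xi>. norm (h \<xi>))" using h by simp
    show "AE \<xi> in lborel. (\<lambda>n. (\<Sum>k<n. indicator (dyad k) \<xi>) *\<^sub>R h \<xi>) \<longlonglongrightarrow> h \<xi>"
    proof (rule AE_I2)
      fix \<xi> :: real
      obtain N where N: "\<bar>\<xi>\<bar> < 2 ^ N" using real_arch_pow[of 2 "\<bar>\<xi>\<bar>"] by auto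
      have "\<forall>\<^sub>F n in sequentially. (\<Sum>k<n. indicator (dyad k) \<xi>) *\<^sub>R h \<xi> = h \<xi>"
        using eventually_ge_at_top[of "Suc N"]
      proof eventually_elim
        case (elim n)
        have "(2::real) ^ N \<le> 2 ^ n" using elim by (intro power_increasing) auto
        with N have "\<bar>\<xi>\<bar> < 2 ^ n" by (rule less_le_trans)
        thus ?case unfolding sum_indicator_dyad using elim by (auto simp: indicator_def)
      qed
      thus "(\<lambda>n. (\<Sum>k<n. indicator (dyad k) \<xi>) *\<^sub>R h \<xi>) \<longlonglongrightarrow> h \<xi>" by (rule tendsto_eventually)
    qed
    show "AE \<xi> in lborel. norm ((\<Sum>k<n. indicator (dyad k) \<xi>) *\<^sub>R h \<xi>) \<le> norm (h \<xi>)" for n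
      unfolding sum_indicator_dyad by (rule AE_I2) (auto simp: indicator_def)
  qed auto
  moreover have "(LINT \<xi>|lborel. (\<Sum>k<n. indicator (dyad k) \<xi>) *\<^sub>R h \<xi>) = (\<Sum>k<n. LINT \<xi>|dyad_measure k. h \<xi>)" for n
  proof -
    have "(LINT \<xi>|lborel. (\<Sum>k<n. indicator (dyad k) \<xi>) *\<^sub>R h \<xi>) = (LINT \<xi>|lborel. (\<Sum>k<n. indicator (dyad k) \<xi> *\<^sub>R h \<xi>))"
      by (simp add: scaleR_sum_left)
    also have "\<dots> = (\<Sum>k<n. LINT \<xi>|lborel. indicator (dyad k) \<xi> *\<^sub>R h \<xi>)" by (rule Bochner_Integration.integral_sum[OF i])
    finally show ?thesis by (simp add: integral_dyad_measure)
  qed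
  ultimately show ?thesis unfolding sums_def by simp
qed

lemma integrable_gaussian_mult_L2:
  assumes [measurable]: "g \<in> borel_measurable borel" and g2: "(\<integral>\<^sup>+\<xi>. ennreal ((cmod (g \<xi>))\<^sup>2) \<partial>lborel) < \<infinity>" and b: "0 < b"
    and w[measurable]: "w \<in> borel_measurable borel" "\<And>\<xi>. norm (w \<xi>) \<le> exp (- b * \<xi>\<^sup>2)"
  shows "integrable lborel (\<lambda>\<xi>. w \<xi> * g \<xi>)"
proof (rule integrable_mult_L2)
  show "integrable lborel (\<lambda>\<xi>. (cmod (g \<xi>))\<^sup>2)" by (rule integrable_L2I) (use g2 in auto)
  have "integrable lborel (\<lambda>\<xi>. exp (- (sqrt (4 * b) * \<xi>)\<^sup>2 / 2))" by (rule integrable_gaussian) (use b in simp)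
  hence G: "integrable lborel (\<lambda>\<xi>. exp (- (2 * b) * \<xi>\<^sup>2))" using b by (simp add: power_mult_distrib mult.assoc)
  show "integrable lborel (\<lambda>\<xi>. (cmod (w \<xi>))\<^sup>2)"
  proof (rule Bochner_Integration.integrable_bound[OF G])
    show "AE \<xi> in lborel. norm ((cmod (w \<xi>))\<^sup>2) \<le> norm (exp (- (2 * b) * \<xi>\<^sup>2))"
    proof (rule AE_I2)
      fix \<xi>
      have "(cmod (w \<xi>))\<^sup>2 \<le> (exp (- b * \<xi>\<^sup>2))\<^sup>2" by (intro power_mono w) auto
      also have "\<dots> = exp (- (2 * b) * \<xi>\<^sup>2)" by (simp add: power2_eq_square flip: exp_add)
      finally show "norm ((cmod (w \<xi>))\<^sup>2) \<le> norm (exp (- (2 * b) * \<xi>\<^sup>2))" by simp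
    qed
  qed auto
qed auto

text \<open>The limit \<open>N \<rightarrow> \<infinity>\<close> is taken under the sum over the dyadic pieces, which are summable
  uniformly in \<open>N\<close>.\<close>

lemma evol_bound_of_dyadic_bounds:
  assumes [measurable]: "fhat f \<in> borel_measurable borel" and g2: "(\<integral>\<^sup>+\<xi>. ennreal ((cmod (fhat f \<xi>))\<^sup>2) \<partial>lborel) < \<infinity>"
    and a: "summable a" and bd: "\<And>k b. 0 \<le> b \<Longrightarrow> cmod (LINT \<xi>|dyad_measure k. damped_wave m t b x \<xi> * fhat f \<xi>) \<le> a k"
  shows "evol_defined m f t x" "cmod (evol m f t x) \<le> suminf a"
proof -
  define p where "p = (\<lambda>k b. LINT \<xi>|dyad_measure k. damped_wave m t b x \<xi> * fhat f \<xi>)"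
  define v where "v = complex_of_real (1 / (2 * pi)) * (\<Sum>k. p k 0)"
  have fi: "integrable (dyad_measure k) (fhat f)" for k
  proof (rule integrable_dyad_of_L2)
    have "(\<integral>\<^sup>+\<xi>. ennreal ((cmod (fhat f \<xi>))\<^sup>2) \<partial>dyad_measure k) \<le> (\<integral>\<^sup>+\<xi>. ennreal ((cmod (fhat f \<xi>))\<^sup>2) \<partial>lborel)"
      by (subst nn_integral_dyad_measure) (auto intro!: nn_integral_mono simp: indicator_def)
    thus "(\<integral>\<^sup>+\<xi>. ennreal ((cmod (fhat f \<xi>))\<^sup>2) \<partial>dyad_measure k) < \<infinity>" using g2 by (rule le_less_trans)
  qed measurable
  \<comment> \<open>Since \<open>fhat f\<close> is only known to be in L^2, the Gaussian is what
    makes the integrand integrable and permits the splitting into dyadic pieces for fixed N.\<close>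
  have reg: "evol_reg m f N t x = complex_of_real (1 / (2 * pi)) * (\<Sum>k. p k (1 / N\<^sup>2))" if N: "0 < N" for N
  proof -
    have "integrable lborel (\<lambda>\<xi>. damped_wave m t (1 / N\<^sup>2) x \<xi> * fhat f \<xi>)"
      by (rule integrable_gaussian_mult_L2[OF _ g2, where b = "1 / N\<^sup>2"]) (use N in \<open>auto simp: damped_wave_def norm_mult\<close>)
    from sums_unique[OF dyadic_sums[OF this]]
    have "(\<Sum>k. p k (1 / N\<^sup>2)) = (LINT \<xi>|lborel. damped_wave m t (1 / N\<^sup>2) x \<xi> * fhat f \<xi>)" by (simp add: p_def)
    thus ?thesis by (simp add: evol_reg_def damped_wave_def mult_ac)
  qed
  have "((\<lambda>N. p k (1 / N\<^sup>2)) \<longlongrightarrow> p k 0) at_top" for k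
  proof (rule tendsto_at_topI_sequentially)
    fix X :: "nat \<Rightarrow> real" assume X: "filterlim X at_top sequentially"
    have "((\<lambda>N::real. 1 / N\<^sup>2) \<longlongrightarrow> 0) at_top" by real_asymp
    from filterlim_compose[OF this X] have "(\<lambda>n. 1 / (X n)\<^sup>2) \<longlonglongrightarrow> 0" .
    thus "(\<lambda>n. p k (1 / (X n)\<^sup>2)) \<longlonglongrightarrow> p k 0"
      unfolding p_def by (intro dyadic_piece_tendsto fi tendsto_const) auto
  qed
  moreover have "\<forall>\<^sub>F (k, N) in at_top \<times>\<^sub>F at_top. norm (p k (1 / N\<^sup>2)) \<le> a k"
    by (rule always_eventually) (auto simp: p_def bd)
  \<comment> \<open>Tannery's theorem: the bound \<open>a k\<close> holds for all dampings at once
    and is summable.\<close>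
  ultimately have "((\<lambda>N. \<Sum>k. p k (1 / N\<^sup>2)) \<longlongrightarrow> (\<Sum>k. p k 0)) at_top"
    using tannerys_theorem[of "\<lambda>k N. p k (1 / N\<^sup>2)" "\<lambda>k. p k 0" at_top a] a by simp
  hence "((\<lambda>N. complex_of_real (1 / (2 * pi)) * (\<Sum>k. p k (1 / N\<^sup>2))) \<longlongrightarrow> v) at_top"
    unfolding v_def by (intro tendsto_mult tendsto_const)
  moreover have "\<forall>\<^sub>F N in at_top. evol_reg m f N t x = complex_of_real (1 / (2 * pi)) * (\<Sum>k. p k (1 / N\<^sup>2))"
    using eventually_gt_at_top[of 0] by eventually_elim (rule reg)
  ultimately have lim: "((\<lambda>N. evol_reg m f N t x) \<longlongrightarrow> v) at_top" by (simp add: tendsto_cong)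
  thus d: "evol_defined m f t x" by (auto simp: evol_defined_def)
  have "evol m f t x = v" using d tendsto_Lim[OF _ lim] by (simp add: evol_def)
  also have "cmod v \<le> 1 * suminf a"
    unfolding v_def norm_mult norm_of_real
  proof (intro mult_mono)
    show "\<bar>1 / (2 * pi)\<bar> \<le> 1" using pi_gt3 by simp
    have "summable (\<lambda>k. norm (p k 0))" by (rule summable_comparison_test'[OF a, of 0]) (auto simp: p_def bd)
    hence "norm (\<Sum>k. p k 0) \<le> (\<Sum>k. norm (p k 0))" by (rule summable_norm)
    also have "\<dots> \<le> suminf a" by (rule suminf_le) (use \<open>summable (\<lambda>k. norm (p k 0))\<close> a in \<open>auto simp: p_def bd\<close>)
    finally show "norm (\<Sum>k. p k 0) \<le> suminf a" .
  qed auto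
  finally show "cmod (evol m f t x) \<le> suminf a" by simp
qed

text \<open>Each dyadic piece gains 2^(-\<delta> k). Half of this gain is put into weights c k with
  c k^2 = 2^(-\<delta> k), the other half makes H, the sum of F k / (c k)^q, integrable. Where H is
  finite the piece k is at most c k H^(1/q) for all times and dampings, and summing the c k yields
  both the existence of the limit and a bound by Z2 H^(1/q). Integrating the q-th power of this
  single majorant gives the norm estimate.\<close>

lemma sufficiency:
  fixes m \<alpha> q \<kappa> \<theta> s :: real and \<gamma> :: "real \<Rightarrow> real \<Rightarrow> real"
  assumes m: "0 < m" "m < 1" and \<alpha>: "0 < \<alpha>" "\<alpha> \<le> 1" and q: "q \<ge> 2" and \<kappa>: "\<kappa> \<ge> 1" and \<theta>: "\<theta> > 0"
    and \<gamma>: "\<And>x t. \<gamma> x t = x - \<theta> * t powr \<kappa>" and s: "s > max (1/2 - m/4) (1/2 - m * \<alpha> / q)"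
    and \<mu>: "\<mu> \<in> fractal_measures \<alpha>"
  shows "\<exists>C::real. \<forall>f\<in>sobolev s.
               (AE x in \<mu>. x \<in> {0<..<1} \<longrightarrow> (\<forall>t\<in>{0<..<1}. evol_defined m f t (\<gamma> x t))) \<and>
               mixed_norm q \<mu> (\<lambda>x t. evol m f t (\<gamma> x t)) \<le> ennreal (C * sobolev_norm s f)"
proof -
  have sets[measurable_cong]: "sets \<mu> = sets borel" using \<mu> by (simp add: fractal_measures_def)
  \<comment> \<open>The threshold 1/2 - m/4 is positive, so the Sobolev weight is at least 1 and the
    data lie in L^2.\<close>
  have s0: "s > 0" using s m by auto
  \<comment> \<open>The two lower bounds on s say that (1 - 2 s) / m is below 1/2 and below 2
    \<alpha> / q. Hence there is a \<beta> admissible for the kernel estimate that also satisfies (1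
    - m \<beta>) / 2 < s.\<close>
  have "max 0 ((1 - 2 * s) / m) < min (1/2) (2 * \<alpha> / q)"
  proof -
    have "(1 - 2 * s) / m < 1/2" "(1 - 2 * s) / m < 2 * \<alpha> / q" using s m q by (simp_all add: field_simps)
    thus ?thesis unfolding max_less_iff_conj min_less_iff_conj using \<alpha> q by auto
  qed
  then obtain \<beta> where \<beta>': "max 0 ((1 - 2 * s) / m) < \<beta>" "\<beta> < min (1/2) (2 * \<alpha> / q)" using dense by blast
  have \<beta>'': "0 < \<beta>" "(1 - 2 * s) / m < \<beta>" "\<beta> < 1/2" "\<beta> < 2 * \<alpha> / q"
    using \<beta>' unfolding max_less_iff_conj min_less_iff_conj by auto
  have \<beta>: "0 \<le> \<beta>" "\<beta> \<le> 1/2" "\<beta> * q / 2 < \<alpha>" using \<beta>'' q by (simp_all add: field_simps)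
  \<comment> \<open>The room in s: the dyadic operator norm 2^(k (1 - m \<beta>) / 2) times the
    factor 2^(-s k) from the Sobolev norm is 2^(-\<delta> k).\<close>
  define \<delta> where "\<delta> = s - (1 - m * \<beta>) / 2"
  have \<delta>: "\<delta> > 0" using \<beta>''(2) m by (simp add: \<delta>_def field_simps)
  show ?thesis
  proof (rule dyadic_maximal_estimate[OF m \<alpha>(1) q \<kappa> \<theta> \<gamma> \<beta> \<mu>])
    fix C0 :: real
    assume C0: "0 < C0" "\<And>k g B. g \<in> borel_measurable borel \<Longrightarrow> 0 \<le> B \<Longrightarrow> (\<integral>\<^sup>+\<xi>. ennreal ((cmod (g \<xi>))\<^sup>2) \<partial>dyad_measure k) \<le> ennreal (B\<^sup>2) \<Longrightarrow>
       \<exists>F \<in> borel_measurable borel. (\<integral>\<^sup>+x. F x \<partial>\<mu>) \<le> ennreal ((C0 * 2 powr (real k * ((1 - m * \<beta>) / 2)) * B) powr q) \<and>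
         (\<forall>x. \<forall>t\<in>{0<..<1}. \<forall>b\<ge>0. ennreal (cmod (LINT \<xi>|dyad_measure k. damped_wave m t b (\<gamma> x t) \<xi> * g \<xi>) powr q) \<le> F x)"
    define c where "c = (\<lambda>k::nat. 2 powr (- (\<delta> / 2) * real k))"
    have c0: "0 < c k" for k by (simp add: c_def)
    have c_geo: "c k = (2 powr (- (\<delta> / 2))) ^ k" for k by (simp add: c_def powr_power mult.commute)
    have cs: "summable c" unfolding c_geo by (rule summable_geometric) (use \<delta> in \<open>simp add: powr_less_one\<close>)
    have cq: "c k powr q = (2 powr (- (\<delta> / 2) * q)) ^ k" for k by (simp add: c_def powr_power powr_powr mult_ac)
    have cqs: "summable (\<lambda>k. c k powr q)" unfolding cq by (rule summable_geometric) (use \<delta> q in \<open>simp add: powr_less_one\<close>)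
    define Z1 where "Z1 = (\<Sum>k. c k powr q)"
    define Z2 where "Z2 = suminf c"
    have Z: "0 \<le> Z1" "0 \<le> Z2"
      unfolding Z1_def Z2_def by (rule suminf_nonneg[OF cqs], simp) (rule suminf_nonneg[OF cs less_imp_le[OF c0]])
    \<comment> \<open>Z2 comes from summing the pieces pointwise, Z1^(1/q) from the integral of H,
      and sqrt(2 pi) from passing between the Sobolev norm and \<open>fhat\<close>.\<close>
    define C where "C = Z2 * (C0 * sqrt (2 * pi)) * Z1 powr (1/q)"
    show ?thesis
    proof (intro exI[of _ C] ballI)
      fix f assume f: "f \<in> sobolev s"
      define S where "S = sqrt (2 * pi) * sobolev_norm s f"
      have S: "0 \<le> S" by (simp add: S_def sobolev_norm_def L2_norm_def)
      have S2: "S\<^sup>2 = 2 * pi * (sobolev_norm s f)\<^sup>2" by (simp add: S_def power_mult_distrib)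
      have [measurable]: "fhat f \<in> borel_measurable borel" by (rule sobolev_fhat(1)[OF f])
      have fS: "(\<integral>\<^sup>+\<xi>. ennreal ((1 + \<xi>\<^sup>2) powr s * (cmod (fhat f \<xi>))\<^sup>2) \<partial>lborel) \<le> ennreal (S\<^sup>2)"
        using sobolev_fhat(2)[OF f] by (simp only: S2)
      have f2: "(\<integral>\<^sup>+\<xi>. ennreal ((cmod (fhat f \<xi>))\<^sup>2) \<partial>lborel) < \<infinity>"
      proof -
        have "(\<integral>\<^sup>+\<xi>. ennreal ((cmod (fhat f \<xi>))\<^sup>2) \<partial>lborel) \<le> (\<integral>\<^sup>+\<xi>. ennreal ((1 + \<xi>\<^sup>2) powr s * (cmod (fhat f \<xi>))\<^sup>2) \<partial>lborel)"
        proof (intro nn_integral_mono ennreal_leI)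
          fix \<xi> :: real
          have "1 \<le> (1 + \<xi>\<^sup>2) powr s" using s0 by (intro ge_one_powr_ge_zero) auto
          from mult_right_mono[OF this, of "(cmod (fhat f \<xi>))\<^sup>2"]
          show "(cmod (fhat f \<xi>))\<^sup>2 \<le> (1 + \<xi>\<^sup>2) powr s * (cmod (fhat f \<xi>))\<^sup>2" by simp
        qed
        also note fS
        also have "ennreal (S\<^sup>2) < \<infinity>" by simp
        finally show ?thesis .
      qed
      \<comment> \<open>On \<open>dyad k\<close> the weight (1 + \<xi>^2)^s is at least 2^(2 s k),
        which bounds the L^2 norm of that piece of \<open>fhat f\<close> by 2^(-s k) S.\<close>
      define B where "B = (\<lambda>k::nat. 2 powr (- s * real k) * S)"
      have B0: "0 \<le> B k" for k using S by (simp add: B_def)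
      have fB: "(\<integral>\<^sup>+\<xi>. ennreal ((cmod (fhat f \<xi>))\<^sup>2) \<partial>dyad_measure k) \<le> ennreal ((B k)\<^sup>2)" for k
      proof -
        define w where "w = 2 powr (2 * s * real k)"
        have w: "0 < w" by (simp add: w_def)
        have "(\<integral>\<^sup>+\<xi>. ennreal ((cmod (fhat f \<xi>))\<^sup>2) \<partial>dyad_measure k) = (\<integral>\<^sup>+\<xi>. indicator (dyad k) \<xi> * ennreal ((cmod (fhat f \<xi>))\<^sup>2) \<partial>lborel)"
          by (rule nn_integral_dyad_measure) measurable
        also have "\<dots> \<le> (\<integral>\<^sup>+\<xi>. ennreal (1 / w) * ennreal ((1 + \<xi>\<^sup>2) powr s * (cmod (fhat f \<xi>))\<^sup>2) \<partial>lborel)"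
        proof (intro nn_integral_mono)
          fix \<xi>
          show "indicator (dyad k) \<xi> * ennreal ((cmod (fhat f \<xi>))\<^sup>2) \<le> ennreal (1 / w) * ennreal ((1 + \<xi>\<^sup>2) powr s * (cmod (fhat f \<xi>))\<^sup>2)"
          proof (cases "\<xi> \<in> dyad k")
            case True
            have "w \<le> (1 + \<xi>\<^sup>2) powr s" unfolding w_def by (rule one_plus_square_ge_on_dyad[OF less_imp_le[OF s0] True])
            from mult_right_mono[OF this, of "(cmod (fhat f \<xi>))\<^sup>2"]
            have "(cmod (fhat f \<xi>))\<^sup>2 \<le> 1 / w * ((1 + \<xi>\<^sup>2) powr s * (cmod (fhat f \<xi>))\<^sup>2)"
              using w by (simp add: field_simps)
            thus ?thesis using True w by (simp add: ennreal_leI flip: ennreal_mult)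
          qed simp
        qed
        also have "\<dots> = ennreal (1 / w) * (\<integral>\<^sup>+\<xi>. ennreal ((1 + \<xi>\<^sup>2) powr s * (cmod (fhat f \<xi>))\<^sup>2) \<partial>lborel)"
          by (rule nn_integral_cmult) measurable
        also have "\<dots> \<le> ennreal (1 / w) * ennreal (S\<^sup>2)" by (intro mult_left_mono fS) auto
        also have "\<dots> = ennreal (1 / w * S\<^sup>2)" by (rule ennreal_mult[symmetric]) (use w in auto)
        also have "1 / w * S\<^sup>2 = (B k)\<^sup>2"
        proof -
          have e: "(2 powr (- s * real k))\<^sup>2 = (2::real) powr (- (2 * s * real k))"
            unfolding power2_eq_square powr_add[symmetric] by (simp add: algebra_simps)
          show ?thesis unfolding B_def w_def power_mult_distrib e by (simp add: powr_minus_divide)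
        qed
        finally show ?thesis .
      qed
      define Q where "Q = (\<lambda>k F. F \<in> borel_measurable borel \<and> (\<integral>\<^sup>+x. F x \<partial>\<mu>) \<le> ennreal ((C0 * 2 powr (real k * ((1 - m * \<beta>) / 2)) * B k) powr q) \<and>
         (\<forall>x. \<forall>t\<in>{0<..<1}. \<forall>b\<ge>0. ennreal (cmod (LINT \<xi>|dyad_measure k. damped_wave m t b (\<gamma> x t) \<xi> * fhat f \<xi>) powr q) \<le> F x))"
      have "\<exists>F. Q k F" for k using C0(2)[OF sobolev_fhat(1)[OF f] B0 fB, of k] unfolding Q_def Bex_def .
      from choice[OF allI[OF this]] obtain F where "\<forall>k. Q k (F k)" ..
      hence F: "\<And>k. F k \<in> borel_measurable borel"
        "\<And>k. (\<integral>\<^sup>+x. F k x \<partial>\<mu>) \<le> ennreal ((C0 * 2 powr (real k * ((1 - m * \<beta>) / 2)) * B k) powr q)"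
        "\<And>k x t b. t \<in> {0<..<1} \<Longrightarrow> 0 \<le> b \<Longrightarrow> ennreal (cmod (LINT \<xi>|dyad_measure k. damped_wave m t b (\<gamma> x t) \<xi> * fhat f \<xi>) powr q) \<le> F k x"
        by (simp_all add: Q_def)
      note F(1)[measurable]
      \<comment> \<open>One integrable function controls all pieces: each summand is at most H, so F
        k \<le> (c k)^q H pointwise.\<close>
      define H where "H = (\<lambda>x. \<Sum>k. ennreal (1 / c k powr q) * F k x)"
      have [measurable]: "H \<in> borel_measurable borel" unfolding H_def by measurable
      have F2: "ennreal (1 / c k powr q) * (\<integral>\<^sup>+x. F k x \<partial>\<mu>) \<le> ennreal ((C0 * S) powr q * c k powr q)" for k
      proof -
        have e: "C0 * 2 powr (real k * ((1 - m * \<beta>) / 2)) * B k = C0 * S * (c k * c k)"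
        proof -
          have "2 powr (real k * ((1 - m * \<beta>) / 2)) * 2 powr (- s * real k) = (2::real) powr (- \<delta> * real k)"
            unfolding powr_add[symmetric] \<delta>_def by (simp add: algebra_simps add_divide_distrib diff_divide_distrib)
          also have "\<dots> = c k * c k" unfolding c_def powr_add[symmetric] by simp
          finally show ?thesis by (simp add: B_def)
        qed
        have "(C0 * S * (c k * c k)) powr q = (C0 * S) powr q * (c k powr q * c k powr q)"
          using C0(1) S c0[of k] by (simp add: powr_mult)
        with F(2)[of k] have "(\<integral>\<^sup>+x. F k x \<partial>\<mu>) \<le> ennreal ((C0 * S) powr q * (c k powr q * c k powr q))"
          unfolding e by (simp only:)
        hence "ennreal (1 / c k powr q) * (\<integral>\<^sup>+x. F k x \<partial>\<mu>) \<le> ennreal (1 / c k powr q) * ennreal ((C0 * S) powr q * (c k powr q * c k powr q))"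
          by (intro mult_left_mono) auto
        also have "\<dots> = ennreal (1 / c k powr q * ((C0 * S) powr q * (c k powr q * c k powr q)))"
          by (rule ennreal_mult[symmetric]) auto
        also have "1 / c k powr q * ((C0 * S) powr q * (c k powr q * c k powr q)) = (C0 * S) powr q * c k powr q"
          using c0[of k] by simp
        finally show ?thesis .
      qed
      have "(\<integral>\<^sup>+x. H x \<partial>\<mu>) = (\<Sum>k. \<integral>\<^sup>+x. ennreal (1 / c k powr q) * F k x \<partial>\<mu>)"
        unfolding H_def by (rule nn_integral_suminf) measurable
      also have "\<dots> = (\<Sum>k. ennreal (1 / c k powr q) * (\<integral>\<^sup>+x. F k x \<partial>\<mu>))"
        by (intro suminf_cong nn_integral_cmult) measurable
      also have "\<dots> \<le> (\<Sum>k. ennreal ((C0 * S) powr q * c k powr q))"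
        by (intro suminf_le summableI F2)
      also have "\<dots> = ennreal (\<Sum>k. (C0 * S) powr q * c k powr q)"
        by (rule suminf_ennreal2) (auto intro!: summable_mult cqs)
      also have "(\<Sum>k. (C0 * S) powr q * c k powr q) = (C0 * S) powr q * Z1"
        unfolding Z1_def by (rule suminf_mult[OF cqs])
      finally have HI: "(\<integral>\<^sup>+x. H x \<partial>\<mu>) \<le> ennreal ((C0 * S) powr q * Z1)" .
      hence "(\<integral>\<^sup>+x. H x \<partial>\<mu>) \<noteq> \<infinity>" by (auto simp: top_unique)
      hence HAE: "AE x in \<mu>. H x \<noteq> \<infinity>" by (intro nn_integral_PInf_AE) auto
      have key: "evol_defined m f t (\<gamma> x t) \<and> ennreal (cmod (evol m f t (\<gamma> x t)) powr q) \<le> ennreal (Z2 powr q) * H x"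
        if Hx: "H x \<noteq> \<infinity>" and t: "t \<in> {0<..<1}" for x t
      proof -
        define h where "h = enn2real (H x)"
        have h: "H x = ennreal h" "0 \<le> h" using Hx by (auto simp: h_def less_top)
        define a where "a = (\<lambda>k. c k * h powr (1/q))"
        have a: "summable a" unfolding a_def by (rule summable_mult2[OF cs])
        have sa: "suminf a = Z2 * h powr (1/q)" unfolding a_def Z2_def by (rule suminf_mult2[OF cs, symmetric])
        have bd: "cmod (LINT \<xi>|dyad_measure k. damped_wave m t b (\<gamma> x t) \<xi> * fhat f \<xi>) \<le> a k" if b: "0 \<le> b" for k b
        proof -
          define z where "z = cmod (LINT \<xi>|dyad_measure k. damped_wave m t b (\<gamma> x t) \<xi> * fhat f \<xi>)"
          have z0: "0 \<le> z" by (simp add: z_def)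
          have "ennreal (1 / c k powr q) * ennreal (z powr q) \<le> ennreal (1 / c k powr q) * F k x"
            unfolding z_def by (intro mult_left_mono F(3) t b) auto
          also have "\<dots> = (\<Sum>i\<in>{k}. ennreal (1 / c i powr q) * F i x)" by simp
          also have "\<dots> \<le> H x" unfolding H_def by (rule sum_le_suminf) auto
          finally have "ennreal (1 / c k powr q * z powr q) \<le> ennreal h" unfolding h by (subst ennreal_mult) auto
          hence "1 / c k powr q * z powr q \<le> h" using h(2) by (simp add: ennreal_le_iff)
          hence "z powr q \<le> c k powr q * h" using c0[of k] by (simp add: field_simps)
          hence "(z powr q) powr (1/q) \<le> (c k powr q * h) powr (1/q)" using q by (intro powr_mono2) auto
          thus ?thesis using q z0 h(2) c0[of k] by (simp add: powr_powr powr_mult a_def z_def)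
        qed
        note ev = evol_bound_of_dyadic_bounds[OF _ f2 a bd]
        have "cmod (evol m f t (\<gamma> x t)) powr q \<le> (Z2 * h powr (1/q)) powr q"
          using ev(2) q by (intro powr_mono2) (auto simp: sa)
        also have "\<dots> = Z2 powr q * h" using Z h q by (simp add: powr_mult powr_powr)
        finally have "ennreal (cmod (evol m f t (\<gamma> x t)) powr q) \<le> ennreal (Z2 powr q * h)" by (rule ennreal_leI)
        thus ?thesis using ev(1) h by (simp add: ennreal_mult)
      qed
      have "AE x in \<mu>. x \<in> {0<..<1} \<longrightarrow> (\<forall>t\<in>{0<..<1}. evol_defined m f t (\<gamma> x t))"
        using HAE by eventually_elim (use key in blast)
      moreover have "mixed_norm q \<mu> (\<lambda>x t. evol m f t (\<gamma> x t)) \<le> ennreal (C * sobolev_norm s f)"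
      proof (rule mixed_norm_le)
        show "0 \<le> C * sobolev_norm s f" using Z C0(1) by (simp add: C_def sobolev_norm_def L2_norm_def)
        have "(\<integral>\<^sup>+x\<in>{0<..<1}. (SUP t\<in>{0<..<1}. ennreal (cmod (evol m f t (\<gamma> x t)) powr q)) \<partial>\<mu>) \<le> (\<integral>\<^sup>+x. ennreal (Z2 powr q) * H x \<partial>\<mu>)"
        proof (rule nn_integral_mono_AE)
          show "AE x in \<mu>. (SUP t\<in>{0<..<1}. ennreal (cmod (evol m f t (\<gamma> x t)) powr q)) * indicator {0<..<1} x \<le> ennreal (Z2 powr q) * H x"
            using HAE
          proof eventually_elim
            case (elim x)
            have "(SUP t\<in>{0<..<1}. ennreal (cmod (evol m f t (\<gamma> x t)) powr q)) \<le> ennreal (Z2 powr q) * H x"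
              by (rule SUP_least) (use key[OF elim] in blast)
            thus ?case by (auto simp: indicator_def)
          qed
        qed
        also have "\<dots> = ennreal (Z2 powr q) * (\<integral>\<^sup>+x. H x \<partial>\<mu>)" by (rule nn_integral_cmult) measurable
        also have "\<dots> \<le> ennreal (Z2 powr q) * ennreal ((C0 * S) powr q * Z1)" by (intro mult_left_mono HI) auto
        also have "\<dots> = ennreal (Z2 powr q * ((C0 * S) powr q * Z1))" using Z by (intro ennreal_mult[symmetric]) auto
        also have "Z2 powr q * ((C0 * S) powr q * Z1) = (C * sobolev_norm s f) powr q"
        proof -
          have "C * sobolev_norm s f = Z2 * (C0 * S) * Z1 powr (1/q)" by (simp add: C_def S_def)
          thus ?thesis using Z C0(1) S q by (simp add: powr_mult powr_powr)
        qed
        finally show "(\<integral>\<^sup>+x\<in>{0<..<1}. (SUP t\<in>{0<..<1}. ennreal (cmod (evol m f t (\<gamma> x t)) powr q)) \<partial>\<mu>) \<le> ennreal ((C * sobolev_norm s f) powr q)" .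
      qed (use q in simp)
      ultimately show "(AE x in \<mu>. x \<in> {0<..<1} \<longrightarrow> (\<forall>t\<in>{0<..<1}. evol_defined m f t (\<gamma> x t))) \<and>
               mixed_norm q \<mu> (\<lambda>x t. evol m f t (\<gamma> x t)) \<le> ennreal (C * sobolev_norm s f)" ..
    qed
  qed
qed

section \<open>The main theorem\<close>

theorem mainTheorem5:
  fixes m \<alpha> q \<kappa> \<theta> s :: real and \<gamma> :: "real \<Rightarrow> real \<Rightarrow> real"
  assumes "0 < m" "m < 1" and "0 < \<alpha>" "\<alpha> \<le> 1" and "q \<ge> 2" and "\<kappa> \<ge> 1" and "\<theta> > 0"
    and "\<And>x t. \<gamma> x t = x - \<theta> * t powr \<kappa>"
  shows "(s > max (1/2 - m/4) (1/2 - m * \<alpha> / q) \<longrightarrow>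
            (\<forall>\<mu>\<in>fractal_measures \<alpha>. \<exists>C::real. \<forall>f\<in>sobolev s.
               (AE x in \<mu>. x \<in> {0<..<1} \<longrightarrow> (\<forall>t\<in>{0<..<1}. evol_defined m f t (\<gamma> x t))) \<and>
               mixed_norm q \<mu> (\<lambda>x t. evol m f t (\<gamma> x t)) \<le> ennreal (C * sobolev_norm s f))) \<and>
         (s < max (1/2 - m/4) (1/2 - m * \<alpha> / q) \<longrightarrow>
            (\<exists>\<mu>\<in>fractal_measures \<alpha>. \<not> (\<exists>C::real. \<forall>f\<in>sobolev s.
               mixed_norm q \<mu> (\<lambda>x t. evol m f t (\<gamma> x t)) \<le> ennreal (C * sobolev_norm s f))))"
proof (intro conjI impI)
  assume "s > max (1/2 - m/4) (1/2 - m * \<alpha> / q)"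
  thus "\<forall>\<mu>\<in>fractal_measures \<alpha>. \<exists>C::real. \<forall>f\<in>sobolev s.
      (AE x in \<mu>. x \<in> {0<..<1} \<longrightarrow> (\<forall>t\<in>{0<..<1}. evol_defined m f t (\<gamma> x t))) \<and>
      mixed_norm q \<mu> (\<lambda>x t. evol m f t (\<gamma> x t)) \<le> ennreal (C * sobolev_norm s f)"
    using assms by (intro ballI sufficiency)
next
  assume "s < max (1/2 - m/4) (1/2 - m * \<alpha> / q)"
  then consider "s < 1/2 - m/4" | "s < 1/2 - m * \<alpha> / q" by (auto simp: less_max_iff_disj)
  thus "\<exists>\<mu>\<in>fractal_measures \<alpha>. \<not> (\<exists>C::real. \<forall>f\<in>sobolev s.
      mixed_norm q \<mu> (\<lambda>x t. evol m f t (\<gamma> x t)) \<le> ennreal (C * sobolev_norm s f))"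
  proof cases
    case 1 thus ?thesis using assms by (intro necessity_wave_packet)
  next
    case 2 thus ?thesis using assms by (intro necessity_focusing)
  qed
qed

end
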